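(* Let $\pi$ be a convex polygon with $n$ vertices and let $k$ be an integer with $k\leq n/8-5/2$. Then a triangulation $T$ of $\pi$ has eccentricity $n-3+k$ in the flip-graph of $\pi$ if and only if there exists a vertex of $\pi$ that is incident to exactly $n-3-k$ interior edges of $T$.
   Context: Let $\pi$ be a convex polygon with $n$ vertices. An edge on $\pi$ is a set of exactly two vertices of $\pi$; two such edges cross when the relative interiors of the corresponding line segments intersect and the edges are distinct. The edges of $\pi$ itself are its $n$ sides. A triangulation of $\pi$ is an inclusion-maximal set of pairwise non-crossing edges on $\pi$; it contains all sides of $\pi$ (its boundary edges), and its remaining edges are called its interior edges (there are $n-3$ of them). A flip removes one interior edge from a triangulation and replaces it by the only other edge such that the result is again a triangulation of $\pi$. The flip-graph of $\pi$ is the graph whose vertices are the triangulations of $\pi$, two triangulations being adjacent when they differ by a single flip. The eccentricity of a vertex $v$ in a graph $G$ is the largest possible distance in $G$ from $v$ to any vertex of $G$. *)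

theory Defs
  imports "HOL-Analysis.Analysis" "Graph_Theory.Graph_Theory"
begin

definition convex_polygon :: "(real^2) set \<Rightarrow> bool" where
  "convex_polygon P \<longleftrightarrow> polytope P \<and> aff_dim P = 2"

definition vertices :: "(real^2) set \<Rightarrow> (real^2) set" where
  "vertices P = {v. v extreme_point_of P}"

definition edges_on :: "(real^2) set \<Rightarrow> (real^2) set set" where
  "edges_on P = {e. e \<subseteq> vertices P \<and> card e = 2}"

text \<open>For a set \<open>e\<close> of two points, \<open>convex hull e\<close> is the line segment between them.\<close>

definition crosses :: "(real^2) set \<Rightarrow> (real^2) set \<Rightarrow> bool" where
  "crosses e f \<longleftrightarrow>
     e \<noteq> f \<and> rel_interior (convex hull e) \<inter> rel_interior (convex hull f) \<noteq> {}"

definition noncrossing_edges_on :: "(real^2) set \<Rightarrow> (real^2) set set \<Rightarrow> bool" where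
  "noncrossing_edges_on P E \<longleftrightarrow> E \<subseteq> edges_on P \<and> (\<forall>e\<in>E. \<forall>f\<in>E. \<not> crosses e f)"

definition polygon_triangulation :: "(real^2) set \<Rightarrow> (real^2) set set \<Rightarrow> bool" where
  "polygon_triangulation P T \<longleftrightarrow>
     noncrossing_edges_on P T \<and>
     (\<forall>E. noncrossing_edges_on P E \<and> T \<subseteq> E \<longrightarrow> E = T)"

definition sides :: "(real^2) set \<Rightarrow> (real^2) set set" where
  "sides P = {e \<in> edges_on P. (convex hull e) edge_of P}"

definition interior_edges :: "(real^2) set \<Rightarrow> (real^2) set set \<Rightarrow> (real^2) set set" where
  "interior_edges P T = T - sides P"

definition flips :: "(real^2) set \<Rightarrow> (real^2) set set \<Rightarrow> (real^2) set set \<Rightarrow> bool" where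
  "flips P T T' \<longleftrightarrow>
     polygon_triangulation P T \<and> polygon_triangulation P T' \<and>
     (\<exists>e \<in> interior_edges P T. \<exists>f \<in> edges_on P. f \<noteq> e \<and> T' = insert f (T - {e}))"

definition flip_graph :: "(real^2) set \<Rightarrow> (real^2) set set pair_pre_digraph" where
  "flip_graph P = \<lparr>pverts = {T. polygon_triangulation P T}, parcs = {(T, T'). flips P T T'}\<rparr>"

text \<open>With unit arc weights, \<open>\<mu>\<close> is the usual graph distance, equal to \<open>\<infinity>\<close> between
  vertices that are not joined by a walk.\<close>

definition eccentricity :: "('a, 'b) pre_digraph \<Rightarrow> 'a \<Rightarrow> ereal" where
  "eccentricity G v = (SUP w\<in>verts G. wf_digraph.\<mu> G (\<lambda>_. 1) v w)"

lemma finite_vertices: "convex_polygon P \<Longrightarrow> finite (vertices P)"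
  unfolding convex_polygon_def vertices_def
  by (simp add: finite_polyhedron_extreme_points polytope_imp_polyhedron)

lemma finite_triangulations:
  assumes "convex_polygon P"
  shows "finite {T. polygon_triangulation P T}"
proof (rule finite_subset)
  show "{T. polygon_triangulation P T} \<subseteq> Pow (Pow (vertices P))"
    unfolding polygon_triangulation_def noncrossing_edges_on_def edges_on_def by blast
  show "finite (Pow (Pow (vertices P)))"
    using finite_vertices[OF assms] by simp
qed

lemma crosses_sym: "crosses e f \<longleftrightarrow> crosses f e"
  unfolding crosses_def by blast

lemma side_not_crosses:
  assumes "s \<in> sides P" "e \<in> edges_on P"
  shows "\<not> crosses s e"
proof
  assume c: "crosses s e"
  from assms(2) obtain a b where e: "e = {a, b}" "a \<noteq> b"
    and ab: "a extreme_point_of P" "b extreme_point_of P"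
    by (auto simp: edges_on_def vertices_def card_2_iff)
  have face: "(convex hull s) face_of P" and s: "card s = 2"
    using assms(1) by (auto simp: sides_def edge_of_def edges_on_def)
  from c obtain x where x: "x \<in> rel_interior (convex hull s)" "x \<in> rel_interior (convex hull e)"
    by (auto simp: crosses_def)
  have xs: "x \<in> convex hull s" using x(1) rel_interior_subset by blast
  have "x \<in> open_segment a b"
    using x(2) e by (simp add: segment_convex_hull[symmetric] rel_interior_closed_segment)
  moreover have abP: "a \<in> P" "b \<in> P" using ab by (auto simp: extreme_point_of_def)
  ultimately have abs: "a \<in> convex hull s" "b \<in> convex hull s"
    using face_ofD[OF face _ _ _ xs] by blast+
  have "a extreme_point_of (convex hull s)" "b extreme_point_of (convex hull s)"
    using ab abs face_of_imp_subset[OF face] unfolding extreme_point_of_def by blast+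
  then have "e \<subseteq> s"
    using e extreme_point_of_convex_hull by blast
  moreover have "card e = 2" "finite s" using e s by (auto intro: card_ge_0_finite)
  ultimately have "e = s" using s by (simp add: card_subset_eq)
  with c show False by (simp add: crosses_def)
qed

lemma sides_subset_triangulation:
  assumes "polygon_triangulation P T"
  shows "sides P \<subseteq> T"
proof
  fix s assume s: "s \<in> sides P"
  have T: "noncrossing_edges_on P T" using assms by (simp add: polygon_triangulation_def)
  have "noncrossing_edges_on P (insert s T)"
    unfolding noncrossing_edges_on_def
  proof (intro conjI ballI)
    show "insert s T \<subseteq> edges_on P"
      using s T by (auto simp: noncrossing_edges_on_def sides_def)
    then show "\<not> crosses e f" if "e \<in> insert s T" "f \<in> insert s T" for e f
      using that s T side_not_crosses crosses_sym
      unfolding noncrossing_edges_on_def by blast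
  qed
  then show "s \<in> T" using assms unfolding polygon_triangulation_def by blast
qed

lemma flips_sym:
  assumes "flips P T T'"
  shows "flips P T' T"
proof -
  from assms obtain e f where T: "polygon_triangulation P T" and T': "polygon_triangulation P T'"
    and e: "e \<in> T" "e \<notin> sides P" and f: "f \<noteq> e" and eq: "T' = insert f (T - {e})"
    by (auto simp: flips_def interior_edges_def)
  have fT: "f \<notin> T"
  proof
    assume "f \<in> T"
    then have "T' = T - {e}" using f eq by auto
    with T T' e show False unfolding polygon_triangulation_def by blast
  qed
  then have "f \<in> interior_edges P T'"
    using sides_subset_triangulation[OF T] eq by (auto simp: interior_edges_def)
  moreover have "e \<in> edges_on P"
    using T e by (auto simp: polygon_triangulation_def noncrossing_edges_on_def)
  moreover have "T = insert e (T' - {f})" using eq e f fT by auto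
  ultimately show ?thesis using T T' f unfolding flips_def by blast
qed

lemma not_flips_self: "\<not> flips P T T"
  by (auto simp: flips_def interior_edges_def)

text \<open>The flip-graph is a finite simple graph, represented as a symmetric loop-free digraph.\<close>

lemma pair_graph_flip_graph:
  assumes "convex_polygon P"
  shows "pair_graph (flip_graph P)"
proof -
  have sub: "parcs (flip_graph P) \<subseteq> pverts (flip_graph P) \<times> pverts (flip_graph P)"
    by (auto simp: flip_graph_def flips_def)
  have fin: "finite (pverts (flip_graph P))"
    using finite_triangulations[OF assms] by (simp add: flip_graph_def)
  have "finite (parcs (flip_graph P))"
    using finite_subset[OF sub] fin by simp
  moreover have "symmetric (flip_graph P)"
    by (auto simp: symmetric_def flip_graph_def intro!: symI flips_sym)
  ultimately show ?thesis
    using sub fin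
    by unfold_locales (auto simp: flip_graph_def not_flips_self)
qed

end

theory Submission
  imports Defs
begin

text \<open>The upper bound on the eccentricity comes from routing through stars. As long as a vertex \<open>v\<close> is
  not joined to all others, some flip creates an edge at \<open>v\<close>. So two triangulations with \<open>d\<close> and \<open>d'\<close>
  interior edges at \<open>v\<close> are at distance at most \<open>2 * (n - 3) - d - d'\<close> (\<open>distance_via_star\<close>), and a
  vertex with \<open>n - 3 - k\<close> interior edges forces the eccentricity to be at most \<open>n - 3 + k\<close>.

  Lower bounds come from contractions. Collapsing a side \<open>pq\<close> turns a triangulation with \<open>n\<close> vertices
  into one with \<open>n - 1\<close> vertices, and a flip into a flip or into nothing. The flips that change the
  triangle on \<open>pq\<close> are the ones that disappear. If \<open>p\<close> is an ear of \<open>T\<close> and has at least two interior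
  edges in \<open>T'\<close>, then on any path from \<open>T\<close> to \<open>T'\<close> one of the two sides at \<open>p\<close> sees its triangle change
  twice, so that removing \<open>p\<close> saves two flips (\<open>far_ear\<close>). Suppose that \<open>K\<close> vertices can be cut off
  from \<open>T\<close> as successive ears, that \<open>T'\<close> joins each of them by two interior edges to vertices that
  remain, and that the two triangulations never come to share an interior edge. Then the distance is
  at least \<open>2 * K\<close> plus the \<open>n - K - 3\<close> flips needed for the remaining interior edges, that is
  \<open>n - 3 + K\<close> (\<open>far_outside_subpolygon\<close>).

  It remains to construct such a \<open>T'\<close> for a given \<open>T\<close>, in one of two ways.
  If a vertex \<open>v\<close> has \<open>d\<close> interior edges where \<open>K \<le> n - 3 - d\<close> and \<open>4 * K \<le> d + 2\<close>, the vertices to be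
  removed are \<open>K\<close> of those not adjacent to \<open>v\<close>; then \<open>T'\<close> makes \<open>v\<close> an ear, and joins each of the \<open>K\<close>
  vertices to four neighbours of \<open>v\<close> (\<open>planar_matching\<close>, \<open>excess_fan\<close>). Further vertices not adjacent to
  \<open>v\<close> can be inserted as ears without lowering the excess over \<open>n - 3\<close> (\<open>excess_insert_ear\<close>).
  If all degrees are too small for this and \<open>8 * K + 12 \<le> n\<close>, there is an edge of \<open>T\<close> that has more
  than \<open>K\<close> vertices on one side, and on the other side \<open>K\<close> vertices adjacent to neither of its ends; then
  \<open>T'\<close> zigzags across this edge (\<open>excess_across\<close>, \<open>excess_if_degrees_small\<close>).

  Because of the bound on \<open>k\<close>, one may take \<open>K = k\<close> in the first construction at a vertex with \<open>n - 3 - k\<close> interior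
  edges, which shows that the upper bound is attained. Conversely, if the eccentricity is \<open>n - 3 + k\<close>
  then no vertex has more than \<open>n - 3 - k\<close> interior edges. If none had exactly that many, one of the two
  constructions would work for \<open>K = k + 1\<close> and give a contradiction.

  All this is done for sets of pairs of natural numbers. A convex polygon enters only through a
  numbering of its vertices in cyclic order, for which two edges cross if and only if the numbers of
  their ends interleave (\<open>cyclic_labelling_exists\<close>, \<open>crosses_iff_xing\<close>).\<close>

section \<open>Noncrossing edges and the contraction of a side\<close>

definition chords :: "nat set \<Rightarrow> (nat \<times> nat) set" where
  "chords V = {(a, b). a \<in> V \<and> b \<in> V \<and> a < b}"

text \<open>Crossing of two chords of a convex polygon whose vertices are numbered in cyclic order is
  interleaving of the numbers. Since the two chords are quantified symmetrically, one of the two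
  interleaving orders suffices.\<close>

definition planar :: "(nat \<times> nat) set \<Rightarrow> bool" where
  "planar E \<longleftrightarrow> (\<forall>a b c d. (a, b) \<in> E \<longrightarrow> (c, d) \<in> E \<longrightarrow> \<not> (a < c \<and> c < b \<and> b < d))"

text \<open>Triangulations, characterised by their number of edges (the sides included): \<open>planar_card\<close>,
  \<open>maximal_tri\<close> and \<open>tri_maximal\<close> show that these are exactly the maximal noncrossing sets. The
  count is what makes contraction easy to handle. An infinite \<open>V\<close> admits no triangulation because
  its \<open>card\<close> is 0.\<close>

definition tri :: "nat set \<Rightarrow> (nat \<times> nat) set \<Rightarrow> bool" where
  "tri V T \<longleftrightarrow> T \<subseteq> chords V \<and> planar T \<and> card T + 3 = 2 * card V"

definition adj :: "(nat \<times> nat) set \<Rightarrow> nat \<Rightarrow> nat \<Rightarrow> bool" where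
  "adj E a b \<longleftrightarrow> (a, b) \<in> E \<or> (b, a) \<in> E"

definition consec :: "nat set \<Rightarrow> nat \<Rightarrow> nat \<Rightarrow> bool" where
  "consec V a b \<longleftrightarrow> a \<in> V \<and> b \<in> V \<and> a \<noteq> b \<and> (\<forall>z\<in>V. \<not> (a < z \<and> z < b) \<and> \<not> (b < z \<and> z < a))"

definition merge :: "nat \<Rightarrow> nat \<Rightarrow> nat \<Rightarrow> nat" where
  "merge p q x = (if x = p then q else x)"

text \<open>Collapsing \<open>p\<close> onto an adjacent vertex \<open>q\<close>. The vertex set may be any finite set of numbers, so
  the result lives on \<open>V - {p}\<close> without renumbering.\<close>

definition contract :: "nat \<Rightarrow> nat \<Rightarrow> (nat \<times> nat) set \<Rightarrow> (nat \<times> nat) set" where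
  "contract p q E = {(merge p q a, merge p q b) | a b. (a, b) \<in> E \<and> merge p q a \<noteq> merge p q b}"

lemma chords_finite: "finite V \<Longrightarrow> finite (chords V)"
  by (rule finite_subset[of _ "V \<times> V"]) (auto simp: chords_def)

lemma planarD: "planar E \<Longrightarrow> (a, b) \<in> E \<Longrightarrow> (c, d) \<in> E \<Longrightarrow> a < c \<Longrightarrow> c < b \<Longrightarrow> b < d \<Longrightarrow> False"
  unfolding planar_def by blast

lemma planar_subset: "planar E \<Longrightarrow> F \<subseteq> E \<Longrightarrow> planar F"
  unfolding planar_def by blast

lemma adj_sym: "adj E a b \<longleftrightarrow> adj E b a"
  unfolding adj_def by blast

lemma adj_less: "E \<subseteq> chords V \<Longrightarrow> a < b \<Longrightarrow> adj E a b \<longleftrightarrow> (a, b) \<in> E"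
  unfolding adj_def chords_def by auto

lemma adj_irrefl: "E \<subseteq> chords V \<Longrightarrow> \<not> adj E a a"
  unfolding adj_def chords_def by auto

lemma adj_in: "E \<subseteq> chords V \<Longrightarrow> adj E a b \<Longrightarrow> a \<in> V \<and> b \<in> V \<and> a \<noteq> b"
  unfolding adj_def chords_def by auto

lemma consec_sym: "consec V a b \<longleftrightarrow> consec V b a"
  unfolding consec_def by blast

lemma merge_mono:
  assumes "consec V p q" "a \<in> V" "b \<in> V" "a < b"
  shows "merge p q a \<le> merge p q b"
  using assms unfolding consec_def merge_def by (auto simp: not_less)

text \<open>If \<open>x\<close> and \<open>y\<close> were two common neighbours of the consecutive vertices \<open>p\<close> and \<open>q\<close>, one of the
  edges from \<open>p\<close> to \<open>{x, y}\<close> would cross one of the edges from \<open>q\<close> to \<open>{x, y}\<close>.\<close>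

lemma common_neighbour_unique:
  assumes E: "E \<subseteq> chords V" "planar E" and pq: "consec V p q"
    and x: "adj E p x" "adj E q x" and y: "adj E p y" "adj E q y"
  shows "x = y"
proof -
  have *: False if "consec V p q" "p < q" "adj E p x" "adj E q x" "adj E p y" "adj E q y" "x < y" for p q x y
  proof -
    have V: "x \<in> V" "y \<in> V" "x \<noteq> p" "x \<noteq> q" "y \<noteq> p" "y \<noteq> q"
      using that adj_in[OF E(1)] by blast+
    then have "x < p \<or> q < x" "y < p \<or> q < y"
      using that unfolding consec_def by (meson nat_neq_iff)+
    then consider "y < p" | "x < p" "q < y" | "q < x"
      using \<open>x < y\<close> \<open>p < q\<close> by linarith
    then show False
    proof cases
      case 1
      then have "(x, p) \<in> E" "(y, q) \<in> E"
        using that adj_less[OF E(1)] adj_sym by (metis less_trans)+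
      then show False using planarD[OF E(2)] 1 that by blast
    next
      case 2
      then have "(x, q) \<in> E" "(p, y) \<in> E"
        using that adj_less[OF E(1)] adj_sym by (metis less_trans)+
      then show False using planarD[OF E(2)] 2 that by blast
    next
      case 3
      then have "(p, x) \<in> E" "(q, y) \<in> E"
        using that adj_less[OF E(1)] adj_sym by (metis less_trans)+
      then show False using planarD[OF E(2)] 3 that by blast
    qed
  qed
  have "p < q \<or> q < p" using pq unfolding consec_def by linarith
  then show ?thesis
    using *[of p q x y] *[of p q y x] *[of q p x y] *[of q p y x] pq x y
    by (metis consec_sym linorder_neqE_nat)
qed

lemma contract_chords:
  assumes "E \<subseteq> chords V" "consec V p q"
  shows "contract p q E \<subseteq> chords (V - {p})"
proof -
  have "merge p q a \<in> V - {p}" if "a \<in> V" for a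
    using assms(2) that unfolding merge_def consec_def by auto
  note V = this
  show ?thesis
  proof clarify
    fix x y assume "(x, y) \<in> contract p q E"
    then obtain a b where "(a, b) \<in> E" "x = merge p q a" "y = merge p q b" "x \<noteq> y"
      unfolding contract_def by auto
    moreover from this have "a \<in> V" "b \<in> V" "a < b" using assms(1) unfolding chords_def by auto
    ultimately show "(x, y) \<in> chords (V - {p})"
      using V merge_mono[OF assms(2), of a b] unfolding chords_def by auto
  qed
qed

lemma contract_planar:
  assumes "E \<subseteq> chords V" "planar E" "consec V p q"
  shows "planar (contract p q E)"
  unfolding planar_def
proof (intro allI impI notI)
  fix a b c d assume *: "(a, b) \<in> contract p q E" "(c, d) \<in> contract p q E" "a < c \<and> c < b \<and> b < d"
  then obtain a' b' c' d' where E: "(a', b') \<in> E" "(c', d') \<in> E"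
    and m: "a = merge p q a'" "b = merge p q b'" "c = merge p q c'" "d = merge p q d'"
    unfolding contract_def by auto
  have V: "a' \<in> V" "b' \<in> V" "c' \<in> V" "d' \<in> V" using E assms(1) unfolding chords_def by auto
  have mm: "x < y" if "merge p q x < merge p q y" "x \<in> V" "y \<in> V" for x y
    using merge_mono[OF assms(3), of y x] that by (cases x y rule: linorder_cases) auto
  show False using planarD[OF assms(2) E] mm V * m by blast
qed

lemma contractI:
  "(a, b) \<in> E \<Longrightarrow> merge p q a \<noteq> merge p q b \<Longrightarrow> (merge p q a, merge p q b) \<in> contract p q E"
  unfolding contract_def by blast

lemma contract_finite:
  assumes "finite E" shows "finite (contract p q E)"
proof (rule finite_subset)
  show "contract p q E \<subseteq> (\<lambda>(a, b). (merge p q a, merge p q b)) ` E" unfolding contract_def by auto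
  show "finite ((\<lambda>(a, b). (merge p q a, merge p q b)) ` E)" using assms by simp
qed

text \<open>Contraction loses the edge \<open>pq\<close>, and identifies two edges only when they join \<open>p\<close> and \<open>q\<close> to a
  common neighbour.\<close>

lemma card_contract_common:
  assumes E: "E \<subseteq> chords V" "finite V" "consec V p q" and X: "\<And>x. adj E p x \<Longrightarrow> adj E q x \<Longrightarrow> x \<in> X" and "finite X"
  shows "card E \<le> card (contract p q E) + 1 + card X"
proof -
  define R where "R = {(a, b) \<in> E. {a, b} = {p, q}}"
  define S where "S = {(a, b) \<in> E. \<exists>x\<in>X. {a, b} = {p, x}}"
  have finE: "finite E" using finite_subset[OF E(1) chords_finite[OF E(2)]] .
  have "R \<subseteq> {(min p q, max p q)}"
  proof clarify
    fix a b assume "(a, b) \<in> R"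
    then have x: "{a, b} = {p, q}" "a < b" using E(1) unfolding R_def chords_def by auto
    then have "(a, b) = (min p q, max p q)" unfolding doubleton_eq_iff by auto
    then show "a = min p q \<and> b = max p q" by simp
  qed
  then have cR: "card R \<le> 1" using card_mono[of "{(min p q, max p q)}" R] by simp
  have "S \<subseteq> (\<lambda>x. (min p x, max p x)) ` X"
  proof clarify
    fix a b assume "(a, b) \<in> S"
    then obtain x where x: "x \<in> X" "{a, b} = {p, x}" "a < b" using E(1) unfolding S_def chords_def by auto
    then have "(a, b) = (min p x, max p x)" unfolding doubleton_eq_iff by auto
    then show "(a, b) \<in> (\<lambda>x. (min p x, max p x)) ` X" using x by blast
  qed
  then have cS: "card S \<le> card X" 
    using card_mono[OF finite_imageI[OF assms(5)]] card_image_le[OF assms(5)] order_trans by blast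
  let ?m = "\<lambda>(a, b). (merge p q a, merge p q b)"
  have sub: "?m ` (E - R - S) \<subseteq> contract p q E"
  proof clarify
    fix a b assume "(a, b) \<in> E" "(a, b) \<notin> R" "(a, b) \<notin> S"
    then show "(merge p q a, merge p q b) \<in> contract p q E"
      using E(1) unfolding R_def by (intro contractI) (auto simp: merge_def chords_def split: if_splits)
  qed
  have inj: "inj_on ?m (E - R - S)"
  proof (rule inj_onI, clarify)
    fix a b a' b'
    assume ab: "(a, b) \<in> E" "(a, b) \<notin> R" "(a, b) \<notin> S" and ab': "(a', b') \<in> E" "(a', b') \<notin> R" "(a', b') \<notin> S"
      and m: "merge p q a = merge p q a'" "merge p q b = merge p q b'"
    have less: "a < b" "a' < b'" using ab ab' E unfolding chords_def by auto
    have a: "a = a' \<or> (a = p \<and> a' = q) \<or> (a = q \<and> a' = p)"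
      and b: "b = b' \<or> (b = p \<and> b' = q) \<or> (b = q \<and> b' = p)"
      using m unfolding merge_def by (auto split: if_splits)
    have S1: "\<not> (adj E q x)" if h: "{a, b} = {p, x}" for x
    proof -
      have "adj E p x" using h ab(1) unfolding adj_def doubleton_eq_iff by auto
      moreover have "x \<notin> X" using h ab unfolding S_def by auto
      ultimately show ?thesis using X by blast
    qed
    have S2: "\<not> (adj E q x)" if h: "{a', b'} = {p, x}" for x
    proof -
      have "adj E p x" using h ab'(1) unfolding adj_def doubleton_eq_iff by auto
      moreover have "x \<notin> X" using h ab' unfolding S_def by auto
      ultimately show ?thesis using X by blast
    qed
    show "a = a' \<and> b = b'"
    proof (rule ccontr)
      assume n: "\<not> (a = a' \<and> b = b')"
      have "(a = a' \<and> b = p \<and> b' = q) \<or> (a = a' \<and> b = q \<and> b' = p)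
        \<or> (b = b' \<and> a = p \<and> a' = q) \<or> (b = b' \<and> a = q \<and> a' = p)"
        using a b n less by (elim disjE conjE) simp_all
      then consider "a = a'" "b = p" "b' = q" | "a = a'" "b = q" "b' = p"
        | "b = b'" "a = p" "a' = q" | "b = b'" "a = q" "a' = p" by blast
      then show False
      proof cases
        case 1 then show False using S1[of a] ab' unfolding adj_def by auto
      next
        case 2 then show False using S2[of a] ab unfolding adj_def by auto
      next
        case 3 then show False using S1[of b] ab' unfolding adj_def by auto
      next
        case 4 then show False using S2[of b] ab unfolding adj_def by auto
      qed
    qed
  qed
  have "card (E - R - S) \<le> card (contract p q E)"
    using card_inj_on_le[OF inj sub] finE contract_finite by blast
  moreover have "card E \<le> card (E - R - S) + card R + card S"
  proof -
    have "E = (E - R - S) \<union> R \<union> S" unfolding R_def S_def by auto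
    then have "card E = card ((E - R - S) \<union> R \<union> S)" by simp
    then show ?thesis using card_Un_le[of "(E - R - S) \<union> R" S] card_Un_le[of "E - R - S" R] by linarith
  qed
  ultimately show ?thesis using cR cS by linarith
qed

section \<open>Triangulations and their number of edges\<close>

definition xing :: "nat \<Rightarrow> nat \<Rightarrow> nat \<Rightarrow> nat \<Rightarrow> bool" where
  "xing a b c d \<longleftrightarrow> a < c \<and> c < b \<and> b < d \<or> c < a \<and> a < d \<and> d < b"

lemma planar_xing: "planar E \<Longrightarrow> (a, b) \<in> E \<Longrightarrow> (c, d) \<in> E \<Longrightarrow> \<not> xing a b c d"
  unfolding planar_def xing_def by blast

lemma planar_insert:
  assumes "planar E" "\<And>c d. (c, d) \<in> E \<Longrightarrow> \<not> xing a b c d"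
  shows "planar (insert (a, b) E)"
  unfolding planar_def
proof (intro allI impI notI)
  fix u v c d assume h: "(u, v) \<in> insert (a, b) E" "(c, d) \<in> insert (a, b) E" "u < c \<and> c < v \<and> v < d"
  consider "(u, v) = (a, b)" "(c, d) = (a, b)" | "(u, v) = (a, b)" "(c, d) \<in> E"
    | "(u, v) \<in> E" "(c, d) = (a, b)" | "(u, v) \<in> E" "(c, d) \<in> E" using h by blast
  then show False
  proof cases
    case 1 then show False using h by auto
  next
    case 2 then show False using h assms(2)[of c d] unfolding xing_def by auto
  next
    case 3 then show False using h assms(2)[of u v] unfolding xing_def by auto
  next
    case 4 then show False using h planarD[OF assms(1)] by blast
  qed
qed

lemma card_contract:
  assumes E: "E \<subseteq> chords V" "planar E" "finite V" "consec V p q"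
  shows "card E \<le> card (contract p q E) + 2"
proof (cases "\<exists>x. adj E p x \<and> adj E q x")
  case True
  then obtain x where "adj E p x" "adj E q x" by blast
  then have "y \<in> {x}" if "adj E p y" "adj E q y" for y
    using common_neighbour_unique[OF E(1,2,4) that] by blast
  then show ?thesis using card_contract_common[OF E(1,3,4), of "{x}"] by simp
next
  case False
  then show ?thesis using card_contract_common[OF E(1,3,4), of "{}"] by simp
qed

lemma card_contract_le:
  assumes "finite E" shows "card (contract p q E) \<le> card E"
proof -
  have "contract p q E \<subseteq> (\<lambda>(a, b). (merge p q a, merge p q b)) ` E" unfolding contract_def by auto
  then have "card (contract p q E) \<le> card ((\<lambda>(a, b). (merge p q a, merge p q b)) ` E)"
    using assms by (intro card_mono) auto
  also have "\<dots> \<le> card E" using assms by (rule card_image_le)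
  finally show ?thesis .
qed

lemma top_two:
  assumes "finite (V :: nat set)" "2 \<le> card V"
  obtains m l where "consec V m l" "l < m" "\<And>x. x \<in> V \<Longrightarrow> x \<le> m" "\<And>x. x \<in> V \<Longrightarrow> x \<noteq> m \<Longrightarrow> x \<le> l"
proof -
  have ne: "V \<noteq> {}" using assms by auto
  let ?W = "V - {Max V}"
  have "card ?W \<ge> 1" using assms ne by simp
  then have neW: "?W \<noteq> {}" by fastforce
  have fW: "finite ?W" using assms by simp
  have l: "Max ?W \<in> ?W" using Max_in[OF fW neW] .
  have le: "x \<le> Max ?W" if "x \<in> V" "x \<noteq> Max V" for x using that fW by (intro Max_ge) auto
  have m: "x \<le> Max V" if "x \<in> V" for x using assms that by (intro Max_ge) auto
  have lt: "Max ?W < Max V" using l m[of "Max ?W"] by auto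
  have "consec V (Max V) (Max ?W)"
    unfolding consec_def
  proof (intro conjI ballI)
    fix z assume z: "z \<in> V"
    show "\<not> (Max V < z \<and> z < Max ?W)" using m[OF z] by linarith
    show "\<not> (Max ?W < z \<and> z < Max V)" using le[OF z] by linarith
  qed (use l Max_in[OF assms(1) ne] lt in auto)
  then show thesis using that lt m le by blast
qed

text \<open>Contracting the largest vertex onto the second largest loses at most two edges, namely the side
  between them and one of the edges to their common neighbour, of which there is at most one.\<close>

theorem planar_card:
  assumes "finite V" "2 \<le> card V" "E \<subseteq> chords V" "planar E"
  shows "card E + 3 \<le> 2 * card V"
  using assms
proof (induction "card V" arbitrary: V E rule: less_induct)
  case less
  obtain m l where ml: "consec V m l" "l < m" "\<And>x. x \<in> V \<Longrightarrow> x \<le> m" "\<And>x. x \<in> V \<Longrightarrow> x \<noteq> m \<Longrightarrow> x \<le> l"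
    using top_two[OF less.prems(1,2)] by blast
  have mV: "m \<in> V" "l \<in> V" using ml(1) unfolding consec_def by auto
  show ?case
  proof (cases "card V = 2")
    case True
    then have "V = {m, l}" using mV ml(2) less.prems(1)
      by (intro card_subset_eq[symmetric]) auto
    then have "E \<subseteq> {(l, m)}" using less.prems(3) ml(2) unfolding chords_def by auto
    then have "card E \<le> 1" using card_mono[of "{(l, m)}" E] by simp
    then show ?thesis using True by simp
  next
    case False
    have c: "card (V - {m}) = card V - 1" using mV less.prems(1) by simp
    have "card (contract m l E) + 3 \<le> 2 * card (V - {m})"
      using less.prems False c contract_chords[OF less.prems(3) ml(1)]
        contract_planar[OF less.prems(3,4) ml(1)]
      by (intro less.hyps) auto
    then show ?thesis using card_contract[OF less.prems(3,4,1) ml(1)] c less.prems(2) by linarith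
  qed
qed

text \<open>The same contraction run backwards. A maximal set does contain the side and a triangle on it, so
  that contraction loses exactly two edges; and the contracted set is again maximal, because an
  edge that could be added to it would lift to an edge that could be added before.\<close>

lemma maximal_card:
  assumes "finite V" "2 \<le> card V" "E \<subseteq> chords V" "planar E"
    and "\<And>a b. (a, b) \<in> chords V \<Longrightarrow> (a, b) \<notin> E \<Longrightarrow> \<exists>c d. (c, d) \<in> E \<and> xing a b c d"
  shows "card E + 3 = 2 * card V"
  using assms
proof (induction "card V" arbitrary: V E rule: less_induct)
  case less
  note E = less.prems(3) and pE = less.prems(4) and mx = less.prems(5)
  have finE: "finite E" using finite_subset[OF E chords_finite[OF less.prems(1)]] .
  obtain m l where ml: "consec V m l" "l < m" "\<And>x. x \<in> V \<Longrightarrow> x \<le> m" "\<And>x. x \<in> V \<Longrightarrow> x \<noteq> m \<Longrightarrow> x \<le> l"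
    using top_two[OF less.prems(1,2)] by blast
  have mV: "m \<in> V" "l \<in> V" using ml(1) unfolding consec_def by auto
  have EV: "c \<in> V \<and> d \<in> V \<and> c < d" if "(c, d) \<in> E" for c d using E that unfolding chords_def by auto
  have lmE: "(l, m) \<in> E"
  proof (rule ccontr)
    assume "(l, m) \<notin> E"
    then obtain c d where "(c, d) \<in> E" "xing l m c d" using mx[of l m] mV ml(2) unfolding chords_def by auto
    then show False using EV[of c d] ml(3)[of d] ml(4)[of c] ml(4)[of d] unfolding xing_def by auto
  qed
  show ?case
  proof (cases "card V = 2")
    case True
    have "card E \<ge> 1" using card_mono[OF finE, of "{(l, m)}"] lmE by simp
    then show ?thesis using True planar_card[OF less.prems(1,2) E pE] by linarith
  next
    case False
    have c: "card (V - {m}) = card V - 1" using mV less.prems(1) by simp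
    \<comment> \<open>the triangle on the side \<open>lm\<close> has its apex at the largest neighbour of \<open>m\<close> below \<open>l\<close>\<close>
    let ?X = "{x \<in> V. x < l \<and> (x, m) \<in> E}"
    have "?X \<noteq> {}"
    proof -
      have ne: "V \<noteq> {}" using mV by auto
      let ?a = "Min V"
      have a: "?a \<in> V" "\<And>x. x \<in> V \<Longrightarrow> ?a \<le> x" using less.prems(1) ne by auto
      have "?a \<noteq> l"
      proof
        assume "?a = l"
        then have "V \<subseteq> {l, m}" using a(2) ml(4) by force
        then have "card V \<le> card {l, m}" by (intro card_mono) auto
        then show False using False less.prems(2) ml(2) by simp
      qed
      then have al: "?a < l" using a(2)[OF mV(2)] by simp
      have "(?a, m) \<in> E"
      proof (rule ccontr)
        assume "(?a, m) \<notin> E"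
        then obtain c d where "(c, d) \<in> E" "xing ?a m c d" using mx[of ?a m] mV a al ml(2) unfolding chords_def by auto
        then show False using EV[of c d] ml(3)[of d] a(2)[of c] unfolding xing_def by auto
      qed
      then show ?thesis using a al by blast
    qed
    moreover have "finite ?X" using less.prems(1) by simp
    ultimately have xX: "Max ?X \<in> ?X" and xM: "\<And>y. y \<in> ?X \<Longrightarrow> y \<le> Max ?X"
      using Max_in[of ?X] Max_ge[of ?X] by blast+
    define x where "x = Max ?X"
    have x: "x \<in> V" "x < l" "(x, m) \<in> E" and xM': "\<And>y. y < l \<Longrightarrow> (y, m) \<in> E \<Longrightarrow> y \<le> x"
      using xX xM EV unfolding x_def by auto
    have xlE: "(x, l) \<in> E"
    proof (rule ccontr)
      assume "(x, l) \<notin> E"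
      then obtain c d where cd: "(c, d) \<in> E" "xing x l c d" using mx[of x l] x mV unfolding chords_def by auto
      show False
      proof (cases "d = m")
        case True
        then show False using cd xM'[of c] ml(2) EV[of c d] unfolding xing_def by auto
      next
        case False
        then show False using cd ml(4)[of d] EV[of c d] planarD[OF pE cd(1) x(3)] ml(2) unfolding xing_def by auto
      qed
    qed
    let ?E = "contract m l E"
    have old: "(c, d) \<in> ?E" if "(c, d) \<in> E" "d \<noteq> m" for c d
    proof -
      have "c \<noteq> m" using EV[OF that(1)] ml(3)[of d] by auto
      then show ?thesis using contractI[OF that(1), of m l] that EV[OF that(1)] unfolding merge_def by auto
    qed
    have new: "(c, l) \<in> ?E" if "(c, m) \<in> E" "c \<noteq> l" for c
      using contractI[OF that(1), of m l] that EV[OF that(1)] unfolding merge_def by auto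
    have "?E \<subseteq> contract m l (E - {(l, m), (x, m)})"
    proof clarify
      fix u v assume "(u, v) \<in> ?E"
      then obtain a b where ab: "(a, b) \<in> E" "u = merge m l a" "v = merge m l b" "u \<noteq> v" unfolding contract_def by auto
      show "(u, v) \<in> contract m l (E - {(l, m), (x, m)})"
      proof (cases "(a, b) = (x, m)")
        case True
        then have "u = merge m l x" "v = merge m l l" using ab ml(2) unfolding merge_def by auto
        moreover have "(x, l) \<in> E - {(l, m), (x, m)}" using xlE ml(2) by auto
        ultimately show ?thesis using ab(4) contractI[of x l "E - {(l, m), (x, m)}" m l] by auto
      next
        case False
        have "(a, b) \<noteq> (l, m)" using ab unfolding merge_def by auto
        then show ?thesis using False ab contractI[of a b "E - {(l, m), (x, m)}" m l] by auto
      qed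
    qed
    then have "card ?E \<le> card (contract m l (E - {(l, m), (x, m)}))"
      using finE contract_finite by (intro card_mono) auto
    also have "\<dots> \<le> card (E - {(l, m), (x, m)})" using finE by (intro card_contract_le) auto
    also have "\<dots> = card E - 2" using lmE x finE by (subst card_Diff_subset) auto
    finally have le: "card ?E \<le> card E - 2" .
    have two: "2 \<le> card E" using card_mono[OF finE, of "{(l, m), (x, m)}"] lmE x by auto
    have "card ?E + 3 = 2 * card (V - {m})"
    proof (rule less.hyps)
      show "card (V - {m}) < card V" using c less.prems(2) by linarith
      show "finite (V - {m})" "2 \<le> card (V - {m})" using less.prems False c by auto
      show "?E \<subseteq> chords (V - {m})" using contract_chords[OF E ml(1)] .
      show "planar ?E" using contract_planar[OF E pE ml(1)] .
      fix a b assume ab: "(a, b) \<in> chords (V - {m})" "(a, b) \<notin> ?E"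
      then have abV: "a \<in> V" "b \<in> V" "a < b" "a \<noteq> m" "b \<noteq> m" unfolding chords_def by auto
      have "(a, b) \<notin> E" using old ab(2) abV(5) by blast
      then obtain c d where cd: "(c, d) \<in> E" "xing a b c d" using mx[of a b] abV unfolding chords_def by auto
      show "\<exists>c d. (c, d) \<in> ?E \<and> xing a b c d"
      proof (cases "d = m")
        case False
        then show ?thesis using old cd by blast
      next
        case True
        have ord: "a < c" "c < b" using cd(2) ml(3)[OF abV(2)] True unfolding xing_def by auto
        have cm: "(c, m) \<in> E" using cd True by simp
        show ?thesis
        proof (cases "b = l")
          case False
          then have "b < l" using ml(4)[of b] abV by auto
          then show ?thesis using new[OF cm] ord unfolding xing_def by (intro exI[of _ c] exI[of _ l]) auto
        next
          case True
          have "(a, m) \<notin> E" using new[of a] ab(2) True abV(3) by blast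
          then obtain c' d' where cd': "(c', d') \<in> E" "xing a m c' d'"
            using mx[of a m] abV mV ml(2) True unfolding chords_def by auto
          then have o: "c' < a" "a < d'" "d' < m" using EV[of c' d'] ml(3)[of d'] unfolding xing_def by auto
          then have "d' \<le> l" using ml(4)[of d'] EV[OF cd'(1)] by auto
          show ?thesis
          proof (cases "d' = l")
            case False
            then have "xing a b c' d'" using o \<open>d' \<le> l\<close> True unfolding xing_def by auto
            then show ?thesis using old[OF cd'(1)] o by blast
          next
            case d: True
            then show ?thesis using planarD[OF pE cd'(1) cm] o ord True ml(2) by auto
          qed
        qed
      qed
    qed
    then show ?thesis using le two c planar_card[OF less.prems(1,2) E pE] less.prems(2) by linarith
  qed
qed

lemma triD:
  assumes "tri V T"
  shows "T \<subseteq> chords V" "planar T" "card T + 3 = 2 * card V" "finite V" "2 \<le> card V" "finite T"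
proof -
  show *: "T \<subseteq> chords V" "planar T" "card T + 3 = 2 * card V" using assms unfolding tri_def by auto
  then show "2 \<le> card V" by linarith
  then show "finite V" using card.infinite[of V] by (cases "finite V") auto
  then show "finite T" using finite_subset[OF *(1) chords_finite] by blast
qed

lemma tri_in: "tri V T \<Longrightarrow> (a, b) \<in> T \<Longrightarrow> a \<in> V \<and> b \<in> V \<and> a < b"
  unfolding tri_def chords_def by auto

text \<open>One more edge would exceed the bound of \<open>planar_card\<close>.\<close>

lemma tri_memI:
  assumes T: "tri V T" and "a \<in> V" "b \<in> V" "a < b" and "\<And>c d. (c, d) \<in> T \<Longrightarrow> \<not> xing a b c d"
  shows "(a, b) \<in> T"
proof (rule ccontr)
  assume "(a, b) \<notin> T"
  then have "card (insert (a, b) T) = card T + 1" using triD[OF T] by simp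
  moreover have "card (insert (a, b) T) + 3 \<le> 2 * card V"
    using triD[OF T] assms planar_insert[OF triD(2)[OF T] assms(5)]
    by (intro planar_card) (auto simp: chords_def)
  ultimately show False using triD(3)[OF T] by linarith
qed

lemma maximal_tri:
  assumes "finite V" "2 \<le> card V" "E \<subseteq> chords V" "planar E"
    and "\<And>F. F \<subseteq> chords V \<Longrightarrow> planar F \<Longrightarrow> E \<subseteq> F \<Longrightarrow> F = E"
  shows "tri V E"
  unfolding tri_def
proof (intro conjI)
  show "card E + 3 = 2 * card V"
  proof (rule maximal_card[OF assms(1-4)])
    fix a b assume ab: "(a, b) \<in> chords V" "(a, b) \<notin> E"
    show "\<exists>c d. (c, d) \<in> E \<and> xing a b c d"
    proof (rule ccontr)
      assume "\<nexists>c d. (c, d) \<in> E \<and> xing a b c d"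
      then have "planar (insert (a, b) E)" using planar_insert[OF assms(4)] by blast
      then have "insert (a, b) E = E" using assms(3) ab by (intro assms(5)) auto
      then show False using ab by auto
    qed
  qed
qed (use assms in auto)

lemma tri_maximal:
  assumes "tri V T" "F \<subseteq> chords V" "planar F" "T \<subseteq> F"
  shows "F = T"
proof -
  have "card F + 3 \<le> 2 * card V" using triD[OF assms(1)] assms by (intro planar_card) auto
  then have "card F \<le> card T" using triD(3)[OF assms(1)] by linarith
  moreover have "finite F" using assms(2) chords_finite[OF triD(4)[OF assms(1)]] finite_subset by blast
  ultimately show ?thesis using card_seteq[of F T] assms(4) by blast
qed

lemma planar_extends:
  assumes "finite V" "2 \<le> card V" "E \<subseteq> chords V" "planar E"
  obtains T where "tri V T" "E \<subseteq> T"
proof -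
  let ?A = "{F. F \<subseteq> chords V \<and> planar F}"
  have "finite ?A" using chords_finite[OF assms(1)] by simp
  moreover have "E \<in> ?A" using assms by simp
  ultimately obtain T where "T \<in> ?A" "E \<subseteq> T" and mx: "\<forall>F\<in>?A. T \<subseteq> F \<longrightarrow> T = F"
    using finite_has_maximal2[of ?A E] by blast
  then have "tri V T" using assms by (intro maximal_tri) auto
  then show thesis using that \<open>E \<subseteq> T\<close> by blast
qed

lemma tri_consec:
  assumes T: "tri V T" and "consec V a b" "a < b"
  shows "(a, b) \<in> T"
proof (rule tri_memI[OF T])
  show "a \<in> V" "b \<in> V" "a < b" using assms unfolding consec_def by auto
  fix c d assume "(c, d) \<in> T"
  then show "\<not> xing a b c d" using tri_in[OF T] assms(2) unfolding xing_def consec_def by blast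
qed

lemma tri_outer:
  assumes T: "tri V T" and "a \<in> V" "b \<in> V" "a < b" "\<And>x. x \<in> V \<Longrightarrow> a \<le> x \<and> x \<le> b"
  shows "(a, b) \<in> T"
proof (rule tri_memI[OF T])
  fix c d assume "(c, d) \<in> T"
  then have "c \<in> V" "d \<in> V" using tri_in[OF T] by auto
  then show "\<not> xing a b c d" using assms(5) unfolding xing_def by (meson leD)
qed (use assms in auto)

text \<open>This and its mirror image produce the triangles at \<open>a\<close>: an edge crossing \<open>xq\<close> without crossing
  \<open>ax\<close> or \<open>aq\<close> would have to start at \<open>a\<close> and end strictly between \<open>x\<close> and \<open>q\<close>.\<close>

lemma fan_step_left:
  assumes T: "tri V T" and "(a, q) \<in> T" "(a, x) \<in> T" "x < q" "\<And>y. x < y \<Longrightarrow> y < q \<Longrightarrow> (a, y) \<notin> T"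
  shows "(x, q) \<in> T"
proof (rule tri_memI[OF T])
  show "x \<in> V" "q \<in> V" "x < q" using assms tri_in[OF T] by blast+
  have ax: "a < x" using tri_in[OF T assms(3)] by simp
  fix c d assume cd: "(c, d) \<in> T"
  have 1: "\<not> (a < c \<and> c < q \<and> q < d)" "\<not> (c < a \<and> a < d \<and> d < q)" "\<not> (a < c \<and> c < x \<and> x < d)"
    using planarD[OF triD(2)[OF T]] cd assms by blast+
  show "\<not> xing x q c d"
  proof
    assume "xing x q c d"
    then consider "x < c" "c < q" "q < d" | "c < x" "x < d" "d < q" unfolding xing_def by blast
    then show False
    proof cases
      case 1 then show False using \<open>\<not> (a < c \<and> c < q \<and> q < d)\<close> ax by linarith
    next
      case 2
      then have "c = a" using 1 ax by linarith
      then show False using assms(5)[of d] 2 cd by blast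
    qed
  qed
qed

lemma fan_step_right:
  assumes T: "tri V T" and "(a, c) \<in> T" "(x, c) \<in> T" "a < x" "\<And>y. a < y \<Longrightarrow> y < x \<Longrightarrow> (y, c) \<notin> T"
  shows "(a, x) \<in> T"
proof (rule tri_memI[OF T])
  show "a \<in> V" "x \<in> V" "a < x" using assms tri_in[OF T] by blast+
  have xc: "x < c" using tri_in[OF T assms(3)] by simp
  fix u d assume cd: "(u, d) \<in> T"
  have 1: "\<not> (a < u \<and> u < c \<and> c < d)" "\<not> (u < a \<and> a < d \<and> d < c)" "\<not> (u < x \<and> x < d \<and> d < c)"
    using planarD[OF triD(2)[OF T]] cd assms by blast+
  show "\<not> xing a x u d"
  proof
    assume "xing a x u d"
    then consider "a < u" "u < x" "x < d" | "u < a" "a < d" "d < x" unfolding xing_def by blast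
    then show False
    proof cases
      case 2 then show False using \<open>\<not> (u < a \<and> a < d \<and> d < c)\<close> xc by linarith
    next
      case 1
      then have "d = c" using \<open>\<not> (a < u \<and> u < c \<and> c < d)\<close> \<open>\<not> (u < x \<and> x < d \<and> d < c)\<close> xc by linarith
      then show False using assms(5)[of u] 1 cd by blast
    qed
  qed
qed

lemma ex_succ:
  assumes "finite (V :: nat set)" "a \<in> V" "z \<in> V" "a < z"
  obtains s where "consec V a s" "a < s" "s \<le> z"
proof -
  let ?S = "{y \<in> V. a < y}"
  have S: "finite ?S" "?S \<noteq> {}" using assms by auto
  have s: "Min ?S \<in> ?S" using Min_in[OF S] .
  have m: "Min ?S \<le> y" if "y \<in> V" "a < y" for y using that S by (intro Min_le) auto
  have "consec V a (Min ?S)" unfolding consec_def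
  proof (intro conjI ballI)
    fix y assume y: "y \<in> V"
    show "\<not> (a < y \<and> y < Min ?S)" using m[OF y] by linarith
    show "\<not> (Min ?S < y \<and> y < a)" using s by auto
  qed (use s assms in auto)
  then show thesis using that[of "Min ?S"] s m[of z] assms by auto
qed

lemma largest_below:
  assumes "P z" "z < (b :: nat)"
  obtains x where "P x" "z \<le> x" "x < b" "\<And>y. x < y \<Longrightarrow> y < b \<Longrightarrow> \<not> P y"
proof -
  let ?S = "{y. P y \<and> y < b}"
  have f: "finite ?S" by simp
  have "?S \<noteq> {}" using assms by auto
  then have s: "Max ?S \<in> ?S" by (rule Max_in[OF f])
  have m: "y \<le> Max ?S" if "P y" "y < b" for y using that f by (intro Max_ge) auto
  show thesis
  proof (rule that[of "Max ?S"])
    fix y assume y: "Max ?S < y" "y < b"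
    show "\<not> P y" using m[of y] y by linarith
  qed (use s m[OF assms] in auto)
qed

lemma smallest_above:
  assumes "P z" "(b :: nat) < z"
  obtains x where "P x" "x \<le> z" "b < x" "\<And>y. b < y \<Longrightarrow> y < x \<Longrightarrow> \<not> P y"
proof -
  let ?Q = "\<lambda>y. P y \<and> b < y"
  have x: "?Q (Least ?Q)" using LeastI[of ?Q z] assms by simp
  have m: "Least ?Q \<le> y" if "P y" "b < y" for y using Least_le[of ?Q y] that by simp
  show thesis
  proof (rule that[of "Least ?Q"])
    fix y assume y: "b < y" "y < Least ?Q"
    show "\<not> P y" using m[of y] y by linarith
  qed (use x m[OF assms] in auto)
qed

lemma triangle_inside:
  assumes T: "tri V T" and ab: "(a, b) \<in> T" and z: "z \<in> V" "a < z" "z < b"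
  obtains x where "a < x" "x < b" "(a, x) \<in> T" "(x, b) \<in> T"
proof -
  obtain s where s: "consec V a s" "a < s" "s \<le> z"
    using ex_succ[OF triD(4)[OF T], of a z] tri_in[OF T ab] z by blast
  then have "(a, s) \<in> T" using tri_consec[OF T] by blast
  then obtain x where x: "(a, x) \<in> T" "s \<le> x" "x < b" "\<And>y. x < y \<Longrightarrow> y < b \<Longrightarrow> (a, y) \<notin> T"
    using largest_below[of "\<lambda>y. (a, y) \<in> T" s b] s z by auto
  then have "(x, b) \<in> T" using fan_step_left[OF T ab x(1)] by blast
  then show thesis using that[of x] x(1-3) s(2) by simp
qed

section \<open>Flips under contraction\<close>

text \<open>A flip or no move at all. Allowing the latter makes the relation stable under contraction, where
  some flips become trivial.\<close>

definition step :: "nat set \<Rightarrow> (nat \<times> nat) set \<Rightarrow> (nat \<times> nat) set \<Rightarrow> bool" where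
  "step V A B \<longleftrightarrow> tri V A \<and> tri V B \<and> card (A - B) \<le> 1"

definition far :: "nat set \<Rightarrow> (nat \<times> nat) set \<Rightarrow> (nat \<times> nat) set \<Rightarrow> nat \<Rightarrow> bool" where
  "far V A B N \<longleftrightarrow> (\<forall>m. (step V ^^ m) A B \<longrightarrow> N \<le> m)"

text \<open>The third vertex of the triangle on the side \<open>pq\<close>; it is well defined by
  \<open>common_neighbour_unique\<close> and \<open>apex_adj\<close>.\<close>

definition apex :: "(nat \<times> nat) set \<Rightarrow> nat \<Rightarrow> nat \<Rightarrow> nat" where
  "apex S p q = (THE x. adj S p x \<and> adj S q x)"

lemma adj_min_max:
  assumes "E \<subseteq> chords V"
  shows "(min a b, max a b) \<in> E \<longleftrightarrow> adj E a b"
proof (cases a b rule: linorder_cases)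
  case less then show ?thesis using adj_less[OF assms less] by simp
next
  case equal then show ?thesis unfolding adj_def by simp
next
  case greater then show ?thesis using adj_less[OF assms greater] adj_sym[of E a b] by simp
qed

lemma tri_contract:
  assumes S: "tri V S" and pq: "consec V p q" and V: "3 \<le> card V"
  shows "tri (V - {p}) (contract p q S)"
proof -
  have c: "card (V - {p}) = card V - 1" using pq triD(4)[OF S] unfolding consec_def by simp
  have 1: "contract p q S \<subseteq> chords (V - {p})" "planar (contract p q S)"
    using contract_chords[OF triD(1)[OF S] pq] contract_planar[OF triD(1,2)[OF S] pq] .
  have "card (contract p q S) + 3 \<le> 2 * card (V - {p})"
    using 1 triD(4)[OF S] c V by (intro planar_card) auto
  moreover have "card S \<le> card (contract p q S) + 2"
    using card_contract[OF triD(1,2,4)[OF S] pq] .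
  ultimately show ?thesis using 1 c V triD(3)[OF S] unfolding tri_def by linarith
qed

lemma apex_eq:
  assumes S: "tri V S" and pq: "consec V p q" and "adj S p x" "adj S q x"
  shows "apex S p q = x"
  unfolding apex_def using common_neighbour_unique[OF triD(1,2)[OF S] pq] assms(3,4) by blast

text \<open>Without a common neighbour, contracting \<open>pq\<close> would lose only one edge and leave more edges than
  \<open>planar_card\<close> allows.\<close>

lemma apex_adj:
  assumes S: "tri V S" and pq: "consec V p q" and V: "3 \<le> card V"
  shows "adj S p (apex S p q)" "adj S q (apex S p q)"
proof -
  have "\<exists>x. adj S p x \<and> adj S q x"
  proof (rule ccontr)
    assume "\<nexists>x. adj S p x \<and> adj S q x"
    then have "card S \<le> card (contract p q S) + 1"
      using card_contract_common[OF triD(1,4)[OF S] pq, of "{}"] by auto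
    moreover have "card (contract p q S) + 3 = 2 * card (V - {p})" using triD(3)[OF tri_contract[OF assms]] .
    moreover have "card (V - {p}) = card V - 1" using pq triD(4)[OF S] unfolding consec_def by simp
    ultimately show False using triD(3)[OF S] V by simp
  qed
  then obtain x where "adj S p x" "adj S q x" by blast
  then show "adj S p (apex S p q)" "adj S q (apex S p q)" using apex_eq[OF S pq] by auto
qed

lemma step_sym: "step V A B \<Longrightarrow> step V B A"
proof -
  assume *: "step V A B"
  then have T: "tri V A" "tri V B" unfolding step_def by auto
  have "card (A - B) = card (B - A)"
    using triD(3,6)[OF T(1)] triD(3,6)[OF T(2)] card_Diff_subset_Int[of A B] card_Diff_subset_Int[of B A]
    by (simp add: Int_commute)
  then show "step V B A" using * unfolding step_def by simp
qed

lemma step_contract: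
  assumes "step V A B" "consec V p q" "3 \<le> card V"
  shows "step (V - {p}) (contract p q A) (contract p q B)"
proof -
  have T: "tri V A" "tri V B" "card (A - B) \<le> 1" using assms unfolding step_def by auto
  have "contract p q A - contract p q B \<subseteq> contract p q (A - B)" unfolding contract_def by blast
  then have "card (contract p q A - contract p q B) \<le> card (contract p q (A - B))"
    using triD(6)[OF T(1)] by (intro card_mono contract_finite) auto
  also have "\<dots> \<le> card (A - B)" using triD(6)[OF T(1)] by (intro card_contract_le) auto
  finally show ?thesis using T tri_contract[OF _ assms(2,3)] unfolding step_def by auto
qed

lemma contract_edge:
  assumes "adj A p x" "x \<noteq> q" "x \<noteq> p" "A \<subseteq> chords V" "consec V p q"
  shows "(min q x, max q x) \<in> contract p q A"
proof -
  have c: "contract p q A \<subseteq> chords (V - {p})" using contract_chords[OF assms(4,5)] .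
  have "(q, x) \<in> contract p q A \<or> (x, q) \<in> contract p q A"
    using assms contractI[of p x A p q] contractI[of x p A p q] unfolding adj_def merge_def by auto
  then show ?thesis using c unfolding chords_def by (auto simp: min_def max_def)
qed

text \<open>The only edge that the flip removes joins \<open>p\<close> or \<open>q\<close> to the old apex \<open>x\<close>. Contraction identifies it
  with the other edge at \<open>x\<close>, which survives the flip. So the image of \<open>A\<close> is contained in the image
  of \<open>B\<close>, and both have the same number of edges.\<close>

lemma contract_eq_if_apex_changes:
  assumes st: "step V A B" and pq: "consec V p q" and V: "3 \<le> card V"
    and ne: "apex A p q \<noteq> apex B p q"
  shows "contract p q A = contract p q B"
proof -
  have T: "tri V A" "tri V B" "card (A - B) \<le> 1" using st unfolding step_def by auto
  define x where "x = apex A p q"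
  have x: "adj A p x" "adj A q x" using apex_adj[OF T(1) pq V] unfolding x_def by auto
  have xne: "x \<noteq> p" "x \<noteq> q" using x adj_irrefl[OF triD(1)[OF T(1)]] by auto
  have "\<not> (adj B p x \<and> adj B q x)" using apex_eq[OF T(2) pq] ne unfolding x_def by metis
  then obtain e where e: "e \<in> A - B" "e = (min p x, max p x) \<and> adj B q x \<or> e = (min q x, max q x) \<and> adj B p x \<or>
     (e = (min p x, max p x) \<and> (min q x, max q x) \<in> A - B)"
  proof -
    have a: "(min p x, max p x) \<in> A" "(min q x, max q x) \<in> A"
      using x adj_min_max[OF triD(1)[OF T(1)]] by auto
    have b: "(min p x, max p x) \<in> B \<Longrightarrow> adj B p x" "(min q x, max q x) \<in> B \<Longrightarrow> adj B q x"
      using adj_min_max[OF triD(1)[OF T(2)]] by auto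
    show thesis using that[of "(min p x, max p x)"] that[of "(min q x, max q x)"] a b
        \<open>\<not> (adj B p x \<and> adj B q x)\<close> by blast
  qed
  have one: "e' = e" if "e' \<in> A - B" for e'
    using that e(1) T(3) triD(6)[OF T(1)] card_le_Suc0_iff_eq[of "A - B"] by auto
  have e': "e = (min p x, max p x) \<and> adj B q x \<or> e = (min q x, max q x) \<and> adj B p x"
  proof -
    have "(min q x, max q x) \<noteq> (min p x, max p x)" using xne pq unfolding consec_def
      by (auto simp: min_def max_def split: if_splits)
    then show ?thesis using e(2) one by blast
  qed
  have sub: "contract p q A \<subseteq> contract p q B"
  proof clarify
    fix u v assume uv: "(u, v) \<in> contract p q A"
    then obtain a b where ab: "(a, b) \<in> A" "u = merge p q a" "v = merge p q b" "u \<noteq> v"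
      unfolding contract_def by auto
    show "(u, v) \<in> contract p q B"
    proof (cases "(a, b) \<in> B")
      case True
      then show ?thesis using ab contractI[OF True, of p q] by simp
    next
      case False
      then have eab: "(a, b) = e" using one ab(1) by blast
      have uv': "u < v" using uv contract_chords[OF triD(1)[OF T(1)] pq] unfolding chords_def by auto
      have "(u, v) = (min q x, max q x)"
        using e' eab ab(2,3) uv' xne unfolding merge_def by (auto simp: min_def max_def split: if_splits)
      moreover have "(min q x, max q x) \<in> contract p q B"
      proof (cases "adj B p x")
        case True
        then show ?thesis using contract_edge[OF True xne(2,1) triD(1)[OF T(2)] pq] by simp
      next
        case False
        then have q: "adj B q x" using e' by blast
        have "(min q x, max q x) \<in> B" using q adj_min_max[OF triD(1)[OF T(2)]] by auto
        moreover have "merge p q (min q x) = min q x" "merge p q (max q x) = max q x"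
          using xne pq unfolding merge_def consec_def by (auto simp: min_def max_def)
        ultimately show ?thesis using contractI[of "min q x" "max q x" B p q] xne
          by (auto simp: min_def max_def split: if_splits)
      qed
      ultimately show ?thesis by simp
    qed
  qed
  have tA: "tri (V - {p}) (contract p q A)" and tB: "tri (V - {p}) (contract p q B)"
    using tri_contract[OF _ pq V] T by auto
  show ?thesis using tri_maximal[OF tA triD(1,2)[OF tB] sub] by simp
qed

text \<open>Contracting a side turns a path into a shorter one: each change of the triangle on that side is a
  step saved.\<close>

lemma path_contract:
  assumes pq: "consec V p q" and V: "3 \<le> card V"
    and "\<And>i. i < m \<Longrightarrow> step V (f i) (f (Suc i))"
  shows "\<exists>m'. m' + card {i. i < m \<and> apex (f i) p q \<noteq> apex (f (Suc i)) p q} \<le> m \<and>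
     (step (V - {p}) ^^ m') (contract p q (f 0)) (contract p q (f m))"
  using assms(3)
proof (induction m)
  case 0
  then show ?case by (intro exI[of _ 0]) auto
next
  case (Suc m)
  let ?S = "\<lambda>m. {i. i < m \<and> apex (f i) p q \<noteq> apex (f (Suc i)) p q}"
  obtain m' where m': "m' + card (?S m) \<le> m" "(step (V - {p}) ^^ m') (contract p q (f 0)) (contract p q (f m))"
    using Suc.IH Suc.prems by auto
  have st: "step V (f m) (f (Suc m))" using Suc.prems by simp
  show ?case
  proof (cases "apex (f m) p q = apex (f (Suc m)) p q")
    case True
    then have "?S (Suc m) = ?S m" by (auto simp: less_Suc_eq)
    moreover have "(step (V - {p}) ^^ Suc m') (contract p q (f 0)) (contract p q (f (Suc m)))"
      using m'(2) step_contract[OF st pq V] by (rule relpowp_Suc_I)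
    ultimately show ?thesis using m'(1) by (intro exI[of _ "Suc m'"]) auto
  next
    case False
    then have "?S (Suc m) = insert m (?S m)" by (auto simp: less_Suc_eq)
    then have "card (?S (Suc m)) = Suc (card (?S m))" by simp
    then show ?thesis using m' contract_eq_if_apex_changes[OF st pq V False] by (intro exI[of _ m']) auto
  qed
qed

lemma few_changes:
  fixes h :: "nat \<Rightarrow> 'a"
  assumes "card {i. i < m \<and> h i \<noteq> h (Suc i)} < 2" "i < m" "h i \<noteq> h (Suc i)"
  shows "h m = h (Suc i)"
proof -
  let ?S = "{i. i < m \<and> h i \<noteq> h (Suc i)}"
  have one: "j = i" if "j < m" "h j \<noteq> h (Suc j)" for j
  proof (rule ccontr)
    assume "j \<noteq> i"
    then have "card {i, j} = 2" by simp
    moreover have "card {i, j} \<le> card ?S" using assms that by (intro card_mono) auto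
    ultimately show False using assms(1) by linarith
  qed
  have "Suc i \<le> j \<Longrightarrow> j \<le> m \<Longrightarrow> h j = h (Suc i)" for j
  proof (induction j rule: dec_induct)
    case (step j)
    then show ?case using one[of j] by (cases "h j = h (Suc j)") auto
  qed simp
  from this[of m] show ?thesis using assms(2) by simp
qed

lemma no_changes:
  fixes h :: "nat \<Rightarrow> 'a"
  assumes "{i. i < m \<and> h i \<noteq> h (Suc i)} = {}"
  shows "h m = h 0"
  using assms
proof (induction m)
  case (Suc m)
  then have "h m = h 0" "h m = h (Suc m)" by auto
  then show ?case by simp
qed simp

lemma far_if_apex_changes:
  assumes pq: "consec V p q" and V: "3 \<le> card V" and ne: "apex A p q \<noteq> apex B p q"
    and far: "far (V - {p}) (contract p q A) (contract p q B) N"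
  shows "far V A B (N + 1)"
  unfolding far_def
proof (intro allI impI)
  fix m assume "(step V ^^ m) A B"
  then obtain f where f: "f 0 = A" "f m = B" "\<And>i. i < m \<Longrightarrow> step V (f i) (f (Suc i))"
    unfolding relpowp_fun_conv by blast
  let ?S = "{i. i < m \<and> apex (f i) p q \<noteq> apex (f (Suc i)) p q}"
  have "?S \<noteq> {}" using no_changes[of m "\<lambda>i. apex (f i) p q"] f ne by auto
  then have "card ?S \<ge> 1" by (simp add: Suc_le_eq card_gt_0_iff)
  moreover obtain m' where "m' + card ?S \<le> m" "(step (V - {p}) ^^ m') (contract p q (f 0)) (contract p q (f m))"
    using path_contract[OF pq V, of m f] f(3) by blast
  ultimately show "N + 1 \<le> m" using far f unfolding far_def by fastforce
qed

lemma far_card: "far V A B (card (A - B))"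
  unfolding far_def
proof (intro allI impI)
  fix m show "(step V ^^ m) A B \<Longrightarrow> card (A - B) \<le> m"
  proof (induction m arbitrary: B)
    case 0 then show ?case by simp
  next
    case (Suc m)
    then obtain C where C: "(step V ^^ m) A C" "step V C B" by (meson relpowp_Suc_E)
    have fin: "finite C" using C(2) triD(6) unfolding step_def by blast
    have "finite A"
    proof (cases m)
      case 0 then show ?thesis using C fin by simp
    next
      case (Suc k)
      then obtain D where "step V A D" using C(1) by (meson relpowp_Suc_D2)
      then show ?thesis using triD(6) unfolding step_def by blast
    qed
    then have "card (A - B) \<le> card ((A - C) \<union> (C - B))" using fin by (intro card_mono) auto
    also have "\<dots> \<le> card (A - C) + card (C - B)" by (rule card_Un_le)
    finally show ?case using Suc.IH[OF C(1)] C(2) unfolding step_def by simp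
  qed
qed

lemma consec_outside:
  assumes "consec V p l" "consec V p r" "l < p" "p < r" "z \<in> V" "z \<noteq> l" "z \<noteq> r" "z \<noteq> p"
  shows "z < l \<or> r < z"
proof -
  have "\<not> (l < z \<and> z < p)" "\<not> (p < z \<and> z < r)" using assms unfolding consec_def by blast+
  then show ?thesis using assms(3,4,6-8) by linarith
qed

lemma ear_neighbours:
  assumes S: "tri V S" and pl: "consec V p l" "consec V p r" "l < p" "p < r" and lr: "(l, r) \<in> S"
    and z: "adj S p z"
  shows "z = l \<or> z = r"
proof (rule ccontr)
  assume *: "\<not> (z = l \<or> z = r)"
  have "z \<in> V" "z \<noteq> p" using adj_in[OF triD(1)[OF S] z] by auto
  then have "z < l \<or> r < z" using consec_outside[OF pl] * by blast
  then show False
  proof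
    assume zl: "z < l"
    then have "(z, p) \<in> S" using z pl adj_less[OF triD(1)[OF S], of z p] adj_sym[of S p z] by auto
    then show False using planarD[OF triD(2)[OF S] _ lr] zl pl by blast
  next
    assume rz: "r < z"
    then have "(p, z) \<in> S" using z pl adj_less[OF triD(1)[OF S], of p z] by auto
    then show False using planarD[OF triD(2)[OF S] lr] rz pl by blast
  qed
qed

text \<open>The source of the surplus in all lower bounds: deleting \<open>p\<close> lowers the number of vertices by one,
  but the distance by two. As \<open>p\<close> is an ear of \<open>A\<close>, the triangles on its two sides can first change
  only when \<open>lr\<close> is flipped, and then both change at once. If neither changed again, \<open>p\<close> would keep
  as its only interior edge the one that this flip created, whereas \<open>B\<close> has two. So one of the two
  sides sees its triangle change twice, and contracting that side saves two steps. Which side it is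
  depends on the path, hence the assumptions on both contractions.\<close>

lemma far_ear:
  assumes A: "tri V A" and B: "tri V B" and pl: "consec V p l" "consec V p r" "l < p" "p < r"
    and lr: "(l, r) \<in> A" and x: "adj B p x" "x \<noteq> l" "x \<noteq> r" and y: "adj B p y" "y \<noteq> l" "y \<noteq> r" and xy: "x \<noteq> y"
    and V: "3 \<le> card V"
    and far: "far (V - {p}) (contract p l A) (contract p l B) N" "far (V - {p}) (contract p r A) (contract p r B) N"
  shows "far V A B (N + 2)"
  unfolding far_def
proof (intro allI impI)
  fix m assume "(step V ^^ m) A B"
  then obtain f where f: "f 0 = A" "f m = B" and st: "\<And>i. i < m \<Longrightarrow> step V (f i) (f (Suc i))"
    unfolding relpowp_fun_conv by blast
  let ?S = "\<lambda>q. {i. i < m \<and> apex (f i) p q \<noteq> apex (f (Suc i)) p q}"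
  have enough: "N + 2 \<le> m" if h: "2 \<le> card (?S q)" "consec V p q" "far (V - {p}) (contract p q A) (contract p q B) N" for q
  proof -
    obtain m' where "m' + card (?S q) \<le> m" "(step (V - {p}) ^^ m') (contract p q (f 0)) (contract p q (f m))"
      using path_contract[OF h(2) V, of m f] st by blast
    then show ?thesis using h f unfolding far_def by fastforce
  qed
  have "2 \<le> card (?S l) \<or> 2 \<le> card (?S r)"
  proof (rule ccontr)
    assume *: "\<not> (2 \<le> card (?S l) \<or> 2 \<le> card (?S r))"
    have lrB: "(l, r) \<notin> B" using ear_neighbours[OF B pl] x by blast
    \<comment> \<open>the first time at which \<open>lr\<close> is gone; both sides at \<open>p\<close> change their triangle in the flip before\<close>
    define k where "k = (LEAST k. (l, r) \<notin> f k)"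
    have k: "(l, r) \<notin> f k" "k \<le> m" unfolding k_def using lrB f
        LeastI[of "\<lambda>k. (l, r) \<notin> f k" m] Least_le[of "\<lambda>k. (l, r) \<notin> f k" m] by auto
    have "k \<noteq> 0" using k lr f by metis
    then obtain i where i: "k = Suc i" using not0_implies_Suc by blast
    have fi: "(l, r) \<in> f i" using not_less_Least[of i "\<lambda>k. (l, r) \<notin> f k"] i unfolding k_def by auto
    have im: "i < m" using i k by simp
    have s: "step V (f i) (f k)" using st[OF im] i by simp
    have T: "tri V (f i)" "tri V (f k)" using s unfolding step_def by auto
    have side: "adj S p l" "adj S p r" if "tri V S" for S
      using tri_consec[OF that, of l p] tri_consec[OF that, of p r] pl consec_sym[of V l p] unfolding adj_def by blast+
    have aR: "apex (f i) p r = l" using apex_eq[OF T(1) pl(2)] side[OF T(1)] fi unfolding adj_def by blast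
    have aL: "apex (f i) p l = r" using apex_eq[OF T(1) pl(1)] side[OF T(1)] fi unfolding adj_def by blast
    define u where "u = apex (f k) p r"
    define v where "v = apex (f k) p l"
    have u: "adj (f k) p u" "adj (f k) r u" and v: "adj (f k) p v" "adj (f k) l v"
      using apex_adj[OF T(2) pl(2) V] apex_adj[OF T(2) pl(1) V] unfolding u_def v_def by auto
    have nlr: "\<not> adj (f k) r l" "\<not> adj (f k) l r"
      using k(1) tri_in[OF T(2), of r l] pl unfolding adj_def by auto
    have un: "u \<noteq> l" "u \<noteq> r" "v \<noteq> l" "v \<noteq> r"
      using u v nlr adj_irrefl[OF triD(1)[OF T(2)]] by blast+
    \<comment> \<open>\<open>pu\<close> and \<open>pv\<close> are both new after a single flip\<close>
    have uv: "u = v"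
    proof -
      have n: "\<not> adj (f i) p u" "\<not> adj (f i) p v" using ear_neighbours[OF T(1) pl fi] un by blast+
      have "card (f k - f i) \<le> 1" using step_sym[OF s] unfolding step_def by simp
      then have one: "e = e'" if "e \<in> f k - f i" "e' \<in> f k - f i" for e e'
        using that card_le_Suc0_iff_eq[of "f k - f i"] triD(6)[OF T(2)] by auto
      have "((p, u) \<in> f k - f i \<or> (u, p) \<in> f k - f i)" "((p, v) \<in> f k - f i \<or> (v, p) \<in> f k - f i)"
        using u(1) v(1) n unfolding adj_def by auto
      then show ?thesis using one by blast
    qed
    have "apex B p r = u" using few_changes[of m "\<lambda>i. apex (f i) p r" i] * im aR un i f unfolding u_def by auto
    then have uB: "adj B p u" "adj B r u" using apex_adj[OF B pl(2) V] by auto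
    have "apex B p l = u" using few_changes[of m "\<lambda>i. apex (f i) p l" i] * im aL un uv i f unfolding v_def by auto
    then have uB': "adj B l u" using apex_adj[OF B pl(1) V] by auto
    \<comment> \<open>the second interior edge at \<open>p\<close> crosses \<open>lu\<close> or \<open>ru\<close>\<close>
    obtain z where z: "adj B p z" "z \<noteq> l" "z \<noteq> r" "z \<noteq> u" using x y xy by (cases "x = u") auto
    have V1: "z \<in> V" "z \<noteq> p" "u \<in> V" "u \<noteq> p" using adj_in[OF triD(1)[OF B]] z(1) uB(1) by blast+
    have zo: "z < l \<or> r < z" and uo: "u < l \<or> r < u" using consec_outside[OF pl] V1 z un by blast+
    note less = adj_less[OF triD(1)[OF B]] and pn = planarD[OF triD(2)[OF B]]
    show False
    proof (cases "r < u")
      case True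
      have e: "(r, u) \<in> B" "(l, u) \<in> B" using less[of r u] less[of l u] True uB(2) uB' pl by auto
      show False
      proof (cases "z < l")
        case z': True
        then have zp: "(z, p) \<in> B" using less[of z p] z(1) pl adj_sym[of B p z] by auto
        show False using pn[OF zp e(2)] z' pl True by auto
      next
        case False
        then have rz: "r < z" using zo by simp
        then have zp: "(p, z) \<in> B" using less[of p z] z(1) pl by auto
        show False using pn[OF zp e(1)] pn[OF e(2) zp] rz pl z(4) True by (cases z u rule: linorder_cases) auto
      qed
    next
      case False
      then have ul: "u < l" using uo by simp
      have e: "(u, r) \<in> B" "(u, l) \<in> B" using less[of u r] less[of u l] ul uB(2) uB' pl adj_sym[of B r u] adj_sym[of B l u] by auto
      show False
      proof (cases "r < z")
        case z': True
        then have zp: "(p, z) \<in> B" using less[of p z] z(1) pl by auto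
        show False using pn[OF e(1) zp] z' pl ul by auto
      next
        case False
        then have zl: "z < l" using zo by simp
        then have zp: "(z, p) \<in> B" using less[of z p] z(1) pl adj_sym[of B p z] by auto
        show False using pn[OF zp e(1)] pn[OF e(2) zp] zl pl z(4) ul by (cases z u rule: linorder_cases) auto
      qed
    qed
  qed
  then show "N + 2 \<le> m" using enough pl far by blast
qed

section \<open>Deleting ears outside a subpolygon\<close>

text \<open>\<open>N\<close> is the vertex set of a polygon that is cut out of \<open>V\<close> by edges of \<open>T\<close>: each missing vertex lies
  behind an edge \<open>uv\<close> of \<open>T\<close> that is a side of this smaller polygon.\<close>

definition subpolygon :: "nat set \<Rightarrow> nat set \<Rightarrow> (nat \<times> nat) set \<Rightarrow> bool" where
  "subpolygon N V T \<longleftrightarrow> N \<subseteq> V \<and>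
     (\<forall>p\<in>V - N. \<exists>u\<in>N. \<exists>v\<in>N. (u, v) \<in> T \<and> u < p \<and> p < v \<and> (\<forall>x\<in>N. \<not> (u < x \<and> x < v)))"

definition side :: "nat set \<Rightarrow> nat \<Rightarrow> nat \<Rightarrow> bool" where
  "side V x y \<longleftrightarrow> consec V x y \<or> (\<forall>z\<in>V. x \<le> z \<and> z \<le> y)"

lemma subpolygonD:
  assumes "subpolygon N V T" "p \<in> V" "p \<notin> N"
  obtains u v where "u \<in> N" "v \<in> N" "(u, v) \<in> T" "u < p" "p < v" "\<And>x. x \<in> N \<Longrightarrow> \<not> (u < x \<and> x < v)"
proof -
  have "\<exists>u\<in>N. \<exists>v\<in>N. (u, v) \<in> T \<and> u < p \<and> p < v \<and> (\<forall>x\<in>N. \<not> (u < x \<and> x < v))"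
    using assms unfolding subpolygon_def by simp
  then obtain u v where "u \<in> N" "v \<in> N" "(u, v) \<in> T \<and> u < p \<and> p < v \<and> (\<forall>x\<in>N. \<not> (u < x \<and> x < v))"
    by (elim bexE)
  then show thesis using that[of u v] by simp
qed

text \<open>The triangle behind a side \<open>uv\<close> of the smaller polygon can be added to it.\<close>

lemma subpolygon_grow:
  assumes T: "tri V T" and N: "subpolygon N V T" "N \<noteq> V"
  shows "\<exists>x\<in>V - N. subpolygon (insert x N) V T"
proof -
  have NV: "N \<subseteq> V" using N(1) unfolding subpolygon_def by blast
  then obtain p where p: "p \<in> V" "p \<notin> N" using N(2) by blast
  obtain u v where uv: "u \<in> N" "v \<in> N" "(u, v) \<in> T" "u < p" "p < v" and gap: "\<And>x. x \<in> N \<Longrightarrow> \<not> (u < x \<and> x < v)"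
    using subpolygonD[OF N(1) p] by blast
  obtain x where x: "u < x" "x < v" "(u, x) \<in> T" "(x, v) \<in> T"
    using triangle_inside[OF T uv(3) p(1) uv(4,5)] by blast
  have xV: "x \<in> V" "x \<notin> N" using tri_in[OF T x(3)] gap[of x] x by auto
  have "subpolygon (insert x N) V T"
    unfolding subpolygon_def
  proof (intro conjI ballI)
    show "insert x N \<subseteq> V" using NV xV by auto
    fix p' assume "p' \<in> V - insert x N"
    then have p': "p' \<in> V" "p' \<notin> N" "p' \<noteq> x" by auto
    obtain w z where wz: "w \<in> N" "z \<in> N" "(w, z) \<in> T" "w < p'" "p' < z" and gap': "\<And>x. x \<in> N \<Longrightarrow> \<not> (w < x \<and> x < z)"
      using subpolygonD[OF N(1) p'(1,2)] by blast
    show "\<exists>u\<in>insert x N. \<exists>v\<in>insert x N. (u, v) \<in> T \<and> u < p' \<and> p' < v \<and> (\<forall>y\<in>insert x N. \<not> (u < y \<and> y < v))"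
    proof (cases "w < x \<and> x < z")
      case False
      then show ?thesis using wz gap' by (intro bexI[of _ w] bexI[of _ z]) auto
    next
      case True
      have "w = u" "z = v" using gap[OF wz(1)] gap[OF wz(2)] gap'[OF uv(1)] gap'[OF uv(2)] True x by linarith+
      show ?thesis
      proof (cases "p' < x")
        case True
        have "\<not> (u < y \<and> y < x)" if "y \<in> insert x N" for y using gap[of y] that x by auto
        then show ?thesis using True x uv wz \<open>w = u\<close> by (intro bexI[of _ u] bexI[of _ x]) auto
      next
        case False
        have "\<not> (x < y \<and> y < v)" if "y \<in> insert x N" for y using gap[of y] that x by auto
        then show ?thesis using False p'(3) x uv wz \<open>z = v\<close> by (intro bexI[of _ x] bexI[of _ v]) auto
      qed
    qed
  qed
  then show ?thesis using xV by blast
qed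

lemma subpolygon_of_size:
  assumes T: "tri V T" and "subpolygon N V T" "k \<le> card (V - N)"
  shows "\<exists>G. N \<subseteq> G \<and> subpolygon G V T \<and> card (V - G) = k"
  using assms(2,3)
proof (induction "card (V - N)" arbitrary: N rule: less_induct)
  case less
  show ?case
  proof (cases "card (V - N) = k")
    case True
    then show ?thesis using less.prems by blast
  next
    case False
    then have "N \<noteq> V" using less.prems(2) by auto
    then obtain x where x: "x \<in> V - N" "subpolygon (insert x N) V T"
      using subpolygon_grow[OF T less.prems(1)] by blast
    have "V - insert x N = (V - N) - {x}" by blast
    then have "card (V - insert x N) = card (V - N) - 1" using x(1) triD(4)[OF T] by simp
    then have "\<exists>G. insert x N \<subseteq> G \<and> subpolygon G V T \<and> card (V - G) = k"
      using False less.prems(2) x by (intro less.hyps) auto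
    then show ?thesis by blast
  qed
qed

text \<open>Growing \<open>N\<close> until a single vertex is missing leaves an ear of \<open>T\<close> as that vertex.\<close>

lemma ear_outside_subpolygon:
  assumes T: "tri V T" and N: "subpolygon N V T" "N \<noteq> V"
  obtains p l r where "p \<in> V - N" "consec V p l" "consec V p r" "l < p" "p < r" "(l, r) \<in> T"
proof -
  have NV: "N \<subseteq> V" using N(1) unfolding subpolygon_def by blast
  then have "V - N \<noteq> {}" using N(2) by blast
  then have "1 \<le> card (V - N)" using triD(4)[OF T] by (simp add: Suc_le_eq card_gt_0_iff)
  then obtain G where G: "N \<subseteq> G" "subpolygon G V T" "card (V - G) = 1"
    using subpolygon_of_size[OF T N(1)] by blast
  then obtain p where p: "V - G = {p}" by (auto simp: card_1_singleton_iff)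
  then have "p \<in> V" "p \<notin> G" by auto
  then obtain l r where lr: "l \<in> G" "r \<in> G" "(l, r) \<in> T" "l < p" "p < r" and gap: "\<And>x. x \<in> G \<Longrightarrow> \<not> (l < x \<and> x < r)"
    using subpolygonD[OF G(2)] by blast
  have gap': "z = p" if "z \<in> V" "l < z" "z < r" for z using gap[of z] p that by blast
  have lrV: "l \<in> V" "r \<in> V" using tri_in[OF T lr(3)] by auto
  have "consec V p l" unfolding consec_def
  proof (intro conjI ballI)
    fix z assume z: "z \<in> V"
    show "\<not> (p < z \<and> z < l)" using lr by linarith
    show "\<not> (l < z \<and> z < p)" using gap'[OF z] lr by linarith
  qed (use lr lrV \<open>p \<in> V\<close> in auto)
  moreover have "consec V p r" unfolding consec_def
  proof (intro conjI ballI)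
    fix z assume z: "z \<in> V"
    show "\<not> (p < z \<and> z < r)" using gap'[OF z] lr by linarith
    show "\<not> (r < z \<and> z < p)" using lr by linarith
  qed (use lr lrV \<open>p \<in> V\<close> in auto)
  ultimately show thesis using that[of p l r] lr \<open>p \<in> V\<close> \<open>p \<notin> G\<close> G(1) by blast
qed

lemma subpolygon_remove:
  assumes "subpolygon N V T" "p \<notin> N"
  shows "subpolygon N (V - {p}) (T \<inter> chords (V - {p}))"
  unfolding subpolygon_def
proof (intro conjI ballI)
  have NV: "N \<subseteq> V" using assms unfolding subpolygon_def by blast
  then show "N \<subseteq> V - {p}" using assms(2) by blast
  fix z assume "z \<in> V - {p} - N"
  then have "z \<in> V" "z \<notin> N" by auto
  then obtain u v where uv: "u \<in> N" "v \<in> N" "(u, v) \<in> T" "u < z" "z < v" "\<And>x. x \<in> N \<Longrightarrow> \<not> (u < x \<and> x < v)"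
    using subpolygonD[OF assms(1)] by blast
  have "(u, v) \<in> chords (V - {p})" using uv NV assms(2) unfolding chords_def by auto
  then show "\<exists>u\<in>N. \<exists>v\<in>N. (u, v) \<in> T \<inter> chords (V - {p}) \<and> u < z \<and> z < v \<and> (\<forall>x\<in>N. \<not> (u < x \<and> x < v))"
    using uv by blast
qed

text \<open>At an ear both contractions amount to deleting the ear.\<close>

lemma contract_ear:
  assumes A: "tri V A" and pl: "consec V p l" "consec V p r" "l < p" "p < r" and lr: "(l, r) \<in> A"
    and q: "q = l \<or> q = r"
  shows "contract p q A = A \<inter> chords (V - {p})"
proof (rule subset_antisym; clarify)
  fix u v assume uv: "(u, v) \<in> contract p q A"
  then obtain a b where ab: "(a, b) \<in> A" "u = merge p q a" "v = merge p q b" "u \<noteq> v"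
    unfolding contract_def by auto
  have c: "(u, v) \<in> chords (V - {p})" using uv q pl contract_chords[OF triD(1)[OF A], of p q] by blast
  have "(u, v) \<in> A"
  proof (cases "a = p \<or> b = p")
    case False
    then show ?thesis using ab unfolding merge_def by simp
  next
    case True
    have "a < b" using tri_in[OF A ab(1)] by simp
    have "b = r" if "a = p" using ear_neighbours[OF A pl lr, of b] that ab(1) \<open>a < b\<close> pl unfolding adj_def by auto
    moreover have "a = l" if "b = p" using ear_neighbours[OF A pl lr, of a] that ab(1) \<open>a < b\<close> pl unfolding adj_def by auto
    ultimately have "(a = p \<and> b = r) \<or> (a = l \<and> b = p)" using True by blast
    then show ?thesis using ab q lr pl unfolding merge_def by auto
  qed
  then show "(u, v) \<in> A \<inter> chords (V - {p})" using c by blast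
next
  fix a b assume "(a, b) \<in> A" "(a, b) \<in> chords (V - {p})"
  then have "merge p q a = a" "merge p q b = b" "a \<noteq> b" "(a, b) \<in> A" unfolding merge_def chords_def by auto
  then show "(a, b) \<in> contract p q A" using contractI[of a b A p q] by simp
qed

lemma tri_remove_ear:
  assumes "tri V A" "consec V p l" "consec V p r" "l < p" "p < r" "(l, r) \<in> A" "3 \<le> card V"
  shows "tri (V - {p}) (A \<inter> chords (V - {p}))"
  using tri_contract[OF assms(1,2,7)] contract_ear[OF assms(1-6), of l] by simp

lemma consec_left_unique: "consec V p l \<Longrightarrow> consec V p m \<Longrightarrow> l < p \<Longrightarrow> m < p \<Longrightarrow> l = m"
  unfolding consec_def by (cases l m rule: linorder_cases) auto

lemma consec_right_unique: "consec V p l \<Longrightarrow> consec V p m \<Longrightarrow> p < l \<Longrightarrow> p < m \<Longrightarrow> l = m"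
  unfolding consec_def by (cases l m rule: linorder_cases) auto

lemma consec_remove: "consec V x y \<Longrightarrow> x \<noteq> p \<Longrightarrow> y \<noteq> p \<Longrightarrow> consec (V - {p}) x y"
  unfolding consec_def by blast

lemma consec_across:
  assumes "consec V p l" "consec V p r" "l < p" "p < r"
  shows "consec (V - {p}) l r"
  unfolding consec_def
proof (intro conjI ballI)
  fix z assume z: "z \<in> V - {p}"
  show "\<not> (l < z \<and> z < r)" using consec_outside[OF assms, of z] z by auto
  show "\<not> (r < z \<and> z < l)" using assms by auto
qed (use assms in \<open>auto simp: consec_def\<close>)

text \<open>Deleting \<open>p\<close> makes only its two neighbours consecutive.\<close>

lemma consec_remove_cases:
  assumes c: "consec (V - {p}) x y" "p \<in> V" and pl: "consec V p l" "consec V p r" "l < p" "p < r"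
  shows "consec V x y \<or> {x, y} = {l, r}"
proof (rule ccontr)
  assume *: "\<not> (consec V x y \<or> {x, y} = {l, r})"
  have xy: "x \<in> V" "y \<in> V" "x \<noteq> y" "x \<noteq> p" "y \<noteq> p" "\<And>z. z \<in> V \<Longrightarrow> z \<noteq> p \<Longrightarrow> \<not> (x < z \<and> z < y) \<and> \<not> (y < z \<and> z < x)"
    using c(1) unfolding consec_def by auto
  have b: "x < p \<and> p < y \<or> y < p \<and> p < x" using * xy unfolding consec_def by blast
  have lV: "l \<in> V" "r \<in> V" "l \<noteq> p" "r \<noteq> p" using pl unfolding consec_def by auto
  have ox: "x < l \<or> r < x \<or> x = l \<or> x = r" and oy: "y < l \<or> r < y \<or> y = l \<or> y = r"
    using consec_outside[OF pl, of x] consec_outside[OF pl, of y] xy by blast+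
  have "x = l \<and> y = r \<or> x = r \<and> y = l"
    using xy(6)[OF lV(1,3)] xy(6)[OF lV(2,4)] b ox oy pl(3,4) by linarith
  then show False using * by blast
qed

lemma card_sides:
  assumes "finite V"
  shows "card {(x, y) \<in> chords V. side V x y} \<le> card V"
proof (cases "V = {}")
  case True then show ?thesis unfolding chords_def by simp
next
  case False
  let ?C = "{(x, y) \<in> chords V. consec V x y}"
  have "inj_on fst ?C"
  proof (rule inj_onI)
    fix e f assume "e \<in> ?C" "f \<in> ?C" "fst e = fst f"
    then show "e = f" using consec_right_unique[of V "fst e" "snd e" "snd f"]
      unfolding chords_def by (cases e; cases f) auto
  qed
  moreover have "fst ` ?C \<subseteq> V - {Max V}"
  proof
    fix x assume "x \<in> fst ` ?C"
    then obtain y where "x \<in> V" "y \<in> V" "x < y" unfolding chords_def by auto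
    then show "x \<in> V - {Max V}" using Max_ge[OF assms, of y] by auto
  qed
  ultimately have "card ?C \<le> card (V - {Max V})" using assms by (intro card_inj_on_le[of fst]) auto
  also have "\<dots> = card V - 1" using assms False by simp
  finally have C: "card ?C \<le> card V - 1" .
  have "{(x, y) \<in> chords V. side V x y} \<subseteq> insert (Min V, Max V) ?C"
  proof
    fix e assume "e \<in> {(x, y) \<in> chords V. side V x y}"
    then obtain x y where e: "e = (x, y)" and xy: "(x, y) \<in> chords V" "side V x y" by blast
    show "e \<in> insert (Min V, Max V) ?C"
    proof (cases "consec V x y")
      case False
      then have o: "\<forall>z\<in>V. x \<le> z \<and> z \<le> y" using xy unfolding side_def by auto
      have V: "x \<in> V" "y \<in> V" using xy(1) unfolding chords_def by auto
      have "Min V = x" using V o assms by (intro Min_eqI) auto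
      moreover have "Max V = y" using V o assms by (intro Max_eqI) auto
      ultimately show ?thesis using e by simp
    qed (use e xy in simp)
  qed
  moreover have f: "finite ?C" by (rule finite_subset[OF _ chords_finite[OF assms]]) auto
  ultimately have "card {(x, y) \<in> chords V. side V x y} \<le> card (insert (Min V, Max V) ?C)"
    by (intro card_mono) auto
  also have "\<dots> \<le> Suc (card ?C)" using f by (simp add: card_insert_if)
  also have "\<dots> \<le> card V" using C card_gt_0_iff[of V] False assms by linarith
  finally show ?thesis .
qed

lemma far_mono: "far V A B M \<Longrightarrow> N \<le> M \<Longrightarrow> far V A B N"
  unfolding far_def by (meson le_trans)

text \<open>Iterates \<open>far_ear\<close>: the vertices outside \<open>G\<close> are deleted one by one as ears of \<open>T\<close>. The assumption
  \<open>rich\<close> says that each of them has two interior edges in \<open>T'\<close> to vertices of \<open>G\<close>. These edges are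
  inherited by both contractions, since vertices of \<open>G\<close> never disappear and a contraction can turn
  an interior edge into a side only if it joins the neighbours of the deleted ear.

  The set \<open>D\<close> records which edges may become common to both triangulations. In the end all interior
  edges of \<open>T\<close> on \<open>G\<close> belong to it (\<open>D3\<close>), while \<open>T'\<close> has no interior edge in \<open>D\<close> at the start (\<open>D1\<close>)
  and acquires none by contraction (\<open>D2\<close>). So the final triangulations share only sides, and each of
  the \<open>card G - 3\<close> interior edges has to be flipped.\<close>

lemma far_outside_subpolygon:
  assumes "tri V T" "tri V T'" "subpolygon G V T" "3 \<le> card G"
    and rich: "\<And>b. b \<in> V - G \<Longrightarrow> \<exists>x\<in>G. \<exists>y\<in>G. x \<noteq> y \<and> adj T' b x \<and> adj T' b y \<and> \<not> consec V b x \<and> \<not> consec V b y"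
    and D1: "\<And>x y. (x, y) \<in> T' \<Longrightarrow> (x, y) \<in> D \<Longrightarrow> side V x y"
    and D2: "\<And>W p q x y. G \<subseteq> W \<Longrightarrow> W \<subseteq> V \<Longrightarrow> p \<in> W - G \<Longrightarrow> consec W p q \<Longrightarrow> (merge p q x, merge p q y) \<in> D \<Longrightarrow> (x, y) \<in> D"
    and D3: "\<And>x y. (x, y) \<in> T \<Longrightarrow> x \<in> G \<Longrightarrow> y \<in> G \<Longrightarrow> (x, y) \<in> D \<or> side G x y"
  shows "far V T T' (card G - 3 + 2 * card (V - G))"
  using assms
proof (induction "card (V - G)" arbitrary: V T T')
  case 0
  have GV: "G \<subseteq> V" using 0(4) unfolding subpolygon_def by blast
  then have V: "V = G" using 0(1) triD(4)[OF 0(2)] by auto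
  have "T \<inter> T' \<subseteq> {(x, y) \<in> chords V. side V x y}"
  proof clarify
    fix x y assume xy: "(x, y) \<in> T" "(x, y) \<in> T'"
    then have "side V x y" using "0.prems"(6,8)[of x y] V tri_in[OF 0(2) xy(1)] by blast
    then show "(x, y) \<in> chords V \<and> side V x y" using triD(1)[OF 0(2)] xy by auto
  qed
  then have "card (T \<inter> T') \<le> card {(x, y) \<in> chords V. side V x y}"
    using chords_finite[OF triD(4)[OF 0(2)]] by (intro card_mono) (auto intro: finite_subset[rotated])
  then have "card (T \<inter> T') \<le> card V" using card_sides[OF triD(4)[OF 0(2)]] by linarith
  moreover have "card (T - T') = card T - card (T \<inter> T')"
    using triD(6)[OF 0(2)] by (intro card_Diff_subset_Int) auto
  ultimately have "card G - 3 + 2 * card (V - G) \<le> card (T - T')"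
    using triD(3)[OF 0(2)] V by simp
  then show ?case using far_mono[OF far_card] by blast
next
  case (Suc n)
  note T = Suc.prems(1) and T' = Suc.prems(2) and G = Suc.prems(3) and rich = Suc.prems(5)
  have GV: "G \<subseteq> V" using G unfolding subpolygon_def by blast
  have "G \<noteq> V" using Suc.hyps(2) by auto
  then obtain p l r where p: "p \<in> V - G" and pl: "consec V p l" "consec V p r" "l < p" "p < r" and lr: "(l, r) \<in> T"
    using ear_outside_subpolygon[OF T G] by blast
  let ?W = "V - {p}" and ?A = "T \<inter> chords (V - {p})"
  have cV: "3 \<le> card V" using card_mono[OF triD(4)[OF T] GV] Suc.prems(4) by linarith
  have WG: "?W - G = (V - G) - {p}" by blast
  have cW: "n = card (?W - G)" using p Suc.hyps(2) triD(4)[OF T] unfolding WG by simp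
  obtain x y where xy: "x \<noteq> y" "adj T' p x" "adj T' p y" "\<not> consec V p x" "\<not> consec V p y"
    using rich[OF p] by blast
  have nlr: "x \<noteq> l" "x \<noteq> r" "y \<noteq> l" "y \<noteq> r" using xy pl by blast+
  \<comment> \<open>otherwise \<open>p\<close> would be an ear of \<open>T'\<close> as well\<close>
  have lrT': "(l, r) \<notin> T'" using ear_neighbours[OF T' pl _ xy(2)] nlr by blast
  have IH: "far ?W ?A (contract p q T') (card G - 3 + 2 * card (?W - G))" if q: "q = l \<or> q = r" for q
  proof (rule Suc.hyps(1)[OF cW])
    have pq: "consec V p q" using pl q by blast
    show "tri ?W ?A" using tri_remove_ear[OF T pl lr cV] .
    show tS: "tri ?W (contract p q T')" using tri_contract[OF T' pq cV] .
    show "subpolygon G ?W ?A" using subpolygon_remove[OF G] p by blast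
    show "3 \<le> card G" using Suc.prems(4) .
    fix b assume "b \<in> ?W - G"
    then have b: "b \<in> V - G" "b \<noteq> p" by auto
    obtain x y where xy: "x \<in> G" "y \<in> G" "x \<noteq> y" "adj T' b x" "adj T' b y" "\<not> consec V b x" "\<not> consec V b y"
      using rich[OF b(1)] by blast
    have keep: "adj (contract p q T') b z \<and> \<not> consec ?W b z" if z: "z \<in> G" "adj T' b z" "\<not> consec V b z" for z
    proof
      have "z \<noteq> p" "z \<noteq> b" using z p b by auto
      then show "adj (contract p q T') b z"
        using z(2) contractI[of b z T' p q] contractI[of z b T' p q] b(2) unfolding adj_def merge_def by auto
      show "\<not> consec ?W b z"
      proof
        assume "consec ?W b z"
        then have "{b, z} = {l, r}" using consec_remove_cases[OF _ _ pl] z(3) p by blast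
        then have "adj T' l r" using z(2) adj_sym unfolding doubleton_eq_iff by blast
        then show False using lrT' tri_in[OF T', of r l] pl unfolding adj_def by auto
      qed
    qed
    show "\<exists>x\<in>G. \<exists>y\<in>G. x \<noteq> y \<and> adj (contract p q T') b x \<and> adj (contract p q T') b y \<and> \<not> consec ?W b x \<and> \<not> consec ?W b y"
      using keep[OF xy(1,4,6)] keep[OF xy(2,5,7)] xy(1-3) by blast
  next
    fix u v assume uv: "(u, v) \<in> contract p q T'" "(u, v) \<in> D"
    have pq: "consec V p q" using pl q by blast
    obtain a b where ab: "(a, b) \<in> T'" "u = merge p q a" "v = merge p q b" "u \<noteq> v"
      using uv(1) unfolding contract_def by auto
    have "(a, b) \<in> D" using Suc.prems(7)[OF GV subset_refl p pq] uv(2) ab by blast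
    then have "side V a b" using Suc.prems(6) ab(1) by blast
    then consider "consec V a b" | "\<forall>z\<in>V. a \<le> z \<and> z \<le> b" unfolding side_def by blast
    then show "side ?W u v"
    proof cases
      case 1
      have ls: "consec ?W l r" "consec ?W r l" using consec_across[OF pl] consec_sym by blast+
      have nb: "z = l \<or> z = r" if z: "consec V p z" for z
      proof -
        have "z < p \<or> p < z" using z unfolding consec_def by auto
        then show ?thesis
          using consec_left_unique[OF pl(1) z pl(3)] consec_right_unique[OF pl(2) z pl(4)] by blast
      qed
      then have "consec ?W u v"
        using 1 ab(2-4) q ls nb[of a] nb[of b] consec_remove[OF 1, of p] consec_sym[of V a b] unfolding merge_def
        by (cases "a = p"; cases "b = p") auto
      then show ?thesis unfolding side_def by blast
    next
      case 2
      have "l \<in> V" "r \<in> V" using pl unfolding consec_def by auto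
      then have "a \<noteq> p" "b \<noteq> p" using 2 pl by auto
      then have "u = a" "v = b" using ab unfolding merge_def by auto
      then show ?thesis using 2 unfolding side_def by blast
    qed
  next
    fix W p' q' x y
    assume "G \<subseteq> W" "W \<subseteq> ?W" "p' \<in> W - G" "consec W p' q'" "(merge p' q' x, merge p' q' y) \<in> D"
    then show "(x, y) \<in> D" using Suc.prems(7)[of W p' q' x y] by blast
  next
    fix x y assume "(x, y) \<in> ?A" "x \<in> G" "y \<in> G"
    then show "(x, y) \<in> D \<or> side G x y" using Suc.prems(8) by blast
  qed
  have "far V T T' ((card G - 3 + 2 * card (?W - G)) + 2)"
    using far_ear[OF T T' pl lr xy(2) nlr(1,2) xy(3) nlr(3,4) xy(1) cV]
      IH[of l] IH[of r] contract_ear[OF T pl lr] by simp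
  moreover have "card G - 3 + 2 * card (V - G) = (card G - 3 + 2 * card (?W - G)) + 2"
    using cW Suc.hyps(2) by linarith
  ultimately show ?case by simp
qed

section \<open>Fans: the upper bound and the insertion of ears\<close>

text \<open>The closed neighbourhood of \<open>a\<close>. It is used for the smallest vertex \<open>a\<close> only, so that all
  neighbours of \<open>a\<close> are larger.\<close>

definition fan :: "nat set \<Rightarrow> nat \<Rightarrow> (nat \<times> nat) set \<Rightarrow> nat set" where
  "fan V a T = {x \<in> V. x = a \<or> (a, x) \<in> T}"

lemma subpolygon_fan:
  assumes T: "tri V T" and a: "a \<in> V" "\<And>x. x \<in> V \<Longrightarrow> a \<le> x"
    and p: "p \<in> V" "p \<notin> fan V a T"
  obtains u v where "(a, u) \<in> T" "(a, v) \<in> T" "(u, v) \<in> T" "u < p" "p < v" "\<And>x. x \<in> fan V a T \<Longrightarrow> \<not> (u < x \<and> x < v)"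
proof -
  have pn: "p \<noteq> a" "(a, p) \<notin> T" using p unfolding fan_def by auto
  then have ap: "a < p" using a(2)[OF p(1)] by simp
  obtain s where s: "consec V a s" "a < s" "s \<le> p" using ex_succ[OF triD(4)[OF T] a(1) p(1) ap] by blast
  have as: "(a, s) \<in> T" using tri_consec[OF T s(1,2)] .
  then have "s \<noteq> p" using pn by blast
  then have sp: "s < p" using s by simp
  have fV: "finite V" "V \<noteq> {}" using triD(4)[OF T] a by auto
  have M: "Max V \<in> V" "\<And>x. x \<in> V \<Longrightarrow> x \<le> Max V" using fV by auto
  have aM: "(a, Max V) \<in> T" using tri_outer[OF T a(1) M(1)] a(2) M(2) ap M(2)[OF p(1)] by auto
  then have pM: "p < Max V" using pn M(2)[OF p(1)] by (cases "p = Max V") auto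
  obtain u where u: "(a, u) \<in> T" "s \<le> u" "u < p" "\<And>y. u < y \<Longrightarrow> y < p \<Longrightarrow> (a, y) \<notin> T"
    using largest_below[of "\<lambda>y. (a, y) \<in> T" s p] as sp by blast
  obtain v where v: "(a, v) \<in> T" "v \<le> Max V" "p < v" "\<And>y. p < y \<Longrightarrow> y < v \<Longrightarrow> (a, y) \<notin> T"
    using smallest_above[of "\<lambda>y. (a, y) \<in> T" "Max V" p] aM pM by blast
  have gap: "(a, y) \<notin> T" if "u < y" "y < v" for y
    using u(4)[of y] v(4)[of y] pn(2) that by (cases y p rule: linorder_cases) auto
  have uv: "(u, v) \<in> T" using fan_step_left[OF T v(1) u(1)] gap u v by auto
  have "\<not> (u < x \<and> x < v)" if "x \<in> fan V a T" for x
    using that gap[of x] tri_in[OF T u(1)] unfolding fan_def by auto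
  then show thesis using that[of u v] u v uv by blast
qed

lemma subpolygon_fan_set:
  assumes T: "tri V T" and a: "a \<in> V" "\<And>x. x \<in> V \<Longrightarrow> a \<le> x"
  shows "subpolygon (fan V a T) V T"
  unfolding subpolygon_def
proof (intro conjI ballI)
  show "fan V a T \<subseteq> V" unfolding fan_def by blast
  fix p assume "p \<in> V - fan V a T"
  then have p: "p \<in> V" "p \<notin> fan V a T" by auto
  obtain u v where uv: "(a, u) \<in> T" "(a, v) \<in> T" "(u, v) \<in> T" "u < p" "p < v" "\<And>x. x \<in> fan V a T \<Longrightarrow> \<not> (u < x \<and> x < v)"
    using subpolygon_fan[OF T a p] by blast
  have "u \<in> fan V a T" "v \<in> fan V a T" using uv tri_in[OF T] unfolding fan_def by auto
  then show "\<exists>u\<in>fan V a T. \<exists>v\<in>fan V a T. (u, v) \<in> T \<and> u < p \<and> p < v \<and> (\<forall>x\<in>fan V a T. \<not> (u < x \<and> x < v))"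
    using uv by blast
qed

text \<open>If \<open>u\<close> and \<open>v\<close> are consecutive neighbours of \<open>a\<close> that are not consecutive vertices, then the
  edge \<open>uv\<close> is interior. Its flip joins \<open>a\<close> to the apex \<open>x\<close> of the triangle behind \<open>uv\<close>.\<close>

lemma flip_towards:
  assumes T: "tri V T" and a: "a \<in> V" "\<And>x. x \<in> V \<Longrightarrow> a \<le> x" and ne: "fan V a T \<noteq> V"
  obtains S x where "step V T S" "x \<in> V - fan V a T" "fan V a S = insert x (fan V a T)"
proof -
  obtain p where p: "p \<in> V" "p \<notin> fan V a T" using ne unfolding fan_def by blast
  obtain u v where uv: "(a, u) \<in> T" "(a, v) \<in> T" "(u, v) \<in> T" "u < p" "p < v" and gap: "\<And>x. x \<in> fan V a T \<Longrightarrow> \<not> (u < x \<and> x < v)"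
    using subpolygon_fan[OF T a p] by blast
  obtain x where x: "u < x" "x < v" "(u, x) \<in> T" "(x, v) \<in> T"
    using triangle_inside[OF T uv(3) p(1) uv(4,5)] by blast
  have xV: "x \<in> V" "u \<in> V" "v \<in> V" "a < u" using tri_in[OF T x(3)] tri_in[OF T uv(3)] tri_in[OF T uv(1)] by auto
  have xf: "x \<notin> fan V a T" using gap[of x] x by auto
  then have ax: "(a, x) \<notin> T" using xV unfolding fan_def by auto
  let ?R = "T - {(u, v)}"
  let ?S = "insert (a, x) ?R"
  note pn = planarD[OF triD(2)[OF T]]
  have nx: "\<not> xing a x c d" if cd: "(c, d) \<in> ?R" for c d
  proof
    assume "xing a x c d"
    have cdT: "(c, d) \<in> T" "(c, d) \<noteq> (u, v)" using cd by auto
    have "a \<le> c" using a(2) tri_in[OF T cdT(1)] by blast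
    then have o: "a < c" "c < x" "x < d" using \<open>xing a x c d\<close> unfolding xing_def by auto
    show False
    proof (cases c u rule: linorder_cases)
      case less
      then show False using pn[OF uv(1) cdT(1)] o x by auto
    next
      case greater
      then show False using pn[OF x(3) cdT(1)] o by auto
    next
      case equal
      then have "d \<noteq> v" using cdT by auto
      then show False
        using pn[OF cdT(1) x(4)] pn[OF uv(2) cdT(1)] o x equal by (cases d v rule: linorder_cases) auto
    qed
  qed
  have "planar ?S" using planar_insert[OF planar_subset[OF triD(2)[OF T]]] nx by blast
  moreover have "?S \<subseteq> chords V" using triD(1)[OF T] a xV x unfolding chords_def by auto
  moreover have "card ?S = card T" using ax uv(3) triD(6)[OF T] card_Suc_Diff1[OF triD(6)[OF T] uv(3)] by simp
  ultimately have S: "tri V ?S" using triD(3)[OF T] unfolding tri_def by simp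
  have "T - ?S \<subseteq> {(u, v)}" by auto
  then have "card (T - ?S) \<le> card {(u, v)}" by (intro card_mono) auto
  then have "step V T ?S" using T S unfolding step_def by simp
  moreover have "fan V a ?S = insert x (fan V a T)" using xV unfolding fan_def by auto
  ultimately show thesis using that[of ?S x] xV xf by blast
qed

lemma star_unique:
  assumes T: "tri V T" and S: "tri V S" and a: "a \<in> V" "\<And>x. x \<in> V \<Longrightarrow> a \<le> x"
    and "fan V a T = V" "fan V a S = V"
  shows "T = S"
proof -
  have "T \<subseteq> S"
  proof clarify
    fix x y assume xy: "(x, y) \<in> T"
    have V: "x \<in> V" "y \<in> V" "x < y" using tri_in[OF T xy] by auto
    show "(x, y) \<in> S"
    proof (cases "x = a")
      case True
      have "y \<in> fan V a S" using assms V by simp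
      then show ?thesis using True V unfolding fan_def by auto
    next
      case False
      then have ax: "a < x" using a(2)[OF V(1)] by simp
      have "consec V x y" unfolding consec_def
      proof (intro conjI ballI)
        fix z assume z: "z \<in> V"
        show "\<not> (x < z \<and> z < y)"
        proof
          assume *: "x < z \<and> z < y"
          have "z \<in> fan V a T" using z assms by simp
          then have "(a, z) \<in> T" using * ax unfolding fan_def by auto
          then show False using planarD[OF triD(2)[OF T] _ xy] * ax by blast
        qed
        show "\<not> (y < z \<and> z < x)" using V by auto
      qed (use V in auto)
      then show ?thesis using tri_consec[OF S] V by blast
    qed
  qed
  then show ?thesis using tri_maximal[OF T triD(1,2)[OF S]] by simp
qed

lemma path_to_star:
  assumes "tri V T" and a: "a \<in> V" "\<And>x. x \<in> V \<Longrightarrow> a \<le> x"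
  shows "\<exists>S. tri V S \<and> fan V a S = V \<and> (step V ^^ card (V - fan V a T)) T S"
  using assms(1)
proof (induction "card (V - fan V a T)" arbitrary: T)
  case 0
  have "fan V a T \<subseteq> V" unfolding fan_def by auto
  then have "fan V a T = V" using 0(1) triD(4)[OF 0(2)] by auto
  then show ?case using 0 by (intro exI[of _ T]) auto
next
  case (Suc n)
  have "fan V a T \<noteq> V" using Suc(2) by auto
  then obtain R x where R: "step V T R" "x \<in> V - fan V a T" "fan V a R = insert x (fan V a T)"
    using flip_towards[OF Suc(3) a] by blast
  have TR: "tri V R" using R unfolding step_def by blast
  have "V - fan V a R = (V - fan V a T) - {x}" using R(3) by blast
  then have n: "n = card (V - fan V a R)" using R(2) Suc(2) triD(4)[OF TR] by simp
  then obtain S where S: "tri V S" "fan V a S = V" "(step V ^^ n) R S" using Suc(1)[OF n TR] by auto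
  have "(step V ^^ Suc n) T S" using relpowp_Suc_I2[OF R(1) S(3)] .
  then show ?case using S Suc(2) by auto
qed

lemma relpowp_sym:
  assumes "\<And>x y. R x y \<Longrightarrow> R y x" shows "(R ^^ n) x y \<Longrightarrow> (R ^^ n) y x"
proof (induction n arbitrary: y)
  case (Suc n)
  then obtain z where "(R ^^ n) x z" "R z y" by (elim relpowp_Suc_E)
  then show ?case using relpowp_Suc_I2[OF assms Suc.IH] by blast
qed auto

text \<open>Both triangulations can be flipped into the star of \<open>a\<close>, creating an edge at \<open>a\<close> in each flip.\<close>

theorem distance_via_star:
  assumes T: "tri V T" and S: "tri V S" and a: "a \<in> V" "\<And>x. x \<in> V \<Longrightarrow> a \<le> x"
  shows "(step V ^^ (card (V - fan V a T) + card (V - fan V a S))) T S"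
proof -
  obtain T' where T': "tri V T'" "fan V a T' = V" "(step V ^^ card (V - fan V a T)) T T'"
    using path_to_star[OF T a] by blast
  obtain S' where S': "tri V S'" "fan V a S' = V" "(step V ^^ card (V - fan V a S)) S S'"
    using path_to_star[OF S a] by blast
  have "T' = S'" using star_unique[OF T'(1) S'(1) a T'(2) S'(2)] .
  then have "(step V ^^ card (V - fan V a S)) T' S" using relpowp_sym[of "step V", OF step_sym S'(3)] by simp
  then show ?thesis using T'(3) unfolding relpowp_add by blast
qed

text \<open>The surplus of the eccentricity of \<open>T\<close> over \<open>card V - 3\<close>, bounded from below by \<open>K\<close>.\<close>

definition excess_ge :: "nat set \<Rightarrow> (nat \<times> nat) set \<Rightarrow> nat \<Rightarrow> bool" where
  "excess_ge V T K \<longleftrightarrow> (\<exists>T'. tri V T' \<and> far V T T' (card V - 3 + K))"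

text \<open>Given a triangulation \<open>S\<close> far from \<open>T\<close> without the ear, insert \<open>p\<close> on the side \<open>lr\<close> of \<open>S\<close> and join
  it to the apex \<open>x\<close> of that side. Contracting \<open>p\<close> onto \<open>r\<close> undoes this. As \<open>p\<close> is an ear of \<open>T\<close> but
  not of the new triangulation, the triangle on \<open>pr\<close> has to change, which costs one more flip.\<close>

lemma excess_insert_ear:
  assumes T: "tri V T" and pl: "consec V p l" "consec V p r" "l < p" "p < r" and lr: "(l, r) \<in> T"
    and V: "4 \<le> card V" and ex: "excess_ge (V - {p}) (T \<inter> chords (V - {p})) K"
  shows "excess_ge V T K"
proof -
  let ?W = "V - {p}"
  have pV: "p \<in> V" "l \<in> V" "r \<in> V" using pl unfolding consec_def by auto
  have cW: "card ?W = card V - 1" using pV triD(4)[OF T] by simp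
  obtain S where S: "tri ?W S" and far: "far ?W (T \<inter> chords ?W) S (card ?W - 3 + K)"
    using ex unfolding excess_ge_def by blast
  have clr: "consec ?W l r" using consec_across[OF pl] .
  have lrS: "(l, r) \<in> S" using tri_consec[OF S clr] pl by simp
  define x where "x = apex S l r"
  have x: "adj S l x" "adj S r x" using apex_adj[OF S clr] cW V unfolding x_def by auto
  have xW: "x \<in> V" "x \<noteq> p" "x \<noteq> l" "x \<noteq> r" using adj_in[OF triD(1)[OF S]] x by blast+
  have xo: "x < l \<or> r < x" using consec_outside[OF pl xW(1,3,4,2)] .
  let ?R = "S - {(l, r)}"
  have RW: "c \<in> V \<and> d \<in> V \<and> c \<noteq> p \<and> d \<noteq> p \<and> c < d" if "(c, d) \<in> S" for c d using tri_in[OF S that] by auto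
  note pn = planarD[OF triD(2)[OF S]]
  define e where "e = (min p x, max p x)"
  \<comment> \<open>an edge of \<open>S\<close> crossing \<open>px\<close> also crosses one of the edges \<open>lx\<close> and \<open>rx\<close>, unless it is \<open>lr\<close>\<close>
  have e_cross: "\<not> xing (fst e) (snd e) c d" if cd: "(c, d) \<in> ?R" for c d
  proof
    assume *: "xing (fst e) (snd e) c d"
    have cdS: "(c, d) \<in> S" "(c, d) \<noteq> (l, r)" using cd by auto
    have cdV: "c \<in> V" "d \<in> V" "c \<noteq> p" "d \<noteq> p" "c < d" using RW[OF cdS(1)] by auto
    have oc: "c < l \<or> r < c \<or> c = l \<or> c = r" and od: "d < l \<or> r < d \<or> d = l \<or> d = r"
      using consec_outside[OF pl cdV(1)] consec_outside[OF pl cdV(2)] cdV by blast+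
    show False
    proof (cases "x < l")
      case True
      have xl: "(x, l) \<in> S" "(x, r) \<in> S" using x adj_less[OF triD(1)[OF S]] True pl adj_sym by (metis less_trans)+
      have *: "x < c \<and> c < p \<and> p < d \<or> c < x \<and> x < d \<and> d < p"
        using * True pl unfolding e_def xing_def by auto
      then show False
      proof
        assume o: "c < x \<and> x < d \<and> d < p"
        then have "d < r" using od pl by linarith
        then show False using pn[OF cdS(1) xl(2)] o by blast
      next
        assume o: "x < c \<and> c < p \<and> p < d"
        then have "c \<le> l" "r \<le> d" using oc od pl by linarith+
        then consider "c < l" | "c = l" "r < d" using cdS(2) by (cases "c = l"; cases "d = r") auto
        then show False
        proof cases
          case 1 then show False using pn[OF xl(1) cdS(1)] o pl \<open>r \<le> d\<close> by auto
        next
          case 2 then show False using pn[OF xl(2) cdS(1)] o pl by auto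
        qed
      qed
    next
      case False
      then have rx: "r < x" using xo by simp
      have xl: "(l, x) \<in> S" "(r, x) \<in> S" using x adj_less[OF triD(1)[OF S]] rx pl by (metis less_trans)+
      have *: "p < c \<and> c < x \<and> x < d \<or> c < p \<and> p < d \<and> d < x"
        using * rx pl unfolding e_def xing_def by auto
      then show False
      proof
        assume o: "p < c \<and> c < x \<and> x < d"
        then have "l < c" using oc pl by linarith
        then show False using pn[OF xl(1) cdS(1)] o by blast
      next
        assume o: "c < p \<and> p < d \<and> d < x"
        then have "c \<le> l" "r \<le> d" using oc od pl by linarith+
        then consider "r < d" | "d = r" "c < l" using cdS(2) by (cases "c = l"; cases "d = r") auto
        then show False
        proof cases
          case 1 then show False using pn[OF cdS(1) xl(2)] o pl \<open>c \<le> l\<close> by auto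
        next
          case 2 then show False using pn[OF cdS(1) xl(1)] o pl by auto
        qed
      qed
    qed
  qed
  let ?R1 = "insert e ?R"
  have R1: "planar ?R1" using planar_insert[OF planar_subset[OF triD(2)[OF S]], of ?R "fst e" "snd e"] e_cross by simp
  have consec_cross: "\<not> xing a b c d" if "consec V a b" "c \<in> V" "d \<in> V" for a b c d
    using that unfolding xing_def consec_def by blast
  have R1V: "c \<in> V \<and> d \<in> V" if "(c, d) \<in> ?R1" for c d
    using that RW[of c d] xW pV unfolding e_def by (auto simp: min_def max_def split: if_splits)
  have R2: "planar (insert (l, p) ?R1)"
    using planar_insert[OF R1] consec_cross[of l p] pl(1) consec_sym[of V l p] R1V by blast
  have R2V: "c \<in> V \<and> d \<in> V" if "(c, d) \<in> insert (l, p) ?R1" for c d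
    using that R1V[of c d] pV by auto
  let ?S = "insert (p, r) (insert (l, p) ?R1)"
  have R3: "planar ?S" using planar_insert[OF R2] consec_cross[of p r] pl(2) R2V by blast
  have "e \<in> chords V" using xW pV unfolding e_def chords_def by (auto simp: min_def max_def)
  then have ch: "?S \<subseteq> chords V" using RW pV pl unfolding chords_def by auto
  have new: "e \<notin> S" "(l, p) \<notin> S" "(p, r) \<notin> S" "(p, r) \<noteq> (l, p)" "e \<noteq> (l, p)" "e \<noteq> (p, r)"
    using RW xW pl unfolding e_def by (auto simp: min_def max_def split: if_splits)
  have "card ?R = card S - 1" using lrS triD(6)[OF S] by simp
  moreover have "card ?S = card ?R + 3" using new triD(6)[OF S] by simp
  ultimately have "card ?S = card S + 2" using lrS triD(3)[OF S] cW V by linarith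
  then have TS: "tri V ?S" using R3 ch triD(3)[OF S] cW V unfolding tri_def by linarith
  have "S \<subseteq> contract p r ?S"
  proof clarify
    fix c d assume cd: "(c, d) \<in> S"
    show "(c, d) \<in> contract p r ?S"
    proof (cases "(c, d) = (l, r)")
      case True
      then show ?thesis using contractI[of l p ?S p r] pl unfolding merge_def by auto
    next
      case False
      then show ?thesis using contractI[of c d ?S p r] cd RW[OF cd] unfolding merge_def by auto
    qed
  qed
  then have cS: "contract p r ?S = S"
    using tri_maximal[OF S] triD(1,2)[OF tri_contract[OF TS pl(2)]] V by simp
  have side: "adj T p l" using tri_consec[OF T, of l p] pl consec_sym[of V l p] unfolding adj_def by blast
  have "apex T p r = l" using apex_eq[OF T pl(2) side] lr unfolding adj_def by blast
  moreover have "apex ?S p r \<noteq> l"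
  proof
    assume "apex ?S p r = l"
    then have "adj ?S r l" using apex_adj(2)[OF TS pl(2)] V by simp
    moreover have "(l, r) \<notin> ?S" "(r, l) \<notin> ?S" using new RW[of r l] xW pl unfolding e_def
      by (auto simp: min_def max_def split: if_splits)
    ultimately show False unfolding adj_def by blast
  qed
  ultimately have ne: "apex T p r \<noteq> apex ?S p r" by simp
  have "far V T ?S (card ?W - 3 + K + 1)"
    using far_if_apex_changes[OF pl(2) _ ne] far cS contract_ear[OF T pl lr] V by simp
  then have "far V T ?S (card V - 3 + K)" using cW V by (elim far_mono) simp
  then show ?thesis using TS unfolding excess_ge_def by blast
qed

section \<open>Triangulations with a large fan\<close>

lemma card_le_one_if: "(\<And>x y. x \<in> A \<Longrightarrow> y \<in> A \<Longrightarrow> x = y) \<Longrightarrow> card A \<le> 1"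
  using card_le_Suc0_iff_eq[of A] by (cases "finite A") auto

text \<open>Call the elements of \<open>B\<close> bad. Take the smallest window in which the good elements are at least \<open>m\<close>
  times as many as the bad ones, and which is not free of bad ones. Two bad elements could be
  separated, and one of the two parts would be a smaller such window; and with more than \<open>m\<close> good
  elements, an end of the window could be dropped.\<close>

lemma balanced_window:
  fixes W B :: "nat set"
  assumes W: "finite W" and B: "B \<subseteq> W" "B \<noteq> {}" and many: "m * card B \<le> card (W - B)"
  obtains i j b where "W \<inter> {i..j} \<inter> B = {b}" "card (W \<inter> {i..j} - B) = m"
proof -
  define win where "win = (\<lambda>w. (\<exists>i j. w = W \<inter> {i..j}) \<and> w \<inter> B \<noteq> {} \<and> m * card (w \<inter> B) \<le> card (w - B))"
  have "win W"
  proof -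
    have "W = W \<inter> {0..Max W}" using W by auto
    moreover have "W \<inter> B = B" using B by blast
    ultimately show ?thesis unfolding win_def using B many by metis
  qed
  then obtain w where w: "win w" and least: "\<And>v. win v \<Longrightarrow> card w \<le> card v"
    using ex_has_least_nat[of win W card] by blast
  obtain i j where ij: "w = W \<inter> {i..j}" using w unfolding win_def by blast
  have fw: "finite w" using ij W by simp
  have wB: "w \<inter> B \<noteq> {}" "m * card (w \<inter> B) \<le> card (w - B)" using w unfolding win_def by auto
  define b where "b = Min (w \<inter> B)"
  have b: "b \<in> w" "b \<in> B" and bmin: "\<And>z. z \<in> w \<inter> B \<Longrightarrow> b \<le> z"
    using Min_in[of "w \<inter> B"] Min_le[of "w \<inter> B"] fw wB(1) unfolding b_def by auto
  have smaller: False if "win v" "v \<subset> w" for v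
    using least[OF that(1)] psubset_card_mono[OF fw that(2)] by simp
  have single: "w \<inter> B = {b}"
  proof (rule ccontr)
    assume "w \<inter> B \<noteq> {b}"
    then obtain b' where b': "b' \<in> w" "b' \<in> B" "b' \<noteq> b" using b by blast
    then have bb: "b < b'" using bmin[of b'] by auto
    let ?l = "W \<inter> {i..b}" and ?r = "W \<inter> {Suc b..j}"
    have lr: "w = ?l \<union> ?r" "?l \<inter> ?r = {}" using b(1) ij by auto
    have inl: "b \<in> ?l" "b' \<notin> ?l" "b' \<in> ?r" "b \<notin> ?r" using b b' bb ij by auto
    have "?l \<subset> w" "?r \<subset> w" using lr inl b b' by blast+
    then have "\<not> win ?l" "\<not> win ?r" using smaller by blast+
    then have less: "card (?l - B) < m * card (?l \<inter> B)" "card (?r - B) < m * card (?r \<inter> B)"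
      using inl b b' unfolding win_def by (auto simp: not_le)
    have "w \<inter> B = (?l \<inter> B) \<union> (?r \<inter> B)" "w - B = (?l - B) \<union> (?r - B)" using lr by blast+
    moreover have "card ((?l \<inter> B) \<union> (?r \<inter> B)) = card (?l \<inter> B) + card (?r \<inter> B)"
      using W lr(2) by (intro card_Un_disjoint) auto
    moreover have "card ((?l - B) \<union> (?r - B)) = card (?l - B) + card (?r - B)"
      using W lr(2) by (intro card_Un_disjoint) auto
    ultimately have "card (w \<inter> B) = card (?l \<inter> B) + card (?r \<inter> B)" "card (w - B) = card (?l - B) + card (?r - B)"
      by simp_all
    then show False using less wB(2) by (simp add: distrib_left)
  qed
  have "card (w - B) = m"
  proof (rule ccontr)
    assume "card (w - B) \<noteq> m"
    then have ge: "m + 1 \<le> card (w - B)" using wB(2) single by simp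
    have shrink: False if z: "z \<in> w" "z \<noteq> b" "w - {z} = W \<inter> {i'..j'}" for z i' j'
    proof -
      have zB: "z \<notin> B" using z single by blast
      have "(w - {z}) \<inter> B = {b}" using single z by blast
      moreover have "w - {z} - B = (w - B) - {z}" by blast
      moreover have "card ((w - B) - {z}) = card (w - B) - 1" using z zB fw by simp
      ultimately have c: "card ((w - {z}) \<inter> B) = 1" "(w - {z}) \<inter> B \<noteq> {}" "m \<le> card (w - {z} - B)"
        using ge by simp_all
      have "win (w - {z})" unfolding win_def
      proof (intro conjI)
        show "\<exists>i j. w - {z} = W \<inter> {i..j}" using z(3) by blast
        show "m * card ((w - {z}) \<inter> B) \<le> card (w - {z} - B)" using c(1,3) by simp
      qed (rule c(2))
      then show False using smaller z by blast
    qed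
    have "w - B \<noteq> {}"
    proof
      assume "w - B = {}"
      then have "card (w - B) = card ({} :: nat set)" by (rule arg_cong)
      then show False using ge by simp
    qed
    then obtain g where g: "g \<in> w" "g \<noteq> b" using b by blast
    have ne: "w \<noteq> {}" using b(1) by blast
    note M = Max_in[OF fw ne] Max_ge[OF fw] and m = Min_in[OF fw ne] Min_le[OF fw]
    show False
    proof (cases "Max w = b")
      case False
      have "w - {Max w} = W \<inter> {i..Max w - 1}"
      proof
        show "w - {Max w} \<subseteq> W \<inter> {i..Max w - 1}"
        proof
          fix z assume z: "z \<in> w - {Max w}"
          then have "z \<le> Max w" "z \<noteq> Max w" using M(2)[of z] by auto
          moreover have "z \<in> W" "i \<le> z" using z ij by auto
          ultimately show "z \<in> W \<inter> {i..Max w - 1}" by simp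
        qed
        have "1 \<le> Max w" using M(2)[OF b(1)] False by linarith
        then show "W \<inter> {i..Max w - 1} \<subseteq> w - {Max w}" using M(1) ij by auto
      qed
      then show False using shrink[OF M(1) False] by blast
    next
      case True
      then have nb: "Min w \<noteq> b" using m(2)[OF g(1)] M(2)[OF g(1)] g(2) by auto
      have "w - {Min w} = W \<inter> {Suc (Min w)..j}"
      proof
        show "w - {Min w} \<subseteq> W \<inter> {Suc (Min w)..j}"
        proof
          fix z assume z: "z \<in> w - {Min w}"
          then have "Min w \<le> z" "z \<noteq> Min w" using m(2)[of z] by auto
          moreover have "z \<in> W" "z \<le> j" using z ij by auto
          ultimately show "z \<in> W \<inter> {Suc (Min w)..j}" by simp
        qed
        show "W \<inter> {Suc (Min w)..j} \<subseteq> w - {Min w}" using m(1) ij by auto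
      qed
      then show False using shrink[OF m(1) nb] by blast
    qed
  qed
  then show thesis using that[of i j b] single ij by simp
qed

text \<open>Join the bad element of a balanced window to the good ones in it, remove the window and continue:
  later edges have both ends outside the window, so they cannot cross its edges.\<close>

lemma planar_matching:
  fixes W B :: "nat set"
  assumes "finite W" "B \<subseteq> W" "m * card B \<le> card (W - B)"
  shows "\<exists>E. E \<subseteq> chords W \<and> planar E \<and> (\<forall>b\<in>B. \<exists>X \<subseteq> W - B. card X = m \<and> (\<forall>x\<in>X. adj E b x))"
  using assms
proof (induction "card B" arbitrary: W B)
  case 0
  then have "B = {}" using finite_subset by fastforce
  then show ?case by (intro exI[of _ "{}"]) (auto simp: planar_def)
next
  case (Suc n)
  have "B \<noteq> {}" using Suc(2) by auto
  then obtain i j b where bB: "W \<inter> {i..j} \<inter> B = {b}" and X: "card (W \<inter> {i..j} - B) = m"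
    using balanced_window[OF Suc.prems(1,2) _ Suc.prems(3)] by blast
  let ?w = "W \<inter> {i..j}"
  let ?X = "?w - B"
  have b: "b \<in> W" "b \<in> B" "i \<le> b" "b \<le> j" using bB by auto
  have fB: "finite B" using Suc.prems finite_subset by blast
  have n: "n = card (B - {b})" using Suc(2) b fB by simp
  have "(W - ?w) - (B - {b}) = (W - B) - ?X" using bB b by blast
  moreover have "card ((W - B) - ?X) = card (W - B) - card ?X"
    using Suc.prems(1) by (intro card_Diff_subset) auto
  ultimately have c: "card ((W - ?w) - (B - {b})) = card (W - B) - m" using X by simp
  have BW: "B - {b} \<subseteq> W - ?w" using bB Suc.prems(2) by blast
  have "\<exists>E. E \<subseteq> chords (W - ?w) \<and> planar E \<and> (\<forall>b'\<in>B - {b}. \<exists>X \<subseteq> (W - ?w) - (B - {b}). card X = m \<and> (\<forall>x\<in>X. adj E b' x))"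
  proof (rule Suc.hyps(1)[OF n _ BW])
    have "m * card B = m + m * card (B - {b})" using Suc(2) n by (metis mult_Suc_right)
    then show "m * card (B - {b}) \<le> card ((W - ?w) - (B - {b}))" using Suc.prems(3) c by linarith
  qed (use Suc.prems(1) in simp)
  then obtain E where E: "E \<subseteq> chords (W - ?w)" "planar E"
    and adjE: "\<And>b'. b' \<in> B - {b} \<Longrightarrow> \<exists>X \<subseteq> (W - ?w) - (B - {b}). card X = m \<and> (\<forall>x\<in>X. adj E b' x)" by blast
  define F where "F = (\<lambda>x. (min b x, max b x)) ` ?X"
  have F: "c \<in> ?w \<and> d \<in> ?w \<and> c < d \<and> (c = b \<or> d = b)" if cd: "(c, d) \<in> F" for c d
  proof -
    obtain x where x: "x \<in> ?X" "c = min b x" "d = max b x" using cd unfolding F_def by auto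
    then have "x \<noteq> b" "x \<in> ?w" "b \<in> ?w" using b by auto
    then show ?thesis using x by (cases "b < x") (auto simp: min_def max_def)
  qed
  have E': "c \<in> W \<and> d \<in> W \<and> c \<notin> {i..j} \<and> d \<notin> {i..j} \<and> c < d" if "(c, d) \<in> E" for c d
    using that E(1) unfolding chords_def by auto
  have "planar (E \<union> F)"
    unfolding planar_def
  proof (intro allI impI notI)
    fix u v c d assume uv: "(u, v) \<in> E \<union> F" and cd: "(c, d) \<in> E \<union> F" and o: "u < c \<and> c < v \<and> v < d"
    consider "(u, v) \<in> E" "(c, d) \<in> E" | "(u, v) \<in> E" "(c, d) \<in> F" | "(u, v) \<in> F" "(c, d) \<in> E" | "(u, v) \<in> F" "(c, d) \<in> F"
      using uv cd by blast
    then show False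
    proof cases
      case 1 then show False using planarD[OF E(2)] o by blast
    next
      case 2 then show False using E'[of u v] F[of c d] o by auto
    next
      case 3 then show False using E'[of c d] F[of u v] o by auto
    next
      case 4 then show False using F[of u v] F[of c d] o by auto
    qed
  qed
  moreover have "E \<union> F \<subseteq> chords W" using E' F unfolding chords_def by auto
  moreover have "\<exists>X \<subseteq> W - B. card X = m \<and> (\<forall>x\<in>X. adj (E \<union> F) b' x)" if b': "b' \<in> B" for b'
  proof (cases "b' = b")
    case True
    have "adj (E \<union> F) b x" if "x \<in> ?X" for x
    proof -
      have "(min b x, max b x) \<in> F" using that unfolding F_def by blast
      then show ?thesis unfolding adj_def by (auto simp: min_def max_def split: if_splits)
    qed
    then show ?thesis using True X by (intro exI[of _ ?X]) auto
  next
    case False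
    then obtain X where "X \<subseteq> (W - ?w) - (B - {b})" "card X = m" "\<forall>x\<in>X. adj E b' x"
      using adjE[of b'] b' by blast
    moreover from this have "X \<subseteq> W - B" using b by auto
    ultimately show ?thesis unfolding adj_def by blast
  qed
  ultimately show ?case by blast
qed

lemma card_consec:
  assumes "finite X"
  shows "card {x \<in> X. consec V b x} \<le> 2"
proof -
  have "card {x \<in> X. consec V b x \<and> x < b} \<le> 1"
    by (rule card_le_one_if) (auto intro: consec_left_unique)
  moreover have "card {x \<in> X. consec V b x \<and> b < x} \<le> 1"
    by (rule card_le_one_if) (auto intro: consec_right_unique)
  moreover have "{x \<in> X. consec V b x} = {x \<in> X. consec V b x \<and> x < b} \<union> {x \<in> X. consec V b x \<and> b < x}"
    unfolding consec_def by auto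
  ultimately show ?thesis
    using card_Un_le[of "{x \<in> X. consec V b x \<and> x < b}" "{x \<in> X. consec V b x \<and> b < x}"] by simp
qed

text \<open>The vertices that are not adjacent to \<open>a\<close> play the role of the deleted vertices. The target
  triangulation contains the edge that cuts off \<open>a\<close>, so that it shares only sides with the star of
  \<open>a\<close>, and joins each vertex outside the fan to four vertices of the fan. At most two of these four
  edges are sides, which leaves the two interior edges that \<open>far_outside_subpolygon\<close> asks for.\<close>

lemma excess_fan_exact:
  assumes T: "tri V T" and a: "a \<in> V" "\<And>x. x \<in> V \<Longrightarrow> a \<le> x" and V: "3 \<le> card V" "3 \<le> card (fan V a T)"
    and K: "card (V - fan V a T) = K" "4 * K + 1 \<le> card (fan V a T)"
  shows "excess_ge V T K"
proof -
  let ?G = "fan V a T"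
  let ?W = "V - {a}" and ?B = "V - ?G"
  have fV: "finite V" using triD(4)[OF T] .
  have GV: "?G \<subseteq> V" and aG: "a \<in> ?G" using a unfolding fan_def by auto
  have WB: "?W - ?B = ?G - {a}" using GV by blast
  have "card (?W - ?B) = card ?G - 1" unfolding WB using aG finite_subset[OF GV fV] by simp
  then have "4 * card ?B \<le> card (?W - ?B)" using K by linarith
  moreover have "?B \<subseteq> ?W" using aG by blast
  ultimately obtain E where E: "E \<subseteq> chords ?W" "planar E"
    and four: "\<And>b. b \<in> ?B \<Longrightarrow> \<exists>X \<subseteq> ?W - ?B. card X = 4 \<and> (\<forall>x\<in>X. adj E b x)"
    using planar_matching[of ?W ?B 4] fV by auto
  have "card ?W = card V - 1" using a(1) fV by simp
  then have W: "finite ?W" "?W \<noteq> {}" using fV V(1) by (simp, intro notI, simp)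
  let ?s = "Min ?W" and ?M = "Max ?W"
  note s = Min_in[OF W] Min_le[OF W(1)] and M = Max_in[OF W] Max_ge[OF W(1)]
  have sM: "?s < ?M"
  proof (rule ccontr)
    assume "\<not> ?s < ?M"
    then have "?W \<subseteq> {?s}" using s(2) M(2) by fastforce
    then have "card ?W \<le> card {?s}" by (intro card_mono) auto
    then show False using V a fV by simp
  qed
  have as: "a < ?s" using a(2)[of ?s] s(1) by auto
  have cs: "consec V a ?s" unfolding consec_def
  proof (intro conjI ballI)
    fix z assume "z \<in> V"
    then show "\<not> (a < z \<and> z < ?s)" "\<not> (?s < z \<and> z < a)" using s(2)[of z] as by auto
  qed (use s a as in auto)
  have "planar (insert (?s, ?M) E)"
  proof (rule planar_insert[OF E(2)])
    fix c d assume "(c, d) \<in> E"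
    then have "c \<in> ?W" "d \<in> ?W" using E(1) unfolding chords_def by auto
    then show "\<not> xing ?s ?M c d" using s(2)[of c] M(2)[of d] unfolding xing_def by linarith
  qed
  moreover have "insert (?s, ?M) E \<subseteq> chords V" using E(1) s(1) M(1) sM unfolding chords_def by auto
  ultimately obtain T' where T': "tri V T'" "insert (?s, ?M) E \<subseteq> T'"
    using planar_extends[of V "insert (?s, ?M) E"] fV V by auto
  have "far V T T' (card ?G - 3 + 2 * card (V - ?G))"
  proof (rule far_outside_subpolygon[OF T T'(1), where D = "{(x, y). x = a}"])
    show "subpolygon ?G V T" using subpolygon_fan_set[OF T a] .
    show "3 \<le> card ?G" using V by simp
    fix b assume b: "b \<in> V - ?G"
    obtain X where X0: "X \<subseteq> ?W - ?B \<and> card X = 4 \<and> (\<forall>x\<in>X. adj E b x)"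
      using four[OF b] by (elim exE)
    then have X: "X \<subseteq> ?W - ?B" "card X = 4" "\<And>x. x \<in> X \<Longrightarrow> adj E b x" by simp_all
    have fX: "finite X" using X(2) by (intro card_ge_0_finite) simp
    have "card (X - {x \<in> X. consec V b x}) = card X - card {x \<in> X. consec V b x}"
      using fX by (intro card_Diff_subset) auto
    then have "\<not> card (X - {x \<in> X. consec V b x}) \<le> Suc 0" using card_consec[OF fX, of V b] X(2) by linarith
    then obtain x y where xy: "x \<in> X" "y \<in> X" "x \<noteq> y" "\<not> consec V b x" "\<not> consec V b y"
      using card_le_Suc0_iff_eq[of "X - {x \<in> X. consec V b x}"] fX by auto
    moreover have "adj T' b z" if "z \<in> X" for z using X(3)[OF that] T'(2) unfolding adj_def by blast
    moreover have "z \<in> ?G" if "z \<in> X" for z using X(1) that by blast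
    ultimately show "\<exists>x\<in>?G. \<exists>y\<in>?G. x \<noteq> y \<and> adj T' b x \<and> adj T' b y \<and> \<not> consec V b x \<and> \<not> consec V b y"
      by blast
  next
    fix x y assume xy: "(x, y) \<in> T'" "(x, y) \<in> {(x, y). x = a}"
    then have x: "x = a" by simp
    have y: "y \<in> ?W" using tri_in[OF T'(1) xy(1)] x by auto
    have "(?s, ?M) \<in> T'" using T'(2) by blast
    then have "\<not> (?s < y \<and> y < ?M)" using planarD[OF triD(2)[OF T'(1)] xy(1)] x as by blast
    then have "y = ?s \<or> y = ?M" using s(2)[OF y] M(2)[OF y] by linarith
    moreover have "\<forall>z\<in>V. a \<le> z \<and> z \<le> ?M"
    proof
      fix z assume z: "z \<in> V"
      show "a \<le> z \<and> z \<le> ?M" using a(2)[OF z] M(2)[of z] z as sM by (cases "z = a") auto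
    qed
    ultimately show "side V x y" using x cs unfolding side_def by auto
  next
    fix W p q x y
    assume h: "?G \<subseteq> W" "W \<subseteq> V" "p \<in> W - ?G" "consec W p q" "(merge p q x, merge p q y) \<in> {(x, y). x = a}"
    have "q \<noteq> a"
    proof
      assume q: "q = a"
      \<comment> \<open>the smallest vertex after \<open>a\<close> is in the fan and separates \<open>p\<close> from \<open>a\<close>\<close>
      have "?s \<in> ?G" using tri_consec[OF T cs as] s(1) unfolding fan_def by auto
      then have sW: "?s \<in> W" "p \<noteq> ?s" using h by auto
      have "p \<in> ?W" using h aG by auto
      then have "?s < p" using s(2)[of p] sW by auto
      then show False using h(4) q sW as unfolding consec_def by auto
    qed
    then show "(x, y) \<in> {(x, y). x = a}" using h(5) unfolding merge_def by (auto split: if_splits)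
  next
    fix x y assume xy: "(x, y) \<in> T" "x \<in> ?G" "y \<in> ?G"
    show "(x, y) \<in> {(x, y). x = a} \<or> side ?G x y"
    proof (cases "x = a")
      case False
      have lt: "a < x" "x < y" using False a(2)[of x] tri_in[OF T xy(1)] by auto
      have "consec ?G x y" unfolding consec_def
      proof (intro conjI ballI)
        fix z assume z: "z \<in> ?G"
        show "\<not> (x < z \<and> z < y)"
        proof
          assume o: "x < z \<and> z < y"
          then have "(a, z) \<in> T" using z lt unfolding fan_def by auto
          then show False using planarD[OF triD(2)[OF T] _ xy(1)] o lt by blast
        qed
        show "\<not> (y < z \<and> z < x)" using lt by auto
      qed (use xy lt in auto)
      then show ?thesis unfolding side_def by blast
    qed simp
  qed
  moreover have "card V = card ?G + K" using K(1) card_Diff_subset[OF finite_subset[OF GV fV] GV] card_mono[OF fV GV] by linarith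
  ultimately have "far V T T' (card V - 3 + K)" using K(1) V by (elim far_mono) linarith
  then show ?thesis using T'(1) unfolding excess_ge_def by blast
qed

text \<open>Surplus vertices outside the fan are ears of \<open>T\<close> one after the other, and \<open>excess_insert_ear\<close>
  makes it possible to drop them until exactly \<open>K\<close> are left.\<close>

theorem excess_fan:
  assumes "tri V T" and "a \<in> V" "\<And>x. x \<in> V \<Longrightarrow> a \<le> x" and "3 \<le> card V"
    and "K \<le> card (V - fan V a T)" "4 * K + 1 \<le> card (fan V a T)"
  shows "excess_ge V T K"
  using assms
proof (induction "card V" arbitrary: V T rule: less_induct)
  case less
  note T = less.prems(1) and a = less.prems(2,3)
  let ?G = "fan V a T"
  have GV: "?G \<subseteq> V" and aG: "a \<in> ?G" using a unfolding fan_def by auto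
  have fV: "finite V" using triD(4)[OF T] .
  show ?case
  proof (cases "?G = V")
    case True
    then show ?thesis using less.prems by (intro excess_fan_exact) auto
  next
    case False
    then obtain z where z: "z \<in> V" "z \<notin> ?G" using GV by blast
    obtain u v where uv: "(a, u) \<in> T" "(a, v) \<in> T" "u < z" "z < v" using subpolygon_fan[OF T a z] by metis
    have "{a, u, v} \<subseteq> ?G" using uv tri_in[OF T] a unfolding fan_def by auto
    moreover have "card {a, u, v} = 3" using uv tri_in[OF T uv(1)] tri_in[OF T uv(2)] by auto
    ultimately have c3: "3 \<le> card ?G" using card_mono[OF finite_subset[OF GV fV]] by metis
    have "card ?G < card V" using GV False by (intro psubset_card_mono[OF fV]) auto
    then have cV: "4 \<le> card V" using c3 by linarith
    show ?thesis
    proof (cases "card (V - ?G) = K")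
      case True
      then show ?thesis using less.prems c3 by (intro excess_fan_exact) auto
    next
      case False
      obtain p l r where p: "p \<in> V - ?G" and pl: "consec V p l" "consec V p r" "l < p" "p < r" "(l, r) \<in> T"
        using ear_outside_subpolygon[OF T subpolygon_fan_set[OF T a] \<open>?G \<noteq> V\<close>] by blast
      let ?W = "V - {p}" and ?A = "T \<inter> chords (V - {p})"
      have ap: "a \<noteq> p" using p aG by auto
      have f: "fan ?W a ?A = ?G" using p tri_in[OF T] ap a unfolding fan_def chords_def by auto
      have "?W - ?G = (V - ?G) - {p}" by blast
      then have cW: "card (?W - ?G) = card (V - ?G) - 1" using p fV by simp
      have "excess_ge ?W ?A K"
      proof (rule less.hyps)
        show "card ?W < card V" using p fV by (intro psubset_card_mono) auto
        show "tri ?W ?A" using tri_remove_ear[OF T pl] cV by simp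
        show "a \<in> ?W" using ap a by simp
        show "\<And>x. x \<in> ?W \<Longrightarrow> a \<le> x" using a by simp
        show "3 \<le> card ?W" using cV p fV by simp
        show "K \<le> card (?W - fan ?W a ?A)" unfolding f cW using False less.prems(5) by linarith
        show "4 * K + 1 \<le> card (fan ?W a ?A)" unfolding f using less.prems(6) .
      qed
      then show ?thesis using excess_insert_ear[OF T pl cV] by blast
    qed
  qed
qed

section \<open>Zigzags across an edge\<close>

lemma tri_lessThan_consec: "tri {..<n} T \<Longrightarrow> Suc i < n \<Longrightarrow> (i, Suc i) \<in> T"
  by (erule tri_consec) (auto simp: consec_def)

text \<open>The vertices below \<open>c\<close> that are adjacent to \<open>0\<close> come first, those adjacent to \<open>c\<close> come last, and
  the last of the former, \<open>y\<close>, is the common neighbour. So a vertex adjacent to neither is behind an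
  edge facing \<open>0\<close> or behind an edge facing \<open>c\<close>.\<close>

lemma subpolygon_two_fans:
  assumes T: "tri {..<n} T" and c: "(0, c) \<in> T"
  shows "subpolygon ({..<n} - {j. 0 < j \<and> j < c \<and> (0, j) \<notin> T \<and> (j, c) \<notin> T}) {..<n} T"
    (is "subpolygon ?N _ _")
  unfolding subpolygon_def
proof (intro conjI ballI)
  show "?N \<subseteq> {..<n}" by blast
  fix p assume "p \<in> {..<n} - ?N"
  then have p: "0 < p" "p < c" "(0, p) \<notin> T" "(p, c) \<notin> T" by auto
  have cn: "c < n" using tri_in[OF T c] by simp
  note pn = planarD[OF triD(2)[OF T]]
  have ends: "(0, 1) \<in> T" "(c - 1, c) \<in> T"
    using tri_lessThan_consec[OF T, of 0] tri_lessThan_consec[OF T, of "c - 1"] p(1,2) cn by simp_all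
  have "p \<noteq> 1" "p \<noteq> c - 1" using p(3,4) ends by blast+
  then have p1: "1 < p" "p < c - 1" using p(1,2) by linarith+
  have c1: "1 < c" using p1 by simp
  obtain y where y: "(0, y) \<in> T" "1 \<le> y" "y < c" "\<And>z. y < z \<Longrightarrow> z < c \<Longrightarrow> (0, z) \<notin> T"
    using largest_below[of "\<lambda>z. (0, z) \<in> T" 1 c, OF ends(1) c1] by blast
  have yc: "(y, c) \<in> T" using fan_step_left[OF T c y(1,3)] y(4) by blast
  have NI: "(0, x) \<in> T \<or> (x, c) \<in> T" if "x \<in> ?N" "0 < x" "x < c" for x using that by blast
  have NT: "x \<in> ?N" if "(0, x) \<in> T \<or> (x, c) \<in> T" for x using that tri_in[OF T, of 0 x] tri_in[OF T, of x c] by auto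
  show "\<exists>u\<in>?N. \<exists>v\<in>?N. (u, v) \<in> T \<and> u < p \<and> p < v \<and> (\<forall>x\<in>?N. \<not> (u < x \<and> x < v))"
  proof (cases "p < y")
    case True
    obtain u where u: "(0, u) \<in> T" "1 \<le> u" "u < p" "\<And>z. u < z \<Longrightarrow> z < p \<Longrightarrow> (0, z) \<notin> T"
      using largest_below[of "\<lambda>z. (0, z) \<in> T" 1 p, OF ends(1) p1(1)] by blast
    obtain v where v: "(0, v) \<in> T" "v \<le> y" "p < v" "\<And>z. p < z \<Longrightarrow> z < v \<Longrightarrow> (0, z) \<notin> T"
      using smallest_above[of "\<lambda>z. (0, z) \<in> T" y p] y True by blast
    have gap: "(0, z) \<notin> T" if "u < z" "z < v" for z
      using u(4)[of z] v(4)[of z] p(3) that by (cases z p rule: linorder_cases) auto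
    have uv: "(u, v) \<in> T" using fan_step_left[OF T v(1) u(1)] gap u v by auto
    have "\<not> (u < x \<and> x < v)" if "x \<in> ?N" for x
    proof
      assume o: "u < x \<and> x < v"
      then have xc: "(x, c) \<in> T" using NI[OF that] gap[of x] u v y by auto
      then show False using pn[OF v(1) xc] o u(2) v(2) y(3) by simp
    qed
    then show ?thesis using uv u v NT[of u] NT[of v] by blast
  next
    case False
    then have yp: "y < p" using p y(1) by (cases "y = p") auto
    obtain u where u: "(u, c) \<in> T" "y \<le> u" "u < p" "\<And>z. u < z \<Longrightarrow> z < p \<Longrightarrow> (z, c) \<notin> T"
      using largest_below[of "\<lambda>z. (z, c) \<in> T" y p] yc yp by auto
    obtain v where v: "(v, c) \<in> T" "v \<le> c - 1" "p < v" "\<And>z. p < z \<Longrightarrow> z < v \<Longrightarrow> (z, c) \<notin> T"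
      using smallest_above[of "\<lambda>z. (z, c) \<in> T" "c - 1" p] ends p1 by blast
    have gap: "(z, c) \<notin> T" if "u < z" "z < v" for z
      using u(4)[of z] v(4)[of z] p(4) that by (cases z p rule: linorder_cases) auto
    have uv: "(u, v) \<in> T" using fan_step_right[OF T u(1) v(1)] gap u v by auto
    have "\<not> (u < x \<and> x < v)" if "x \<in> ?N" for x
    proof
      assume o: "u < x \<and> x < v"
      have "x < c" using o v p1 by linarith
      then have "(0, x) \<in> T" using NI[OF that] gap[of x] o by auto
      then show False using y(4)[of x] o u \<open>x < c\<close> by auto
    qed
    then show ?thesis using uv u v NT[of u] NT[of v] by blast
  qed
qed

definition rank :: "nat set \<Rightarrow> nat \<Rightarrow> nat" where
  "rank B j = card {b \<in> B. b < j}"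

lemma rank_mono: "finite B \<Longrightarrow> i \<le> j \<Longrightarrow> rank B i \<le> rank B j"
  unfolding rank_def by (intro card_mono) auto

lemma rank_Suc: "finite B \<Longrightarrow> b \<in> B \<Longrightarrow> rank B (Suc b) = Suc (rank B b)"
proof -
  assume "finite B" "b \<in> B"
  moreover from this have "{x \<in> B. x < Suc b} = insert b {x \<in> B. x < b}" by auto
  ultimately show ?thesis unfolding rank_def by simp
qed

text \<open>Every edge crosses the chord from \<open>0\<close> to \<open>c\<close>. As \<open>j\<close> increases, its partners \<open>q\<close> move down from
  \<open>n - 1\<close>: the number \<open>n - 1 - q\<close> of vertices above \<open>q\<close> runs from the number of elements of \<open>B\<close> below
  \<open>j\<close> to the number of those up to \<open>j\<close>. Thus an element of \<open>B\<close> has two partners and any other \<open>j\<close> has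
  one, except that \<open>c - 1\<close> takes all the remaining ones.\<close>

definition zigzag :: "nat set \<Rightarrow> nat \<Rightarrow> nat \<Rightarrow> (nat \<times> nat) set" where
  "zigzag B c n = {(j, q). 0 < j \<and> j < c \<and> c < q \<and> q < n \<and>
     rank B j \<le> n - 1 - q \<and> (n - 1 - q \<le> rank B (Suc j) \<or> j = c - 1)}"

lemma zigzag_planar:
  assumes "finite B"
  shows "planar (zigzag B c n)"
  unfolding planar_def
proof (intro allI impI notI)
  fix j q j' q' assume e: "(j, q) \<in> zigzag B c n" "(j', q') \<in> zigzag B c n" and o: "j < j' \<and> j' < q \<and> q < q'"
  have "j' < c" "q' < n" "rank B j' \<le> n - 1 - q'" "n - 1 - q \<le> rank B (Suc j) \<or> j = c - 1"
    using e unfolding zigzag_def by auto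
  moreover have "rank B (Suc j) \<le> rank B j'" using rank_mono[OF assms] o by simp
  ultimately show False using o by linarith
qed

lemma zigzag_left:
  assumes "finite B" "card B + 1 \<le> n - 1 - c" "0 < j" "j < c"
  shows "\<exists>q. (j, q) \<in> zigzag B c n"
proof -
  have "rank B j \<le> card B" unfolding rank_def using assms(1) by (intro card_mono) auto
  then have "(j, n - 1 - rank B j) \<in> zigzag B c n"
    using assms rank_mono[OF assms(1), of j "Suc j"] unfolding zigzag_def by auto
  then show ?thesis by blast
qed

text \<open>The partner of \<open>q\<close> is the least \<open>j\<close> up to which there are enough elements of \<open>B\<close>, or \<open>c - 1\<close> if there
  are not enough.\<close>

lemma zigzag_right:
  assumes "finite B" "0 \<notin> B" "c < q" "q < n" "1 < c"
  shows "\<exists>j. (j, q) \<in> zigzag B c n"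
proof -
  let ?P = "\<lambda>j. 0 < j \<and> (n - 1 - q \<le> rank B (Suc j) \<or> j = c - 1)"
  define j where "j = (LEAST j. ?P j)"
  have P: "?P j" unfolding j_def using LeastI[of ?P "c - 1"] assms(5) by simp
  have jc: "j \<le> c - 1" unfolding j_def using Least_le[of ?P "c - 1"] assms(5) by simp
  have "rank B j \<le> n - 1 - q"
  proof (cases "j = 1")
    case True
    have "{b \<in> B. b < j} = {}" using assms(2) True by auto
    then show ?thesis unfolding rank_def by (simp only: card.empty)
  next
    case False
    then have j1: "0 < j - 1" "j - 1 < j" "Suc (j - 1) = j" using P by auto
    then have "\<not> ?P (j - 1)" using not_less_Least[of "j - 1" ?P] unfolding j_def by simp
    then show ?thesis using j1 by auto
  qed
  then have "(j, q) \<in> zigzag B c n" using P jc assms unfolding zigzag_def by auto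
  then show ?thesis by blast
qed

text \<open>A chord that does not cross \<open>0c\<close> and is not a side separates off some vertex on the same side of
  \<open>0c\<close>, and thereby crosses the zigzag edge at that vertex. The chords from \<open>0\<close> to vertices beyond
  \<open>c\<close> cross the zigzag edge from \<open>1\<close> to \<open>n - 1\<close>.\<close>

lemma zigzag_extension_crosses:
  assumes T: "tri {..<n} T" "zigzag B c n \<subseteq> T" and B: "finite B" "0 \<notin> B" "card B + 1 \<le> n - 1 - c" and c: "1 < c"
    and xy: "(x, y) \<in> T"
  shows "side {..<n} x y \<or> 0 < x \<and> x < c \<and> c < y"
proof (rule ccontr)
  assume *: "\<not> (side {..<n} x y \<or> 0 < x \<and> x < c \<and> c < y)"
  have xyn: "x < y" "y < n" using tri_in[OF T(1) xy] by auto
  note pn = planarD[OF triD(2)[OF T(1)]]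
  have ne: "y \<noteq> Suc x"
  proof
    assume "y = Suc x"
    then have "consec {..<n} x y" using xyn unfolding consec_def by auto
    then show False using * unfolding side_def by blast
  qed
  then have sx: "Suc x < y" using xyn by simp
  consider "y \<le> c" | "c \<le> x" | "x = 0" "c < y" using * by linarith
  then show False
  proof cases
    case 1
    obtain q where q: "(Suc x, q) \<in> zigzag B c n" using zigzag_left[OF B(1,3), of "Suc x"] sx 1 by auto
    then have "c < q" unfolding zigzag_def by simp
    then show False using pn[OF xy, of "Suc x" q] q T(2) sx 1 by auto
  next
    case 2
    obtain j where j: "(j, Suc x) \<in> zigzag B c n" using zigzag_right[OF B(1,2), of c "Suc x" n] c 2 sx xyn by auto
    then have "j < c" unfolding zigzag_def by simp
    then show False using pn[OF _ xy, of j "Suc x"] j T(2) sx 2 by auto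
  next
    case 3
    have "y \<noteq> n - 1"
    proof
      assume "y = n - 1"
      then have "\<forall>z\<in>{..<n}. x \<le> z \<and> z \<le> y" using 3 by auto
      then show False using * unfolding side_def by blast
    qed
    then have yn: "y < n - 1" using xyn by simp
    have "{b \<in> B. b < 1} = {}" using B(2) by auto
    then have "rank B 1 = 0" unfolding rank_def by (simp only: card.empty)
    then have "(1, n - 1) \<in> zigzag B c n" using c 3 yn unfolding zigzag_def by simp
    then show False using pn[OF xy, of 1 "n - 1"] T(2) 3 c yn by auto
  qed
qed

text \<open>The target is any triangulation containing the zigzag for the set \<open>B\<close> of the \<open>K\<close> vertices to be
  deleted. Its interior edges cross \<open>0c\<close>, and no contraction changes this: \<open>1\<close> and \<open>c - 1\<close> are kept,
  so that a deleted vertex is never merged with \<open>0\<close> or \<open>c\<close>. On the other hand \<open>0c\<close> belongs to \<open>T\<close>, so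
  that no edge of \<open>T\<close> crosses it.\<close>

theorem excess_across:
  assumes T: "tri {..<n} T" and cT: "(0, c) \<in> T" and K: "1 \<le> K" "K + 1 \<le> n - 1 - c"
    and many: "K \<le> card {j. 0 < j \<and> j < c \<and> (0, j) \<notin> T \<and> (j, c) \<notin> T}"
  shows "excess_ge {..<n} T K"
proof -
  let ?V = "{..<n}"
  let ?J = "{j. 0 < j \<and> j < c \<and> (0, j) \<notin> T \<and> (j, c) \<notin> T}"
  have cn: "c < n" using tri_in[OF T cT] by simp
  have "?V - (?V - ?J) = ?J" using cn by auto
  then obtain G where G: "?V - ?J \<subseteq> G" "subpolygon G ?V T" "card (?V - G) = K"
    using subpolygon_of_size[OF T subpolygon_two_fans[OF T cT], of K] many by auto
  have GV: "G \<subseteq> ?V" using G(2) unfolding subpolygon_def by blast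
  let ?B = "?V - G"
  have BJ: "?B \<subseteq> ?J" using G(1) by blast
  have fB: "finite ?B" by simp
  have c1: "1 < c"
  proof (rule ccontr)
    assume "\<not> 1 < c"
    then have "?J = {}" by auto
    then have "card ?J = card ({} :: nat set)" by (rule arg_cong)
    then show False using many K(1) by (simp only: card.empty)
  qed
  have ends: "(0, 1) \<in> T" "(c - 1, c) \<in> T"
    using tri_lessThan_consec[OF T, of 0] tri_lessThan_consec[OF T, of "c - 1"] c1 cn by simp_all
  have inG: "0 \<in> G" "1 \<in> G" "c - 1 \<in> G" "c \<in> G" "\<And>q. c < q \<Longrightarrow> q < n \<Longrightarrow> q \<in> G"
    using G(1) ends cn c1 by auto
  have B0: "0 \<notin> ?B" using inG by simp
  have cB: "card ?B + 1 \<le> n - 1 - c" using G(3) K by simp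
  have "zigzag ?B c n \<subseteq> chords ?V" unfolding zigzag_def chords_def by auto
  then obtain T' where T': "tri ?V T'" "zigzag ?B c n \<subseteq> T'"
    using planar_extends[OF _ _ _ zigzag_planar[OF fB]] triD(5)[OF T] by blast
  have "card {0, 1, c} = 3" using c1 by simp
  then have G3: "3 \<le> card G" using card_mono[of G "{0, 1, c}"] inG finite_subset[OF GV] by simp
  have "far ?V T T' (card G - 3 + 2 * card (?V - G))"
  proof (rule far_outside_subpolygon[OF T T'(1) G(2) G3, where D = "{(x, y). \<not> (0 < x \<and> x < c \<and> c < y)}"])
    fix b assume b: "b \<in> ?V - G"
    then have bc: "0 < b" "b < c" using BJ by auto
    have "rank ?B (Suc b) \<le> card ?B" unfolding rank_def by (intro card_mono) auto
    then have r: "Suc (rank ?B b) \<le> K" using rank_Suc[OF fB b] G(3) by simp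
    \<comment> \<open>the two zigzag partners of \<open>b\<close>; both lie beyond \<open>c\<close> because there are more than \<open>K\<close> vertices beyond \<open>c\<close>\<close>
    let ?x = "n - 1 - rank ?B b" and ?y = "n - 1 - rank ?B (Suc b)"
    have z: "(b, ?x) \<in> zigzag ?B c n" "(b, ?y) \<in> zigzag ?B c n"
      using bc r K rank_Suc[OF fB b] unfolding zigzag_def by auto
    have xy: "c < ?x" "?x < n" "c < ?y" "?y < n" "?x \<noteq> ?y" using z r K rank_Suc[OF fB b] unfolding zigzag_def by auto
    have nc: "\<not> consec ?V b q" if "c < q" for q using that bc cn unfolding consec_def by auto
    show "\<exists>x\<in>G. \<exists>y\<in>G. x \<noteq> y \<and> adj T' b x \<and> adj T' b y \<and> \<not> consec ?V b x \<and> \<not> consec ?V b y"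
      using z T'(2) xy nc inG(5)[of ?x] inG(5)[of ?y] unfolding adj_def
      by (intro bexI[of _ ?x] bexI[of _ ?y]) auto
  next
    fix x y assume "(x, y) \<in> T'" "(x, y) \<in> {(x, y). \<not> (0 < x \<and> x < c \<and> c < y)}"
    then show "side ?V x y" using zigzag_extension_crosses[OF T' fB B0 cB c1, of x y] by auto
  next
    fix W p q x y
    assume h: "G \<subseteq> W" "W \<subseteq> ?V" "p \<in> W - G" "consec W p q"
      "(merge p q x, merge p q y) \<in> {(x, y). \<not> (0 < x \<and> x < c \<and> c < y)}"
    have pB: "p \<in> ?J" using h BJ by blast
    have p: "0 < p" "p < c" using pB by auto
    have pne: "p \<noteq> 1" "p \<noteq> c - 1" using h inG by auto
    have W: "1 \<in> W" "c - 1 \<in> W" using h(1) inG by auto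
    have q: "0 < q" "q < c"
    proof -
      show "0 < q"
      proof (rule ccontr)
        assume "\<not> 0 < q"
        then show False using h(4) W(1) p pne unfolding consec_def by auto
      qed
      show "q < c"
      proof (rule ccontr)
        assume "\<not> q < c"
        then have "p < c - 1 \<and> c - 1 < q" using p pne c1 by auto
        then show False using h(4) W(2) unfolding consec_def by blast
      qed
    qed
    show "(x, y) \<in> {(x, y). \<not> (0 < x \<and> x < c \<and> c < y)}"
      using h(5) p q unfolding merge_def by (auto split: if_splits)
  next
    fix x y assume xy: "(x, y) \<in> T"
    have "\<not> (0 < x \<and> x < c \<and> c < y)" using planarD[OF triD(2)[OF T] cT xy] by blast
    then show "(x, y) \<in> {(x, y). \<not> (0 < x \<and> x < c \<and> c < y)} \<or> side G x y" by simp
  qed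
  moreover have "card ?V = card G + K" using G(3) card_Diff_subset[OF finite_subset[OF GV] GV] card_mono[OF _ GV] by simp
  ultimately have "far ?V T T' (card ?V - 3 + K)" using G(3) G3 by (elim far_mono) linarith
  then show ?thesis using T'(1) unfolding excess_ge_def by blast
qed

section \<open>Cyclic labellings of points in convex position\<close>

definition orient :: "real^2 \<Rightarrow> real^2 \<Rightarrow> real^2 \<Rightarrow> real" where
  "orient a b c = (b$1 - a$1) * (c$2 - a$2) - (b$2 - a$2) * (c$1 - a$1)"

lemma orient_rotate: "orient b c a = orient a b c"
  unfolding orient_def by (simp add: algebra_simps)

lemma orient_self: "orient a b a = 0" "orient a b b = 0"
  unfolding orient_def by (simp_all add: algebra_simps)

lemma orient_affine: "orient a b ((1 - t) *\<^sub>R c + t *\<^sub>R d) = (1 - t) * orient a b c + t * orient a b d"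
  unfolding orient_def by (simp add: algebra_simps)

lemma orient_on_line: "orient a b ((1 - t) *\<^sub>R a + t *\<^sub>R b) = 0"
  unfolding orient_affine orient_self by simp

lemma proportional:
  fixes p q r t :: real
  assumes "p \<noteq> 0" "p * t = q * r"
  shows "q = (q / p) * p" "t = (q / p) * r"
  using assms by (simp_all add: field_simps)

text \<open>The vanishing of the determinant makes \<open>b - c\<close> proportional to \<open>a - c\<close>.\<close>

lemma orient_zero_collinear:
  assumes "orient a b c = 0"
  shows "collinear {a, b, c}"
proof (cases "a = c")
  case True then show ?thesis by (simp add: collinear_3_expand)
next
  case False
  have o: "(a$1 - c$1) * (b$2 - c$2) = (b$1 - c$1) * (a$2 - c$2)"
    using assms unfolding orient_def by (simp add: algebra_simps)
  have "\<exists>u. b$1 - c$1 = u * (a$1 - c$1) \<and> b$2 - c$2 = u * (a$2 - c$2)"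
  proof (cases "a$1 = c$1")
    case True
    then have "a$2 - c$2 \<noteq> 0" using False by (auto simp: vec_eq_iff forall_2)
    moreover have "(a$2 - c$2) * (b$1 - c$1) = (b$2 - c$2) * (a$1 - c$1)" using o by (simp only: mult.commute)
    ultimately show ?thesis using proportional by blast
  next
    case False
    then have "a$1 - c$1 \<noteq> 0" by simp
    then show ?thesis using proportional[OF _ o] by blast
  qed
  then obtain u where "b$1 - c$1 = u * (a$1 - c$1)" "b$2 - c$2 = u * (a$2 - c$2)" by blast
  then have "b = u *\<^sub>R a + (1 - u) *\<^sub>R c" by (simp add: vec_eq_iff forall_2 algebra_simps)
  then show ?thesis using collinear_3_expand by blast
qed

definition convex_position :: "(real^2) set \<Rightarrow> bool" where
  "convex_position S \<longleftrightarrow> finite S \<and> (\<forall>v\<in>S. v \<notin> convex hull (S - {v}))"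

lemma convex_position_vertices:
  assumes "convex_polygon P" shows "convex_position (vertices P)"
  unfolding convex_position_def
proof (intro conjI ballI)
  show "finite (vertices P)" using finite_vertices[OF assms] .
  have P: "convex P" using assms unfolding convex_polygon_def by (simp add: polytope_imp_convex)
  fix v assume "v \<in> vertices P"
  then have "convex (P - {v})" using extreme_point_of_stillconvex[OF P] unfolding vertices_def by blast
  moreover have "vertices P - {v} \<subseteq> P - {v}" unfolding vertices_def by (auto simp: extreme_point_of_def)
  ultimately have "convex hull (vertices P - {v}) \<subseteq> P - {v}" by (intro hull_minimal) auto
  then show "v \<notin> convex hull (vertices P - {v})" by blast
qed

text \<open>Of three collinear points one lies between the two others, hence in the convex hull of the rest.\<close>

lemma orient_nonzero:
  assumes S: "convex_position S" and abc: "a \<in> S" "b \<in> S" "c \<in> S" "a \<noteq> b" "a \<noteq> c" "b \<noteq> c"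
  shows "orient a b c \<noteq> 0"
proof
  assume "orient a b c = 0"
  then have col: "between (b, c) a \<or> between (c, a) b \<or> between (a, b) c"
    using orient_zero_collinear collinear_between_cases by blast
  have *: False if "between (y, z) x" "x \<in> S" "y \<in> S" "z \<in> S" "x \<noteq> y" "x \<noteq> z" for x y z
  proof -
    have "x \<in> convex hull {y, z}" using that(1) by (simp add: between_mem_segment segment_convex_hull)
    moreover have "convex hull {y, z} \<subseteq> convex hull (S - {x})" using that by (intro hull_mono) auto
    ultimately show False using S that(2) unfolding convex_position_def by blast
  qed
  show False using col *[of b c a] *[of c a b] *[of a b c] abc by auto
qed

lemma enumerate_by_key:
  fixes t :: "'a \<Rightarrow> real"
  assumes "finite F" "inj_on t F"
  obtains f where "bij_betw f {..<card F} F" "\<And>i j. i < j \<Longrightarrow> j < card F \<Longrightarrow> t (f i) < t (f j)"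
proof -
  define xs where "xs = sorted_list_of_set (t ` F)"
  have set: "set xs = t ` F" "distinct xs" unfolding xs_def using assms by auto
  have len: "length xs = card F" using set assms by (metis card_image distinct_card)
  have srt: "sorted_wrt (<) xs" unfolding xs_def by simp
  let ?f = "\<lambda>i. inv_into F t (xs ! i)"
  have b1: "bij_betw ((!) xs) {..<card F} (t ` F)" using set len by (intro bij_betw_nth) auto
  have b2: "bij_betw (inv_into F t) (t ` F) F" using assms by (intro bij_betw_inv_into) (simp add: bij_betw_def)
  have "bij_betw ?f {..<card F} F" using bij_betw_trans[OF b1 b2] by (simp add: comp_def)
  moreover have "t (?f i) = xs ! i" if "i < card F" for i
    using that len set(1) nth_mem[of i xs] by (intro f_inv_into_f) auto
  ultimately show thesis using that[of ?f] sorted_wrt_nth_less[OF srt] len by auto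
qed

definition cyclic_labelling :: "(nat \<Rightarrow> real^2) \<Rightarrow> nat \<Rightarrow> (real^2) set \<Rightarrow> bool" where
  "cyclic_labelling f n S \<longleftrightarrow> bij_betw f {..<n} S \<and>
     (\<forall>i j k. i < j \<longrightarrow> j < k \<longrightarrow> k < n \<longrightarrow> 0 < orient (f i) (f j) (f k))"

text \<open>Cramer's rule writes \<open>q\<close> as an affine combination of \<open>v\<close>, \<open>p\<close> and \<open>r\<close> with nonnegative coefficients
  at \<open>p\<close> and \<open>r\<close>. If \<open>p\<close>, \<open>q\<close>, \<open>r\<close> did not turn left, the coefficient at \<open>v\<close> would be nonnegative too
  and \<open>q\<close> would lie in the triangle \<open>v\<close>, \<open>p\<close>, \<open>r\<close>.\<close>

lemma orient_pos_in_fan: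
  assumes S: "convex_position S" and in_S: "v \<in> S" "p \<in> S" "q \<in> S" "r \<in> S"
    and pos: "0 < orient v p q" "0 < orient v q r" "0 < orient v p r"
  shows "0 < orient p q r"
proof (rule ccontr)
  assume "\<not> 0 < orient p q r"
  define D where "D = orient v p r"
  define \<alpha> where "\<alpha> = orient v q r / D"
  define \<beta> where "\<beta> = orient v p q / D"
  have D: "0 < D" using pos unfolding D_def by simp
  have "orient p q r = orient v q r + orient v p q - orient v p r" unfolding orient_def by (simp add: algebra_simps)
  then have "orient v q r + orient v p q \<le> D" using \<open>\<not> 0 < orient p q r\<close> unfolding D_def by simp
  then have s: "\<alpha> + \<beta> \<le> 1" using D unfolding \<alpha>_def \<beta>_def by (simp add: add_divide_distrib[symmetric])
  have nn: "0 \<le> \<alpha>" "0 \<le> \<beta>" using pos D unfolding \<alpha>_def \<beta>_def by simp_all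
  have e: "\<alpha> * D = orient v q r" "\<beta> * D = orient v p q" using D unfolding \<alpha>_def \<beta>_def by simp_all
  have id: "D * (q$i - v$i) = orient v q r * (p$i - v$i) + orient v p q * (r$i - v$i)" if "i = 1 \<or> i = 2" for i
    using that unfolding D_def orient_def by (auto simp: algebra_simps)
  have "D * (q$i - v$i) = D * (\<alpha> * (p$i - v$i) + \<beta> * (r$i - v$i))" if "i = 1 \<or> i = 2" for i
    unfolding id[OF that] e[symmetric] by (simp add: algebra_simps)
  then have c: "q$i - v$i = \<alpha> * (p$i - v$i) + \<beta> * (r$i - v$i)" if "i = 1 \<or> i = 2" for i using that D by simp
  have "q = (1 - \<alpha> - \<beta>) *\<^sub>R v + \<alpha> *\<^sub>R p + \<beta> *\<^sub>R r"
    using c[of 1] c[of 2] by (simp add: vec_eq_iff forall_2 algebra_simps)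
  moreover have "(1 - \<alpha> - \<beta>) *\<^sub>R v + \<alpha> *\<^sub>R p + \<beta> *\<^sub>R r \<in> convex hull {v, p, r}"
    unfolding convex_hull_3 using s nn by (intro CollectI exI[of _ "1 - \<alpha> - \<beta>"] exI[of _ \<alpha>] exI[of _ \<beta>]) auto
  moreover have "convex hull {v, p, r} \<subseteq> convex hull (S - {q})"
    using in_S pos orient_self by (intro hull_mono) (auto simp: orient_def)
  ultimately show False using S in_S(3) unfolding convex_position_def by auto
qed

text \<open>A linear functional separates \<open>v\<close> from the other points, which therefore lie in an open half plane
  bounded by a line through \<open>v\<close>. In it, the angle around \<open>v\<close> is measured by the slope \<open>g / h\<close>, and
  sorting by this slope gives the labelling.\<close>

lemma cyclic_labelling_exists:
  assumes S: "convex_position S" and v: "v \<in> S"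
  obtains f where "cyclic_labelling f (card S) S" "f 0 = v"
proof -
  let ?F = "S - {v}"
  have fS: "finite S" using S unfolding convex_position_def by blast
  have "v \<notin> convex hull ?F" using S v unfolding convex_position_def by blast
  moreover have "closed (convex hull ?F)" using fS by (simp add: finite_imp_compact_convex_hull compact_imp_closed)
  ultimately obtain a b where ab: "a \<bullet> v < b" "\<And>x. x \<in> convex hull ?F \<Longrightarrow> a \<bullet> x > b"
    using separating_hyperplane_closed_point[of "convex hull ?F" v] convex_convex_hull by blast
  define h where "h = (\<lambda>x::real^2. a$1 * (x$1 - v$1) + a$2 * (x$2 - v$2))"
  define g where "g = (\<lambda>x::real^2. a$1 * (x$2 - v$2) - a$2 * (x$1 - v$1))"
  have h: "0 < h x" if "x \<in> ?F" for x
  proof -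
    have "a \<bullet> v < a \<bullet> x" using ab(1) ab(2)[of x] that hull_inc[of x ?F convex] by fastforce
    then show ?thesis unfolding h_def by (simp add: inner_vec_def sum_2 algebra_simps)
  qed
  \<comment> \<open>comparing slopes amounts to testing the orientation\<close>
  have gh: "g y * h x - g x * h y = ((a$1)^2 + (a$2)^2) * orient v x y" for x y
    unfolding g_def h_def orient_def by (simp add: algebra_simps power2_eq_square)
  have "(a$1)^2 + (a$2)^2 > 0" if "x \<in> ?F" for x
  proof (rule ccontr)
    assume "\<not> 0 < (a$1)^2 + (a$2)^2"
    then have "a$1 = 0" "a$2 = 0" using sum_power2_gt_zero_iff by blast+
    then show False using h[OF that] unfolding h_def by simp
  qed
  note apos = this
  define t where "t = (\<lambda>x. g x / h x)"
  have tless: "t x < t y \<longleftrightarrow> 0 < orient v x y" if "x \<in> ?F" "y \<in> ?F" for x y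
  proof -
    have "t x < t y \<longleftrightarrow> g x * h y < g y * h x" unfolding t_def using h that
      by (simp add: divide_less_eq less_divide_eq mult.commute)
    also have "\<dots> \<longleftrightarrow> 0 < ((a$1)^2 + (a$2)^2) * orient v x y" unfolding gh[symmetric] by simp
    also have "\<dots> \<longleftrightarrow> 0 < orient v x y" using apos[OF that(1)] by (simp add: zero_less_mult_iff)
    finally show ?thesis .
  qed
  have "inj_on t ?F"
  proof (rule inj_onI, rule ccontr)
    fix x y assume xy: "x \<in> ?F" "y \<in> ?F" "t x = t y" "x \<noteq> y"
    have "\<not> 0 < orient v x y" "\<not> 0 < orient v y x" using tless xy by (metis less_irrefl)+
    moreover have "orient v y x = - orient v x y" unfolding orient_def by (simp add: algebra_simps)
    moreover have "orient v x y \<noteq> 0" using orient_nonzero[OF S v, of x y] xy by auto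
    ultimately show False by linarith
  qed
  then obtain f where f: "bij_betw f {..<card ?F} ?F" "\<And>i j. i < j \<Longrightarrow> j < card ?F \<Longrightarrow> t (f i) < t (f j)"
    using enumerate_by_key[of ?F t] fS by auto
  define e where "e = (\<lambda>i. case i of 0 \<Rightarrow> v | Suc j \<Rightarrow> f j)"
  have c: "card S = Suc (card ?F)" using v fS by (metis card.remove)
  have fF: "f j \<in> ?F" if "j < card ?F" for j using f(1) that unfolding bij_betw_def by auto
  have e0: "e 0 = v" and eS: "e (Suc j) = f j" for j unfolding e_def by auto
  have bij: "bij_betw e {..<card S} S"
    unfolding bij_betw_def
  proof
    show "inj_on e {..<card S}"
    proof (rule inj_onI)
      fix i j assume ij: "i \<in> {..<card S}" "j \<in> {..<card S}" "e i = e j"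
      have fne: "f k \<noteq> v" if "k < card ?F" for k using fF[OF that] by auto
      show "i = j"
      proof (cases i; cases j)
        fix i' j' assume "i = Suc i'" "j = Suc j'"
        then show ?thesis using ij f(1) c eS unfolding bij_betw_def inj_on_def by auto
      next
        fix j' assume "i = 0" "j = Suc j'"
        then show ?thesis using ij fne[of j'] c e0 eS by auto
      next
        fix i' assume "i = Suc i'" "j = 0"
        then show ?thesis using ij fne[of i'] c e0 eS by auto
      qed simp
    qed
    have "{..<card S} = insert 0 (Suc ` {..<card ?F})" unfolding c by (rule lessThan_Suc_eq_insert_0)
    then have "e ` {..<card S} = insert v (f ` {..<card ?F})" using e0 eS by (simp add: image_image)
    also have "\<dots> = S" using f(1) v unfolding bij_betw_def by auto
    finally show "e ` {..<card S} = S" .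
  qed
  have fan: "0 < orient v (f i) (f j)" if "i < j" "j < card ?F" for i j
    using tless[of "f i" "f j"] fF f(2) that by auto
  have pos: "0 < orient (e i) (e j) (e k)" if ijk: "i < j" "j < k" "k < card S" for i j k
  proof -
    obtain j' k' where jk: "j = Suc j'" "k = Suc k'" using ijk by (metis less_nat_zero_code old.nat.exhaust)
    show ?thesis
    proof (cases i)
      case 0
      then show ?thesis using fan[of j' k'] jk ijk c e0 eS by simp
    next
      case (Suc i')
      have "0 < orient (f i') (f j') (f k')"
      proof (rule orient_pos_in_fan[OF S v])
        have lt: "i' < j'" "j' < k'" "k' < card ?F" using Suc jk ijk c by auto
        then show "f i' \<in> S" "f j' \<in> S" "f k' \<in> S" using fF[of i'] fF[of j'] fF[of k'] by auto
        show "0 < orient v (f i') (f j')" "0 < orient v (f j') (f k')" "0 < orient v (f i') (f k')"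
          using fan lt by auto
      qed
      then show ?thesis using Suc jk eS by simp
    qed
  qed
  have "cyclic_labelling e (card S) S" unfolding cyclic_labelling_def using bij pos by blast
  then show thesis using that e0 by blast
qed

lemma cyclic_labelling_sign:
  assumes f: "cyclic_labelling f n S" and "i < j" "j < n" "m < n"
  shows "m < i \<or> j < m \<Longrightarrow> 0 < orient (f i) (f j) (f m)" "i < m \<Longrightarrow> m < j \<Longrightarrow> orient (f i) (f j) (f m) < 0"
proof -
  have pos: "0 < orient (f x) (f y) (f z)" if "x < y" "y < z" "z < n" for x y z
    using f that unfolding cyclic_labelling_def by blast
  show "m < i \<or> j < m \<Longrightarrow> 0 < orient (f i) (f j) (f m)"
    using pos[of m i j] pos[of i j m] assms orient_rotate[of "f i" "f j" "f m"] by auto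
  have "orient (f i) (f j) (f m) = - orient (f i) (f m) (f j)" unfolding orient_def by (simp add: algebra_simps)
  then show "i < m \<Longrightarrow> m < j \<Longrightarrow> orient (f i) (f j) (f m) < 0" using pos[of i m j] assms by simp
qed

lemma crosses_segments:
  assumes "a \<noteq> b" "c \<noteq> d"
  shows "crosses {a, b} {c, d} \<longleftrightarrow> {a, b} \<noteq> {c, d} \<and> open_segment a b \<inter> open_segment c d \<noteq> {}"
  unfolding crosses_def segment_convex_hull[symmetric] rel_interior_closed_segment using assms by simp

lemma open_segments_meet_signs:
  assumes "x \<in> open_segment a b" "x \<in> open_segment c d"
  shows "orient a b c * orient a b d < 0 \<or> orient a b c = 0 \<and> orient a b d = 0"
proof -
  obtain u where u: "x = (1 - u) *\<^sub>R a + u *\<^sub>R b" using assms(1) unfolding in_segment by blast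
  obtain t where t: "0 < t" "t < 1" "x = (1 - t) *\<^sub>R c + t *\<^sub>R d" using assms(2) unfolding in_segment by blast
  have "orient a b x = 0" unfolding u by (rule orient_on_line)
  then have z: "(1 - t) * orient a b c + t * orient a b d = 0" unfolding t(3) orient_affine .
  consider "orient a b c = 0" | "0 < orient a b c" | "orient a b c < 0" by linarith
  then show ?thesis
  proof cases
    case 1 then show ?thesis using z t by simp
  next
    case 2
    then have "0 < (1 - t) * orient a b c" using t by simp
    then have "t * orient a b d < 0" using z by linarith
    then have "orient a b d < 0" using t(1) by (simp add: mult_less_0_iff)
    then show ?thesis using 2 by (simp add: mult_less_0_iff)
  next
    case 3
    then have "(1 - t) * orient a b c < 0" using t by (simp add: mult_less_0_iff)
    then have "0 < t * orient a b d" using z by linarith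
    then have "0 < orient a b d" using t(1) by (simp add: zero_less_mult_iff)
    then show ?thesis using 3 by (simp add: mult_less_0_iff)
  qed
qed

lemma open_segments_meet:
  assumes A: "orient a b c < 0" "0 < orient a b d" and C: "0 < orient c d a" "orient c d b < 0"
  shows "open_segment a b \<inter> open_segment c d \<noteq> {}"
proof -
  define D where "D = orient a b d - orient a b c"
  have D: "0 < D" using A unfolding D_def by simp
  have D': "D = orient c d a - orient c d b" unfolding D_def orient_def by (simp add: algebra_simps)
  define t where "t = - orient a b c / D"
  define s where "s = orient c d a / D"
  have t: "0 < t" "t < 1" "t * D = - orient a b c" using A D unfolding t_def D_def by (auto simp: field_simps)
  have s: "0 < s" "s < 1" "s * D = orient c d a" using C D unfolding s_def D' by (auto simp: field_simps)
  have "D * ((1 - s) * a$i + s * b$i) = D * ((1 - t) * c$i + t * d$i)" if "i = 1 \<or> i = 2" for i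
  proof -
    have id: "D * a$i + orient c d a * (b$i - a$i) = D * c$i + (- orient a b c) * (d$i - c$i)"
      unfolding D_def using that by (auto simp: orient_def algebra_simps)
    have "D * ((1 - s) * a$i + s * b$i) = D * a$i + (s * D) * (b$i - a$i)" by (simp add: algebra_simps)
    also have "\<dots> = D * c$i + (t * D) * (d$i - c$i)"
      unfolding t(3) s(3) by (rule id)
    also have "\<dots> = D * ((1 - t) * c$i + t * d$i)" by (simp add: algebra_simps)
    finally show ?thesis .
  qed
  then have "(1 - s) *\<^sub>R a + s *\<^sub>R b = (1 - t) *\<^sub>R c + t *\<^sub>R d" using D by (simp add: vec_eq_iff forall_2)
  moreover have "(1 - s) *\<^sub>R a + s *\<^sub>R b \<in> open_segment a b"
    using s A orient_self unfolding in_segment by (auto simp: orient_def)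
  moreover have "(1 - t) *\<^sub>R c + t *\<^sub>R d \<in> open_segment c d"
    using t C orient_self unfolding in_segment by (auto simp: orient_def)
  ultimately show ?thesis by auto
qed

text \<open>Two segments with four distinct end points, no three of them on a line, meet if and only if the line
  through each of them separates the end points of the other. The labelling determines the
  orientations involved.\<close>

theorem crosses_iff_xing:
  assumes f: "cyclic_labelling f n S" and ij: "i < j" "j < n" and kl: "k < l" "l < n"
  shows "crosses {f i, f j} {f k, f l} \<longleftrightarrow> xing i j k l"
proof -
  have inj: "f x = f y \<longleftrightarrow> x = y" if "x < n" "y < n" for x y
    using f that unfolding cyclic_labelling_def bij_betw_def inj_on_def by auto
  have ne: "f i \<noteq> f j" "f k \<noteq> f l" using inj ij kl by auto
  note sign = cyclic_labelling_sign[OF f]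
  have zero: "orient (f i) (f j) (f m) = 0 \<longleftrightarrow> m = i \<or> m = j" if "m < n" for m
    using sign[OF ij that] orient_self[of "f i" "f j"] by (cases "m < i"; cases "j < m"; cases "m = i"; cases "m = j") auto
  show ?thesis
  proof
    assume c: "crosses {f i, f j} {f k, f l}"
    then obtain x where x: "x \<in> open_segment (f i) (f j)" "x \<in> open_segment (f k) (f l)" and df: "{f i, f j} \<noteq> {f k, f l}"
      unfolding crosses_segments[OF ne] by blast
    have nz: "\<not> (orient (f i) (f j) (f k) = 0 \<and> orient (f i) (f j) (f l) = 0)"
    proof
      assume "orient (f i) (f j) (f k) = 0 \<and> orient (f i) (f j) (f l) = 0"
      then have "k = i \<and> l = j" using zero[of k] zero[of l] ij kl by auto
      then show False using df by simp
    qed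
    then have "orient (f i) (f j) (f k) * orient (f i) (f j) (f l) < 0" using open_segments_meet_signs[OF x] by blast
    then have opp: "orient (f i) (f j) (f k) < 0 \<and> 0 < orient (f i) (f j) (f l) \<or>
       0 < orient (f i) (f j) (f k) \<and> orient (f i) (f j) (f l) < 0" by (auto simp: mult_less_0_iff)
    have trichotomy: "m < i \<or> j < m \<or> m = i \<or> m = j \<or> i < m \<and> m < j" for m by linarith
    have inside: "i < m \<and> m < j" if "m < n" "orient (f i) (f j) (f m) < 0" for m
      using trichotomy[of m] sign(1)[OF ij that(1)] zero[OF that(1)] that(2) by argo
    have outside: "m < i \<or> j < m" if "m < n" "0 < orient (f i) (f j) (f m)" for m
      using trichotomy[of m] sign(2)[OF ij that(1)] zero[OF that(1)] that(2) by argo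
    show "xing i j k l"
      using opp inside[of k] inside[of l] outside[of k] outside[of l] kl unfolding xing_def by auto
  next
    assume x: "xing i j k l"
    have "open_segment (f i) (f j) \<inter> open_segment (f k) (f l) \<noteq> {}"
    proof -
      have kn: "k < n" and i_n: "i < n" using ij kl by auto
      consider "i < k" "k < j" "j < l" | "k < i" "i < l" "l < j" using x unfolding xing_def by blast
      then show ?thesis
      proof cases
        case 1
        have s: "orient (f i) (f j) (f k) < 0" "0 < orient (f i) (f j) (f l)"
          "0 < orient (f k) (f l) (f i)" "orient (f k) (f l) (f j) < 0"
          using sign(2)[OF ij kn] sign(1)[OF ij kl(2)] sign(1)[OF kl i_n] sign(2)[OF kl ij(2)] 1 by blast+
        show ?thesis using open_segments_meet[OF s] .
      next
        case 2
        have s: "orient (f k) (f l) (f i) < 0" "0 < orient (f k) (f l) (f j)"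
          "0 < orient (f i) (f j) (f k)" "orient (f i) (f j) (f l) < 0"
          using sign(2)[OF kl i_n] sign(1)[OF kl ij(2)] sign(1)[OF ij kn] sign(2)[OF ij kl(2)] 2 by blast+
        show ?thesis using open_segments_meet[OF s] by blast
      qed
    qed
    moreover have "{f i, f j} \<noteq> {f k, f l}"
      using x inj[of i k] inj[of i l] ij kl unfolding xing_def doubleton_eq_iff by auto
    ultimately show "crosses {f i, f j} {f k, f l}" unfolding crosses_segments[OF ne] by blast
  qed
qed

text \<open>The line through \<open>u\<close> and \<open>w\<close> supports the polygon. The face that it cuts out has no extreme points
  besides \<open>u\<close> and \<open>w\<close>, so it is the segment between them. The sign \<open>\<sigma>\<close> covers both
  orientations.\<close>

lemma supporting_edge:
  assumes P: "convex_polygon P" and uw: "u \<in> vertices P" "w \<in> vertices P" "u \<noteq> w"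
    and pos: "\<And>x. x \<in> vertices P \<Longrightarrow> x \<noteq> u \<Longrightarrow> x \<noteq> w \<Longrightarrow> 0 < \<sigma> * orient u w x"
  shows "{u, w} \<in> sides P"
proof -
  have cP: "convex P" "compact P" using P unfolding convex_polygon_def
    by (simp_all add: polytope_imp_convex polytope_imp_compact)
  have hull: "P = convex hull (vertices P)" unfolding vertices_def by (rule Krein_Milman_Minkowski[OF cP(2,1)])
  define a :: "real^2" where "a = vector [- \<sigma> * (w$2 - u$2), \<sigma> * (w$1 - u$1)]"
  have a: "a \<bullet> x = \<sigma> * orient u w x + a \<bullet> u" for x
    unfolding a_def orient_def by (simp add: inner_vec_def sum_2 algebra_simps)
  have au: "a \<bullet> w = a \<bullet> u" unfolding a[of w] orient_self by simp
  have "vertices P \<subseteq> {x. a \<bullet> x \<ge> a \<bullet> u}"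
  proof
    fix x assume x: "x \<in> vertices P"
    show "x \<in> {x. a \<bullet> x \<ge> a \<bullet> u}"
    proof (cases "x = u \<or> x = w")
      case True then show ?thesis using au by auto
    next
      case False then have "a \<bullet> u \<le> a \<bullet> x" using pos[OF x] a[of x] by simp
      then show ?thesis by simp
    qed
  qed
  then have "convex hull (vertices P) \<subseteq> {x. a \<bullet> x \<ge> a \<bullet> u}" by (intro hull_minimal convex_halfspace_ge)
  then have ge: "a \<bullet> x \<ge> a \<bullet> u" if "x \<in> P" for x using that hull by blast
  let ?F = "P \<inter> {x. a \<bullet> x = a \<bullet> u}"
  have F: "?F face_of P" using face_of_Int_supporting_hyperplane_ge[OF cP(1)] ge by blast
  have cF: "compact ?F" "convex ?F" using face_of_imp_compact[OF cP(1,2) F] face_of_imp_convex[OF F] by auto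
  have "{x. x extreme_point_of ?F} \<subseteq> {u, w}"
  proof
    fix x assume "x \<in> {x. x extreme_point_of ?F}"
    then have x: "x \<in> vertices P" "a \<bullet> x = a \<bullet> u"
      using extreme_point_of_face[OF F] unfolding vertices_def by auto
    show "x \<in> {u, w}"
    proof (rule ccontr)
      assume "x \<notin> {u, w}"
      then show False using pos[OF x(1)] x(2) a[of x] by simp
    qed
  qed
  then have "?F \<subseteq> convex hull {u, w}" using Krein_Milman_Minkowski[OF cF] hull_mono by metis
  moreover have "convex hull {u, w} \<subseteq> ?F"
  proof (rule hull_minimal)
    show "{u, w} \<subseteq> ?F" using uw au unfolding vertices_def by (auto simp: extreme_point_of_def)
    show "convex ?F" using cF by simp
  qed
  ultimately have "?F = convex hull {u, w}" by blast
  then have "convex hull {u, w} edge_of P" using F uw(3) unfolding edge_of_def by (simp add: aff_dim_convex_hull)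
  then show ?thesis using uw unfolding sides_def edges_on_def by simp
qed

lemma card_vertices_ge_3:
  assumes "convex_polygon P" shows "3 \<le> card (vertices P)"
proof -
  have cP: "convex P" "compact P" using assms unfolding convex_polygon_def
    by (simp_all add: polytope_imp_convex polytope_imp_compact)
  have "P = convex hull (vertices P)" unfolding vertices_def by (rule Krein_Milman_Minkowski[OF cP(2,1)])
  then have "aff_dim (vertices P) = 2" using assms unfolding convex_polygon_def by (metis aff_dim_convex_hull)
  then show ?thesis using aff_dim_le_card[OF finite_vertices[OF assms]] by simp
qed

section \<open>From polygons to sets of pairs\<close>

definition encode :: "(nat \<Rightarrow> real^2) \<Rightarrow> nat \<Rightarrow> (real^2) set set \<Rightarrow> (nat \<times> nat) set" where
  "encode f n T = {(i, j). i < j \<and> j < n \<and> {f i, f j} \<in> T}"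

definition decode :: "(nat \<Rightarrow> real^2) \<Rightarrow> (nat \<times> nat) set \<Rightarrow> (real^2) set set" where
  "decode f E = (\<lambda>(i, j). {f i, f j}) ` E"

locale labelled_polygon =
  fixes P :: "(real^2) set" and n :: nat and f :: "nat \<Rightarrow> real^2"
  assumes P: "convex_polygon P" and n: "n = card (vertices P)" and lab: "cyclic_labelling f n (vertices P)"
begin

lemma n3: "3 \<le> n" using card_vertices_ge_3[OF P] n by simp

lemma inj: "i < n \<Longrightarrow> j < n \<Longrightarrow> f i = f j \<longleftrightarrow> i = j"
  using lab unfolding cyclic_labelling_def bij_betw_def inj_on_def by auto

lemma range: "f ` {..<n} = vertices P"
  using lab unfolding cyclic_labelling_def bij_betw_def by blast

lemma edge_eq:
  assumes "i < j" "j < n" "k < l" "l < n"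
  shows "{f i, f j} = {f k, f l} \<longleftrightarrow> i = k \<and> j = l"
  using inj[of i k] inj[of i l] inj[of j k] inj[of j l] assms unfolding doubleton_eq_iff by auto

lemma edge_in: "i < j \<Longrightarrow> j < n \<Longrightarrow> {f i, f j} \<in> edges_on P"
  using range inj[of i j] unfolding edges_on_def by auto

lemma edge_obtain:
  assumes "e \<in> edges_on P"
  obtains i j where "i < j" "j < n" "e = {f i, f j}"
proof -
  obtain a b where ab: "e = {a, b}" "a \<noteq> b" "a \<in> vertices P" "b \<in> vertices P"
    using assms unfolding edges_on_def by (auto simp: card_2_iff)
  obtain i j where ij: "i < n" "j < n" "a = f i" "b = f j" using ab range by blast
  then have "i < j \<or> j < i" using ab by (cases i j rule: linorder_cases) auto
  then show thesis
  proof
    assume "i < j" then show thesis using that[of i j] ij ab by simp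
  next
    assume "j < i" then show thesis using that[of j i] ij ab by (simp add: insert_commute)
  qed
qed

lemma encode_chords: "encode f n T \<subseteq> chords {..<n}"
  unfolding encode_def chords_def by auto

lemma decode_edges: "E \<subseteq> chords {..<n} \<Longrightarrow> decode f E \<subseteq> edges_on P"
  unfolding decode_def chords_def using edge_in by auto

lemma decode_encode:
  assumes "T \<subseteq> edges_on P" shows "decode f (encode f n T) = T"
proof
  show "decode f (encode f n T) \<subseteq> T" unfolding decode_def encode_def by auto
  show "T \<subseteq> decode f (encode f n T)"
  proof
    fix e assume e: "e \<in> T"
    then obtain i j where "i < j" "j < n" "e = {f i, f j}" using edge_obtain assms by blast
    moreover from this have "(i, j) \<in> encode f n T" using e unfolding encode_def by auto
    ultimately show "e \<in> decode f (encode f n T)" unfolding decode_def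
      by (intro image_eqI[of _ _ "(i, j)"]) auto
  qed
qed

lemma encode_decode:
  assumes "E \<subseteq> chords {..<n}" shows "encode f n (decode f E) = E"
proof
  show "E \<subseteq> encode f n (decode f E)"
  proof
    fix x assume x: "x \<in> E"
    then obtain i j where ij: "x = (i, j)" "i < j" "j < n" using assms unfolding chords_def by auto
    have "{f i, f j} \<in> decode f E" using x ij unfolding decode_def by (intro image_eqI[of _ _ x]) auto
    then show "x \<in> encode f n (decode f E)" using ij unfolding encode_def by simp
  qed
  show "encode f n (decode f E) \<subseteq> E"
  proof clarify
    fix i j assume "(i, j) \<in> encode f n (decode f E)"
    then obtain k l where *: "i < j" "j < n" "(k, l) \<in> E" "{f i, f j} = {f k, f l}"
      unfolding encode_def decode_def by auto
    then have "k < l" "l < n" using assms unfolding chords_def by auto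
    then show "(i, j) \<in> E" using edge_eq[of i j k l] * by auto
  qed
qed

lemma noncrossing_iff_planar:
  assumes T: "T \<subseteq> edges_on P"
  shows "noncrossing_edges_on P T \<longleftrightarrow> planar (encode f n T)"
proof
  assume nc: "noncrossing_edges_on P T"
  show "planar (encode f n T)" unfolding planar_def
  proof (intro allI impI notI)
    fix a b c d assume e: "(a, b) \<in> encode f n T" "(c, d) \<in> encode f n T" and o: "a < c \<and> c < b \<and> b < d"
    then have "crosses {f a, f b} {f c, f d}"
      using crosses_iff_xing[OF lab, of a b c d] unfolding encode_def xing_def by auto
    then show False using nc e unfolding noncrossing_edges_on_def encode_def by auto
  qed
next
  assume pl: "planar (encode f n T)"
  show "noncrossing_edges_on P T" unfolding noncrossing_edges_on_def
  proof (intro conjI ballI notI)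
    fix e e' assume e: "e \<in> T" "e' \<in> T" and c: "crosses e e'"
    obtain i j where ij: "i < j" "j < n" "e = {f i, f j}" using edge_obtain e T by blast
    obtain k l where kl: "k < l" "l < n" "e' = {f k, f l}" using edge_obtain e T by blast
    have "(i, j) \<in> encode f n T" "(k, l) \<in> encode f n T" using e ij kl unfolding encode_def by auto
    then have "\<not> xing i j k l" using planar_xing[OF pl] by blast
    then show False using c crosses_iff_xing[OF lab ij(1,2) kl(1,2)] ij kl by blast
  qed (rule T)
qed

lemma triangulation_edges: "polygon_triangulation P T \<Longrightarrow> T \<subseteq> edges_on P"
  unfolding polygon_triangulation_def noncrossing_edges_on_def by blast

lemma triangulation_iff_tri:
  assumes T: "T \<subseteq> edges_on P"
  shows "polygon_triangulation P T \<longleftrightarrow> tri {..<n} (encode f n T)"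
proof
  assume pt: "polygon_triangulation P T"
  show "tri {..<n} (encode f n T)"
  proof (rule maximal_tri)
    show "2 \<le> card {..<n}" using n3 by simp
    show "planar (encode f n T)" using pt noncrossing_iff_planar[OF T] unfolding polygon_triangulation_def by simp
    fix F assume F: "F \<subseteq> chords {..<n}" "planar F" "encode f n T \<subseteq> F"
    have "noncrossing_edges_on P (decode f F)"
      using noncrossing_iff_planar[OF decode_edges[OF F(1)]] F(2) unfolding encode_decode[OF F(1)] by blast
    moreover have "decode f (encode f n T) \<subseteq> decode f F" unfolding decode_def using F(3) by (rule image_mono)
    then have "T \<subseteq> decode f F" unfolding decode_encode[OF T] .
    moreover have "\<forall>E. noncrossing_edges_on P E \<and> T \<subseteq> E \<longrightarrow> E = T"
      using pt unfolding polygon_triangulation_def by (rule conjunct2)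
    ultimately have "decode f F = T" by blast
    then show "F = encode f n T" using encode_decode[OF F(1)] by simp
  qed (use encode_chords in auto)
next
  assume tr: "tri {..<n} (encode f n T)"
  show "polygon_triangulation P T" unfolding polygon_triangulation_def
  proof (intro conjI allI impI)
    show "noncrossing_edges_on P T" using noncrossing_iff_planar[OF T] triD(2)[OF tr] by blast
    fix E assume E: "noncrossing_edges_on P E \<and> T \<subseteq> E"
    then have Ee: "E \<subseteq> edges_on P" unfolding noncrossing_edges_on_def by blast
    have sub: "encode f n T \<subseteq> encode f n E" using E unfolding encode_def by auto
    have "planar (encode f n E)" using noncrossing_iff_planar[OF Ee] E by simp
    then have "encode f n E = encode f n T" using tri_maximal[OF tr encode_chords _ sub] by simp
    then have "decode f (encode f n E) = decode f (encode f n T)" by (rule arg_cong)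
    then show "E = T" unfolding decode_encode[OF Ee] decode_encode[OF T] .
  qed
qed

lemma tri_encode: "polygon_triangulation P T \<Longrightarrow> tri {..<n} (encode f n T)"
  using triangulation_iff_tri[OF triangulation_edges] by simp

lemma triangulation_decode:
  assumes "tri {..<n} E" shows "polygon_triangulation P (decode f E)"
  using triangulation_iff_tri[OF decode_edges[OF triD(1)[OF assms]]] assms encode_decode[OF triD(1)[OF assms]] by simp

lemma step_if_flips:
  assumes "flips P T T'"
  shows "step {..<n} (encode f n T) (encode f n T')"
proof -
  have pt: "polygon_triangulation P T" "polygon_triangulation P T'" using assms unfolding flips_def by auto
  obtain e g where eg: "T' = insert g (T - {e})" using assms unfolding flips_def by blast
  have "card (encode f n T - encode f n T') \<le> 1"
  proof (rule card_le_one_if)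
    fix x y assume "x \<in> encode f n T - encode f n T'" "y \<in> encode f n T - encode f n T'"
    then obtain i j k l where *: "x = (i, j)" "y = (k, l)" "i < j" "j < n" "k < l" "l < n"
      "{f i, f j} \<in> T - T'" "{f k, f l} \<in> T - T'" unfolding encode_def by auto
    then have "{f i, f j} = e" "{f k, f l} = e" using eg by auto
    then show "x = y" using edge_eq[of i j k l] * by simp
  qed
  then show ?thesis using tri_encode[OF pt(1)] tri_encode[OF pt(2)] unfolding step_def by simp
qed

text \<open>Two distinct triangulations that differ in at most one edge differ by a flip. The edge removed is
  not a side, since the other triangulation contains all sides.\<close>

lemma flips_if_step:
  assumes st: "step {..<n} A B" and ne: "A \<noteq> B"
  shows "flips P (decode f A) (decode f B)"
proof -
  have T: "tri {..<n} A" "tri {..<n} B" using st unfolding step_def by auto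
  have single: "\<exists>x. A - B = {x}" if "step {..<n} A B" "A \<noteq> B" for A B
  proof -
    have T: "tri {..<n} A" "tri {..<n} B" "card (A - B) \<le> 1" using that unfolding step_def by auto
    have "\<not> A \<subseteq> B" using tri_maximal[OF T(1) triD(1,2)[OF T(2)]] that(2) by auto
    then have "card (A - B) \<noteq> 0" using triD(6)[OF T(1)] by auto
    then have "card (A - B) = 1" using T(3) by linarith
    then show ?thesis by (simp add: card_1_singleton_iff)
  qed
  obtain x where x: "A - B = {x}" using single[OF st ne] by blast
  obtain y where y: "B - A = {y}" using single[OF step_sym[OF st]] ne by blast
  have B: "B = insert y (A - {x})" using x y by blast
  have xAB: "x \<in> A" "y \<in> B" "x \<notin> B" "y \<notin> A" using x y by auto
  obtain i j k l where xy: "x = (i, j)" "y = (k, l)" by (cases x; cases y) auto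
  have ij: "i < j" "j < n" and kl: "k < l" "l < n" using tri_in[OF T(1), of i j] tri_in[OF T(2), of k l] xAB xy by auto
  have mem: "{f a, f b} \<in> decode f E \<longleftrightarrow> (a, b) \<in> E" if "tri {..<n} E" "a < b" "b < n" for E a b
  proof -
    have "(a, b) \<in> encode f n (decode f E) \<longleftrightarrow> {f a, f b} \<in> decode f E" using that unfolding encode_def by auto
    then show ?thesis using encode_decode[OF triD(1)[OF that(1)]] by simp
  qed
  have pt: "polygon_triangulation P (decode f A)" "polygon_triangulation P (decode f B)"
    using triangulation_decode T by auto
  have "decode f B = insert {f k, f l} (decode f (A - {x}))" unfolding B decode_def xy by simp
  moreover have "decode f (A - {x}) = decode f A - {{f i, f j}}"
  proof
    show "decode f (A - {x}) \<subseteq> decode f A - {{f i, f j}}"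
    proof
      fix e assume "e \<in> decode f (A - {x})"
      then obtain a b where ab: "(a, b) \<in> A" "(a, b) \<noteq> x" "e = {f a, f b}" unfolding decode_def by auto
      then have "a < b" "b < n" using tri_in[OF T(1)] by auto
      then have "e \<noteq> {f i, f j}" using edge_eq[of a b i j] ij ab xy by auto
      moreover have "e \<in> decode f A" using ab unfolding decode_def by (intro image_eqI[of _ _ "(a, b)"]) auto
      ultimately show "e \<in> decode f A - {{f i, f j}}" by simp
    qed
    show "decode f A - {{f i, f j}} \<subseteq> decode f (A - {x})" unfolding decode_def xy by auto
  qed
  ultimately have eq: "decode f B = insert {f k, f l} (decode f A - {{f i, f j}})" by simp
  have "{f i, f j} \<in> decode f A" "{f i, f j} \<notin> decode f B" using mem[OF T(1) ij] mem[OF T(2) ij] xAB xy by auto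
  then have "{f i, f j} \<in> interior_edges P (decode f A)"
    using sides_subset_triangulation[OF pt(2)] unfolding interior_edges_def by blast
  moreover have "{f k, f l} \<noteq> {f i, f j}" using edge_eq[OF kl ij] xAB xy by auto
  ultimately have "\<exists>e\<in>interior_edges P (decode f A). \<exists>g\<in>edges_on P. g \<noteq> e \<and> decode f B = insert g (decode f A - {e})"
    using eq edge_in[OF kl] by (intro bexI[of _ "{f i, f j}"] bexI[of _ "{f k, f l}"]) simp_all
  then show ?thesis using pt unfolding flips_def by simp
qed

lemma path_encode:
  assumes "polygon_triangulation P T" "(flips P ^^ m) T T'"
  shows "(step {..<n} ^^ m) (encode f n T) (encode f n T')"
  using assms(2)
proof (induction m arbitrary: T')
  case (Suc m)
  then obtain S where "(flips P ^^ m) T S" "flips P S T'" by (elim relpowp_Suc_E)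
  then show ?case using relpowp_Suc_I[OF Suc.IH step_if_flips] by blast
qed simp

lemma path_decode:
  assumes "(step {..<n} ^^ m) A B"
  shows "\<exists>k\<le>m. (flips P ^^ k) (decode f A) (decode f B)"
  using assms
proof (induction m arbitrary: B)
  case 0 then show ?case by auto
next
  case (Suc m)
  then obtain C where C: "(step {..<n} ^^ m) A C" "step {..<n} C B" by (elim relpowp_Suc_E)
  obtain k where k: "k \<le> m" "(flips P ^^ k) (decode f A) (decode f C)" using Suc.IH[OF C(1)] by blast
  show ?case
  proof (cases "C = B")
    case True then show ?thesis using k by (intro exI[of _ k]) auto
  next
    case False
    have "(flips P ^^ Suc k) (decode f A) (decode f B)" using relpowp_Suc_I[OF k(2) flips_if_step[OF C(2) False]] .
    then show ?thesis using k(1) by (intro exI[of _ "Suc k"]) auto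
  qed
qed

lemma far_triangulation_exists:
  assumes T: "polygon_triangulation P T" and ex: "excess_ge {..<n} (encode f n T) K"
  shows "\<exists>T'. polygon_triangulation P T' \<and> (\<forall>m. (flips P ^^ m) T T' \<longrightarrow> n - 3 + K \<le> m)"
proof -
  obtain S where S: "tri {..<n} S" "far {..<n} (encode f n T) S (n - 3 + K)" using ex unfolding excess_ge_def by auto
  have "n - 3 + K \<le> m" if "(flips P ^^ m) T (decode f S)" for m
    using path_encode[OF T that] S(2) unfolding encode_decode[OF triD(1)[OF S(1)]] far_def by simp
  then show ?thesis using triangulation_decode[OF S(1)] by blast
qed

lemma side_iff:
  assumes ij: "i < j" "j < n"
  shows "{f i, f j} \<in> sides P \<longleftrightarrow> side {..<n} i j"
proof
  assume s: "{f i, f j} \<in> sides P"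
  have nx: "\<not> xing i j k l" if "k < l" "l < n" for k l
    using side_not_crosses[OF s edge_in[OF that]] crosses_iff_xing[OF lab ij that] by simp
  show "side {..<n} i j"
  proof (cases "j = Suc i")
    case True
    then have "consec {..<n} i j" using ij unfolding consec_def by auto
    then show ?thesis unfolding side_def by simp
  next
    case False
    then have si: "Suc i < j" using ij by simp
    have "\<not> xing i j (Suc i) (n - 1)" using nx[of "Suc i" "n - 1"] si ij by simp
    then have "j = n - 1" using si ij unfolding xing_def by linarith
    moreover have "i = 0"
    proof (rule ccontr)
      assume "i \<noteq> 0"
      then show False using nx[of 0 "Suc i"] si ij unfolding xing_def by linarith
    qed
    ultimately show ?thesis unfolding side_def by auto
  qed
next
  assume s: "side {..<n} i j"
  have V: "f i \<in> vertices P" "f j \<in> vertices P" "f i \<noteq> f j" using range ij inj[of i j] by auto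
  show "{f i, f j} \<in> sides P"
  proof (cases "j = Suc i")
    case True
    show ?thesis
    proof (rule supporting_edge[OF P V, of 1])
      fix x assume x: "x \<in> vertices P" "x \<noteq> f i" "x \<noteq> f j"
      then have "x \<in> f ` {..<n}" using range by simp
      then obtain m where m: "m < n" "x = f m" by auto
      then have "m < i \<or> j < m" using x True by (cases m i rule: linorder_cases; cases m j rule: linorder_cases) auto
      then show "0 < 1 * orient (f i) (f j) x" using cyclic_labelling_sign(1)[OF lab ij m(1)] m(2) by simp
    qed
  next
    case False
    have o: "\<forall>z\<in>{..<n}. i \<le> z \<and> z \<le> j"
    proof -
      have "\<not> consec {..<n} i j"
      proof
        assume "consec {..<n} i j"
        moreover have "Suc i \<in> {..<n}" using ij by simp
        ultimately have "\<not> (i < Suc i \<and> Suc i < j)" unfolding consec_def by blast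
        then show False using False ij by simp
      qed
      then show ?thesis using s unfolding side_def by blast
    qed
    show ?thesis
    proof (rule supporting_edge[OF P V, of "-1"])
      fix x assume x: "x \<in> vertices P" "x \<noteq> f i" "x \<noteq> f j"
      then have "x \<in> f ` {..<n}" using range by simp
      then obtain m where m: "m < n" "x = f m" by auto
      then have "i \<le> m" "m \<le> j" "m \<noteq> i" "m \<noteq> j" using o x by auto
      then have "i < m" "m < j" by auto
      then show "0 < -1 * orient (f i) (f j) x" using cyclic_labelling_sign(2)[OF lab ij m(1)] m(2) by simp
    qed
  qed
qed

text \<open>The three elements of the fan that do not count are the vertex itself and the other ends of its
  two sides.\<close>

lemma card_fan:
  assumes T: "polygon_triangulation P T"
  shows "card (fan {..<n} 0 (encode f n T)) = card {e \<in> interior_edges P T. f 0 \<in> e} + 3"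
proof -
  let ?E = "encode f n T"
  let ?F = "fan {..<n} 0 ?E"
  have tr: "tri {..<n} ?E" using tri_encode[OF T] .
  have "(0, 1) \<in> ?E" using tri_lessThan_consec[OF tr, of 0] n3 by simp
  moreover have "(0, n - 1) \<in> ?E" using n3 by (intro tri_outer[OF tr]) auto
  ultimately have sub: "{0, 1, n - 1} \<subseteq> ?F" unfolding fan_def using n3 by auto
  have fin: "finite ?F" unfolding fan_def by simp
  have c3: "card {0, 1, n - 1} = 3" using n3 by simp
  have "card (?F - {0, 1, n - 1}) = card ?F - 3" using card_Diff_subset[OF _ sub] c3 by simp
  moreover have "3 \<le> card ?F" using card_mono[OF fin sub] c3 by simp
  moreover have bij: "bij_betw (\<lambda>j. {f 0, f j}) (?F - {0, 1, n - 1}) {e \<in> interior_edges P T. f 0 \<in> e}"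
    unfolding bij_betw_def
  proof
    show "inj_on (\<lambda>j. {f 0, f j}) (?F - {0, 1, n - 1})"
    proof (rule inj_onI)
      fix j k assume "j \<in> ?F - {0, 1, n - 1}" "k \<in> ?F - {0, 1, n - 1}" "{f 0, f j} = {f 0, f k}"
      then show "j = k" using edge_eq[of 0 j 0 k] unfolding fan_def by auto
    qed
    have sides0: "{f 0, f j} \<in> sides P \<longleftrightarrow> j = 1 \<or> j = n - 1" if "0 < j" "j < n" for j
    proof -
      have "side {..<n} 0 j \<longleftrightarrow> j = 1 \<or> j = n - 1"
      proof
        assume "side {..<n} 0 j"
        then consider "consec {..<n} 0 j" | "\<forall>z\<in>{..<n}. 0 \<le> z \<and> z \<le> j" unfolding side_def by blast
        then show "j = 1 \<or> j = n - 1"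
        proof cases
          case 1
          moreover have "1 \<in> {..<n}" using n3 by simp
          ultimately have "\<not> (0 < (1::nat) \<and> 1 < j)" unfolding consec_def by blast
          then show ?thesis using that by simp
        next
          case 2
          then have "n - 1 \<le> j" using n3 by simp
          then show ?thesis using that(2) by linarith
        qed
      next
        assume "j = 1 \<or> j = n - 1"
        then show "side {..<n} 0 j"
        proof
          assume "j = 1"
          then have "consec {..<n} 0 j" using n3 unfolding consec_def by auto
          then show ?thesis unfolding side_def by simp
        next
          assume "j = n - 1"
          then have "\<forall>z\<in>{..<n}. 0 \<le> z \<and> z \<le> j" by auto
          then show ?thesis unfolding side_def by simp
        qed
      qed
      then show ?thesis using side_iff[OF that] by simp
    qed
    show "(\<lambda>j. {f 0, f j}) ` (?F - {0, 1, n - 1}) = {e \<in> interior_edges P T. f 0 \<in> e}"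
    proof
      show "(\<lambda>j. {f 0, f j}) ` (?F - {0, 1, n - 1}) \<subseteq> {e \<in> interior_edges P T. f 0 \<in> e}"
      proof
        fix e assume "e \<in> (\<lambda>j. {f 0, f j}) ` (?F - {0, 1, n - 1})"
        then obtain j where j: "j \<in> ?F" "j \<noteq> 0" "j \<noteq> 1" "j \<noteq> n - 1" "e = {f 0, f j}" by auto
        then have "j < n" "{f 0, f j} \<in> T" unfolding fan_def encode_def by auto
        then show "e \<in> {e \<in> interior_edges P T. f 0 \<in> e}" using sides0[of j] j unfolding interior_edges_def by auto
      qed
      show "{e \<in> interior_edges P T. f 0 \<in> e} \<subseteq> (\<lambda>j. {f 0, f j}) ` (?F - {0, 1, n - 1})"
      proof
        fix e assume "e \<in> {e \<in> interior_edges P T. f 0 \<in> e}"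
        then have e: "e \<in> T" "e \<notin> sides P" "f 0 \<in> e" unfolding interior_edges_def by auto
        then obtain i j where ij: "i < j" "j < n" "e = {f i, f j}" using edge_obtain triangulation_edges[OF T] by blast
        have "f 0 = f i \<or> f 0 = f j" using e(3) ij(3) by blast
        then have i: "i = 0" using inj[of 0 i] inj[of 0 j] ij by auto
        have "j \<in> ?F" using ij e(1) i unfolding fan_def encode_def by auto
        moreover have "j \<noteq> 1" "j \<noteq> n - 1" using sides0[of j] ij i e(2) by auto
        ultimately show "e \<in> (\<lambda>j. {f 0, f j}) ` (?F - {0, 1, n - 1})" using ij i by auto
      qed
    qed
  qed
  ultimately show ?thesis using bij_betw_same_card[OF bij] by linarith
qed

lemma distance_bound:
  assumes T: "polygon_triangulation P T" and T': "polygon_triangulation P T'"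
  shows "\<exists>m. (flips P ^^ m) T T' \<and> m + card {e \<in> interior_edges P T. f 0 \<in> e} \<le> 2 * (n - 3)"
proof -
  let ?d = "\<lambda>S. card ({..<n} - fan {..<n} 0 (encode f n S))"
  have d: "?d S + card {e \<in> interior_edges P S. f 0 \<in> e} + 3 = n" if "polygon_triangulation P S" for S
  proof -
    have sub: "fan {..<n} 0 (encode f n S) \<subseteq> {..<n}" unfolding fan_def by blast
    then have "?d S = n - card (fan {..<n} 0 (encode f n S))" using card_Diff_subset[OF finite_subset[OF sub] sub] by simp
    moreover have "card (fan {..<n} 0 (encode f n S)) \<le> n" using card_mono[OF _ sub] by simp
    ultimately show ?thesis using card_fan[OF that] by simp
  qed
  have "(step {..<n} ^^ (?d T + ?d T')) (encode f n T) (encode f n T')"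
    using distance_via_star[OF tri_encode[OF T] tri_encode[OF T'], of 0] n3 by auto
  from path_decode[OF this] obtain k where "k \<le> ?d T + ?d T'" "(flips P ^^ k) T T'"
    unfolding decode_encode[OF triangulation_edges[OF T]] decode_encode[OF triangulation_edges[OF T']] by blast
  then show ?thesis using d[OF T] d[OF T'] by (intro exI[of _ k]) auto
qed

lemma excess_at_vertex:
  assumes T: "polygon_triangulation P T"
    and K: "K + card {e \<in> interior_edges P T. f 0 \<in> e} \<le> n - 3" "4 * K \<le> card {e \<in> interior_edges P T. f 0 \<in> e} + 2"
  shows "excess_ge {..<n} (encode f n T) K"
proof -
  have sub: "fan {..<n} 0 (encode f n T) \<subseteq> {..<n}" unfolding fan_def by blast
  have "card ({..<n} - fan {..<n} 0 (encode f n T)) = n - card (fan {..<n} 0 (encode f n T))"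
    using card_Diff_subset[OF finite_subset[OF sub] sub] by simp
  then show ?thesis using n3 K card_fan[OF T] by (intro excess_fan[OF tri_encode[OF T], of 0]) auto
qed

lemma shift_labelled:
  assumes s: "s < n"
  shows "labelled_polygon P n (\<lambda>i. f ((i + s) mod n))"
proof
  let ?g = "\<lambda>i. f ((i + s) mod n)"
  have m: "(i + s) mod n = (if i + s < n then i + s else i + s - n)" if "i < n" for i
    using that s by (simp add: mod_if)
  have "bij_betw (\<lambda>i. (i + s) mod n) {..<n} {..<n}"
  proof (rule bij_betwI[where g = "\<lambda>i. (i + (n - s)) mod n"])
    fix x assume "x \<in> {..<n}"
    then have x: "x < n" by simp
    have "x + s + (n - s) = x + n" "x + (n - s) + s = x + n" using s by auto
    then show "((x + s) mod n + (n - s)) mod n = x" "((x + (n - s)) mod n + s) mod n = x"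
      unfolding mod_add_left_eq using x by simp_all
  qed (use s in auto)
  then have bij: "bij_betw ?g {..<n} (vertices P)"
    using lab bij_betw_trans[of "\<lambda>i. (i + s) mod n" "{..<n}" "{..<n}" f "vertices P"]
    unfolding cyclic_labelling_def by (simp add: comp_def)
  have pos: "0 < orient (f x) (f y) (f z)" if "x < y" "y < z" "z < n" for x y z
    using lab that unfolding cyclic_labelling_def by blast
  have "0 < orient (?g i) (?g j) (?g k)" if ijk: "i < j" "j < k" "k < n" for i j k
  proof -
    consider "k + s < n" | "j + s < n" "n \<le> k + s" | "i + s < n" "n \<le> j + s" | "n \<le> i + s" by linarith
    then show ?thesis
    proof cases
      case 1 then show ?thesis using pos[of "i + s" "j + s" "k + s"] ijk by simp
    next
      case 2
      then have "0 < orient (f (k + s - n)) (f (i + s)) (f (j + s))" using ijk s by (intro pos) auto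
      then show ?thesis using 2 ijk m[of i] m[of j] m[of k] orient_rotate by auto
    next
      case 3
      then have "0 < orient (f (j + s - n)) (f (k + s - n)) (f (i + s))" using ijk s by (intro pos) auto
      then show ?thesis using 3 ijk m[of i] m[of j] m[of k] orient_rotate by auto
    next
      case 4
      then have "0 < orient (f (i + s - n)) (f (j + s - n)) (f (k + s - n))" using ijk s by (intro pos) auto
      then show ?thesis using 4 ijk m[of i] m[of j] m[of k] by auto
    qed
  qed
  then show "cyclic_labelling ?g n (vertices P)" unfolding cyclic_labelling_def using bij by blast
qed (use P n in auto)

end

context labelled_polygon
begin

text \<open>Renumbering the vertices so that \<open>s\<close> becomes \<open>0\<close>; together with the next lemma this covers all the
  edges whose new positions are needed.\<close>

lemma shift_encode_wrap:
  assumes "(x, y) \<in> encode f n T" "x < s" "s \<le> y"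
  shows "(y - s, x + n - s) \<in> encode (\<lambda>i. f ((i + s) mod n)) n T"
proof -
  have xy: "x < y" "y < n" "{f x, f y} \<in> T" using assms(1) unfolding encode_def by auto
  have "y - s + s = y" "x + n - s + s = x + n" using assms xy by auto
  then have "(y - s + s) mod n = y" "(x + n - s + s) mod n = x" using xy by auto
  then show ?thesis using assms xy unfolding encode_def by (auto simp: insert_commute)
qed

lemma shift_encode_below:
  assumes "(x, y) \<in> encode f n T" "y < s" "s < n"
  shows "(x + n - s, y + n - s) \<in> encode (\<lambda>i. f ((i + s) mod n)) n T"
proof -
  have xy: "x < y" "y < n" "{f x, f y} \<in> T" using assms(1) unfolding encode_def by auto
  have "x + n - s + s = x + n" "y + n - s + s = y + n" using assms xy by auto
  then have "(x + n - s + s) mod n = x" "(y + n - s + s) mod n = y" using xy by auto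
  then show ?thesis using assms xy unfolding encode_def by auto
qed

lemma many_neighbours_left:
  assumes T: "polygon_triangulation P T" and c: "(0, c) \<in> encode f n T" "c \<noteq> n - 1"
  shows "card {j. 0 < j \<and> j < c \<and> (0, j) \<in> encode f n T} + 3 \<le> card (fan {..<n} 0 (encode f n T))"
proof -
  let ?A = "{j. 0 < j \<and> j < c \<and> (0, j) \<in> encode f n T}"
  have tr: "tri {..<n} (encode f n T)" using tri_encode[OF T] .
  have cn: "0 < c" "c < n" using tri_in[OF tr c(1)] by auto
  have "(0, n - 1) \<in> encode f n T" using n3 by (intro tri_outer[OF tr]) auto
  then have "?A \<union> {0, c, n - 1} \<subseteq> fan {..<n} 0 (encode f n T)" using c cn unfolding fan_def by auto
  then have "card (?A \<union> {0, c, n - 1}) \<le> card (fan {..<n} 0 (encode f n T))"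
    by (rule card_mono[rotated]) (simp add: fan_def)
  moreover have "card (?A \<union> {0, c, n - 1}) = card ?A + card {0, c, n - 1}"
    using cn c(2) by (intro card_Un_disjoint) auto
  moreover have "card {0, c, n - 1} = 3" using cn c(2) by auto
  ultimately show ?thesis by linarith
qed

lemma many_neighbours_right:
  assumes T: "polygon_triangulation P T" and c: "(0, c) \<in> encode f n T" "c \<noteq> n - 1"
  shows "card {j. 0 < j \<and> j < c \<and> (j, c) \<in> encode f n T} + 3 \<le> card (fan {..<n} 0 (encode (\<lambda>i. f ((i + c) mod n)) n T))"
proof -
  let ?A = "{j. 0 < j \<and> j < c \<and> (j, c) \<in> encode f n T}"
  let ?E = "encode (\<lambda>i. f ((i + c) mod n)) n T"
  have tr: "tri {..<n} (encode f n T)" using tri_encode[OF T] .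
  have cn: "0 < c" "c < n" using tri_in[OF tr c(1)] by auto
  then interpret g: labelled_polygon P n "\<lambda>i. f ((i + c) mod n)" using shift_labelled by blast
  have trg: "tri {..<n} ?E" using g.tri_encode[OF T] .
  let ?h = "\<lambda>j. j + (n - c)"
  have e: "(0, ?h j) \<in> ?E" if "(j, c) \<in> encode f n T" for j
    using shift_encode_wrap[OF that, of c] tri_in[OF tr that] cn by simp
  have 1: "(0, 1) \<in> ?E" using tri_lessThan_consec[OF trg, of 0] n3 by simp
  have "(0, ?h 0) \<in> ?E" using e[OF c(1)] .
  then have "?h ` ?A \<union> {0, 1, n - c} \<subseteq> fan {..<n} 0 ?E" using 1 e cn n3 unfolding fan_def by auto
  then have "card (?h ` ?A \<union> {0, 1, n - c}) \<le> card (fan {..<n} 0 ?E)"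
    by (rule card_mono[rotated]) (simp add: fan_def)
  moreover have "card (?h ` ?A \<union> {0, 1, n - c}) = card (?h ` ?A) + card {0, 1, n - c}"
    using cn c(2) by (intro card_Un_disjoint) auto
  moreover have "card {0, 1, n - c} = 3" using cn c(2) by auto
  moreover have "card (?h ` ?A) = card ?A" by (intro card_image inj_onI) auto
  ultimately show ?thesis by linarith
qed

end

section \<open>Triangulations without a large fan\<close>

text \<open>The aim is to number the vertices such that \<open>excess_across\<close> applies. Choose a numbering and an edge
  \<open>0c\<close> of \<open>T\<close> that cuts off a minimal number \<open>n - 1 - c > K\<close> of vertices. Both edges of the triangle
  behind \<open>0c\<close> cut off at most \<open>K\<close>, so \<open>0c\<close> cuts off at most \<open>2 * K + 1\<close>. If at least \<open>K\<close> of the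
  vertices in front of \<open>0c\<close> are adjacent neither to \<open>0\<close> nor to \<open>c\<close>, this edge will do. Otherwise the
  bound on the degrees implies that \<open>0\<close> and \<open>c\<close> both have many neighbours there. Then the edge from \<open>c\<close> to their
  common neighbour \<open>y\<close> has many neighbours of \<open>c\<close> on one side, and on the other side the vertices in
  front of the last edge \<open>0u\<close> before \<open>y\<close>, which are adjacent neither to \<open>c\<close> nor to \<open>y\<close>.\<close>

lemma excess_if_degrees_small:
  assumes P: "convex_polygon P" and n: "n = card (vertices P)" and T: "polygon_triangulation P T"
    and K: "1 \<le> K" "8 * K + 12 \<le> n"
    and small: "\<And>v. v \<in> vertices P \<Longrightarrow> card {e \<in> interior_edges P T. v \<in> e} + 2 < 4 * K"
  shows "\<exists>f. labelled_polygon P n f \<and> excess_ge {..<n} (encode f n T) K"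
proof -
  have small': "card (fan {..<n} 0 (encode f n T)) \<le> 4 * K" if "labelled_polygon P n f" for f
  proof -
    interpret labelled_polygon P n f by fact
    have "f 0 \<in> vertices P" using range n3 by auto
    then show ?thesis using small[of "f 0"] card_fan[OF T] by linarith
  qed
  define Q where "Q = (\<lambda>(f, c). labelled_polygon P n f \<and> (0, c) \<in> encode f n T \<and> K + 1 \<le> n - 1 - c)"
  define size where "size = (\<lambda>(f :: nat \<Rightarrow> real^2, c). n - 1 - c)"
  have "\<exists>x. Q x"
  proof -
    have "card (vertices P) \<noteq> 0" using K n by simp
    then obtain v where "v \<in> vertices P" by fastforce
    then obtain f where "cyclic_labelling f n (vertices P)"
      using cyclic_labelling_exists[OF convex_position_vertices[OF P]] n by metis
    then interpret labelled_polygon P n f using P n by unfold_locales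
    have "(0, 1) \<in> encode f n T" using tri_lessThan_consec[OF tri_encode[OF T], of 0] n3 by simp
    then have "Q (f, 1)" unfolding Q_def using labelled_polygon_axioms K by simp
    then show ?thesis by blast
  qed
  then obtain x where x: "Q x" and least: "\<And>y. Q y \<Longrightarrow> size x \<le> size y"
    using ex_has_least_nat[of Q _ size] by blast
  obtain f c where fc: "x = (f, c)" by (cases x)
  have lf: "labelled_polygon P n f" and c: "(0, c) \<in> encode f n T" and big: "K + 1 \<le> n - 1 - c"
    using x unfolding fc Q_def by auto
  have least': "n - 1 - c \<le> n - 1 - d" if "labelled_polygon P n g" "(0, d) \<in> encode g n T" "K + 1 \<le> n - 1 - d" for g d
    using least[of "(g, d)"] that unfolding Q_def size_def fc by simp
  interpret f: labelled_polygon P n f by fact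
  let ?E = "encode f n T"
  have tr: "tri {..<n} ?E" using f.tri_encode[OF T] .
  have cn: "0 < c" "c < n" using tri_in[OF tr c] by auto
  have c1: "c < n - 1" using big K by linarith
  note pn = planarD[OF triD(2)[OF tr]]
  have "(0, n - 1) \<in> ?E" using f.n3 by (intro tri_outer[OF tr]) auto
  then obtain q where q: "(0, q) \<in> ?E" "q \<le> n - 1" "c < q" "\<And>y. c < y \<Longrightarrow> y < q \<Longrightarrow> (0, y) \<notin> ?E"
    using smallest_above[of "\<lambda>y. (0, y) \<in> ?E" "n - 1" c] c1 by blast
  have cq: "(c, q) \<in> ?E" using fan_step_left[OF tr q(1) c q(3)] q(4) by blast
  have qn: "q < n" using tri_in[OF tr q(1)] by simp
  \<comment> \<open>minimality, applied to the edge \<open>0q\<close> in the same numbering and to \<open>cq\<close> in the numbering that starts at \<open>q\<close>\<close>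
  have s1: "n - 1 - q \<le> K" using least'[OF lf q(1)] q(3) qn by linarith
  have s2: "q - 1 - c \<le> K"
  proof (rule ccontr)
    assume *: "\<not> q - 1 - c \<le> K"
    have "(0, c + n - q) \<in> encode (\<lambda>i. f ((i + q) mod n)) n T"
      using f.shift_encode_wrap[OF cq, of q] q(3) by simp
    moreover have e: "n - 1 - (c + n - q) = q - 1 - c" using q(3) qn by linarith
    ultimately have "n - 1 - c \<le> q - 1 - c"
      using least'[OF f.shift_labelled[OF qn], of "c + n - q"] * by simp
    then show False using q(3) qn by linarith
  qed
  have c_large: "6 * K + 10 \<le> c" using s1 s2 q(3) qn K by linarith
  let ?J = "{j. 0 < j \<and> j < c \<and> (0, j) \<notin> ?E \<and> (j, c) \<notin> ?E}"
  show ?thesis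
  proof (cases "K \<le> card ?J")
    case True
    then show ?thesis using excess_across[OF tr c K(1) big] lf by blast
  next
    case False
    let ?A = "{j. 0 < j \<and> j < c \<and> (0, j) \<in> ?E}" and ?C = "{j. 0 < j \<and> j < c \<and> (j, c) \<in> ?E}"
    \<comment> \<open>the numbering that starts at \<open>c\<close>\<close>
    let ?g = "\<lambda>i. f ((i + c) mod n)"
    have lg: "labelled_polygon P n ?g" using f.shift_labelled[OF cn(2)] .
    interpret g: labelled_polygon P n ?g by fact
    let ?G = "encode ?g n T"
    have trg: "tri {..<n} ?G" using g.tri_encode[OF T] .
    have A: "card ?A + 3 \<le> 4 * K" using f.many_neighbours_left[OF T c] small'[OF lf] c1 by linarith
    have C: "card ?C + 3 \<le> 4 * K" using f.many_neighbours_right[OF T c] small'[OF lg] c1 by linarith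
    have "{0<..<c} = ?J \<union> (?A \<union> ?C)" by auto
    then have "card {0<..<c} = card (?J \<union> (?A \<union> ?C))" by (rule arg_cong)
    then have "c - 1 \<le> card ?J + (card ?A + card ?C)"
      using card_Un_le[of ?J "?A \<union> ?C"] card_Un_le[of ?A ?C] by simp
    then have A': "K + 13 \<le> card ?A" and C': "K + 13 \<le> card ?C" using A C False c_large by linarith+
    have "(0, 1) \<in> ?E" using tri_lessThan_consec[OF tr, of 0] f.n3 by simp
    note one = this
    obtain y where y: "(0, y) \<in> ?E" "1 \<le> y" "y < c" "\<And>z. y < z \<Longrightarrow> z < c \<Longrightarrow> (0, z) \<notin> ?E"
      using largest_below[of "\<lambda>z. (0, z) \<in> ?E" 1 c] one c_large K by auto
    have yc: "(y, c) \<in> ?E" using fan_step_left[OF tr c y(1,3)] y(4) by blast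
    have "?A \<subseteq> {1..y}"
    proof
      fix j assume "j \<in> ?A"
      then show "j \<in> {1..y}" using y(4)[of j] by (cases "y < j") auto
    qed
    then have ylarge: "K + 13 \<le> y" using card_mono[of "{1..y}" ?A] A' by simp
    have "?C \<subseteq> {y..<c}"
    proof
      fix j assume j: "j \<in> ?C"
      then have "\<not> j < y" using pn[OF y(1), of j c] y(3) by auto
      then show "j \<in> {y..<c}" using j by auto
    qed
    then have cy: "K + 13 \<le> c - y" using card_mono[of "{y..<c}" ?C] C' by simp
    obtain u where u: "(0, u) \<in> ?E" "1 \<le> u" "u < y" "\<And>z. u < z \<Longrightarrow> z < y \<Longrightarrow> (0, z) \<notin> ?E"
      using largest_below[of "\<lambda>z. (0, z) \<in> ?E" 1 y] one ylarge by auto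
    have "?A \<subseteq> insert y {1..u}"
    proof
      fix j assume j: "j \<in> ?A"
      show "j \<in> insert y {1..u}"
        using j y(4)[of j] u(4)[of j] by (cases j y rule: linorder_cases; cases "u < j") auto
    qed
    then have "card ?A \<le> card (insert y {1..u})" by (intro card_mono) auto
    also have "\<dots> \<le> Suc u" by (simp add: card_insert_if)
    finally have ularge: "K + 12 \<le> u" using A' by linarith
    \<comment> \<open>the new numbers of \<open>y\<close>, \<open>0\<close> and \<open>u\<close> are \<open>?d\<close>, \<open>n - c\<close> and \<open>u + n - c\<close>\<close>
    let ?d = "y + n - c"
    have d: "(0, ?d) \<in> ?G" using f.shift_encode_wrap[OF yc, of c] y(3) by simp
    have cut: "(n - c, u + n - c) \<in> ?G" using f.shift_encode_below[OF u(1), of c] u(3) y(3) cn by simp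
    have ud: "u + n - c < ?d" using u(3) cn by linarith
    have dn: "n - 1 - ?d = c - 1 - y" using y(3) cn by linarith
    have "{n - c<..<u + n - c} \<subseteq> {j. 0 < j \<and> j < ?d \<and> (0, j) \<notin> ?G \<and> (j, ?d) \<notin> ?G}"
    proof
      fix j assume "j \<in> {n - c<..<u + n - c}"
      then have j: "n - c < j" "j < u + n - c" by auto
      have "(0, j) \<notin> ?G" using planarD[OF triD(2)[OF trg] _ cut, of 0 j] j cn by auto
      moreover have "(j, ?d) \<notin> ?G" using planarD[OF triD(2)[OF trg] cut, of j ?d] j ud by auto
      ultimately show "j \<in> {j. 0 < j \<and> j < ?d \<and> (0, j) \<notin> ?G \<and> (j, ?d) \<notin> ?G}" using j u(3) by auto
    qed
    then have "card {n - c<..<u + n - c} \<le> card {j. 0 < j \<and> j < ?d \<and> (0, j) \<notin> ?G \<and> (j, ?d) \<notin> ?G}"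
      by (intro card_mono) auto
    moreover have "card {n - c<..<u + n - c} = u - 1" using cn by simp
    ultimately have "K \<le> card {j. 0 < j \<and> j < ?d \<and> (0, j) \<notin> ?G \<and> (j, ?d) \<notin> ?G}" using ularge by linarith
    then show ?thesis using excess_across[OF trg d K(1)] dn cy lg by auto
  qed
qed

section \<open>Distances in the flip-graph and eccentricities\<close>

lemma awalk_if_path:
  assumes "(flips P ^^ m) T T'" "polygon_triangulation P T"
  shows "\<exists>p. pre_digraph.awalk (with_proj (flip_graph P)) T p T' \<and> length p = m"
  using assms
proof (induction m arbitrary: T)
  case 0
  then show ?case by (intro exI[of _ "[]"]) (simp add: pre_digraph.awalk_def pre_digraph.cas.simps flip_graph_def)
next
  case (Suc m)
  then obtain S where S: "flips P T S" "(flips P ^^ m) S T'" by (elim relpowp_Suc_E2)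
  then have "polygon_triangulation P S" unfolding flips_def by blast
  then obtain p where p: "pre_digraph.awalk (with_proj (flip_graph P)) S p T'" "length p = m" using Suc.IH[OF S(2)] by blast
  then have "pre_digraph.awalk (with_proj (flip_graph P)) T ((T, S) # p) T'"
    using S(1) Suc.prems(2) by (simp add: pre_digraph.awalk_def pre_digraph.cas.simps flip_graph_def)
  then show ?case using p(2) by (intro exI[of _ "(T, S) # p"]) simp
qed

lemma path_if_awalk:
  assumes "pre_digraph.awalk (with_proj (flip_graph P)) T p T'"
  shows "(flips P ^^ length p) T T'"
  using assms
proof (induction p arbitrary: T)
  case Nil
  then show ?case by (simp add: pre_digraph.awalk_def pre_digraph.cas.simps)
next
  case (Cons e p)
  obtain A B where e: "e = (A, B)" by (cases e)
  have A: "A = T" "flips P T B" and p: "set p \<subseteq> parcs (flip_graph P)" "pre_digraph.cas (with_proj (flip_graph P)) B p T'"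
    using Cons.prems unfolding e by (auto simp: pre_digraph.awalk_def pre_digraph.cas.simps flip_graph_def)
  have "polygon_triangulation P B" using A(2) unfolding flips_def by blast
  then have "pre_digraph.awalk (with_proj (flip_graph P)) B p T'"
    using p by (simp add: pre_digraph.awalk_def flip_graph_def)
  then have "(flips P ^^ length p) B T'" by (rule Cons.IH)
  then show ?case using relpowp_Suc_I2[of "flips P" T B "length p" T'] A by simp
qed

lemma wf_flip_graph:
  assumes "convex_polygon P" shows "wf_digraph (with_proj (flip_graph P))"
proof -
  interpret pair_graph "flip_graph P" using pair_graph_flip_graph[OF assms] .
  show ?thesis by (rule wf_digraph_axioms)
qed

lemma awalk_cost_unit:
  fixes G :: "('a, 'b) pre_digraph" and p :: "'b list"
  assumes "wf_digraph G" shows "wf_digraph.awalk_cost (\<lambda>_. 1) p = real (length p)"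
  unfolding wf_digraph.awalk_cost_def[OF assms] by (induction p) auto

lemma eccentricity_le:
  assumes P: "convex_polygon P" and T: "polygon_triangulation P T"
    and path: "\<And>T'. polygon_triangulation P T' \<Longrightarrow> \<exists>m\<le>N. (flips P ^^ m) T T'"
  shows "eccentricity (flip_graph P) T \<le> ereal (real N)"
  unfolding eccentricity_def
proof (rule SUP_least)
  fix T' assume "T' \<in> verts (with_proj (flip_graph P))"
  then have "polygon_triangulation P T'" by (simp add: flip_graph_def)
  then obtain m where m: "m \<le> N" "(flips P ^^ m) T T'" using path by blast
  obtain p where p: "pre_digraph.awalk (with_proj (flip_graph P)) T p T'" "length p = m"
    using awalk_if_path[OF m(2) T] by blast
  have "wf_digraph.\<mu> (with_proj (flip_graph P)) (\<lambda>_. 1) T T' \<le> ereal (wf_digraph.awalk_cost (\<lambda>_. 1) p)"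
    unfolding wf_digraph.\<mu>_def[OF wf_flip_graph[OF P]] using p(1) by (intro INF_lower) simp
  also have "\<dots> \<le> ereal (real N)" using p(2) m(1) by (simp add: awalk_cost_unit[OF wf_flip_graph[OF P]])
  finally show "wf_digraph.\<mu> (with_proj (flip_graph P)) (\<lambda>_. 1) T T' \<le> ereal (real N)" .
qed

lemma eccentricity_ge:
  assumes P: "convex_polygon P" and T': "polygon_triangulation P T'"
    and path: "\<And>m. (flips P ^^ m) T T' \<Longrightarrow> N \<le> m"
  shows "ereal (real N) \<le> eccentricity (flip_graph P) T"
proof -
  have "ereal (real N) \<le> wf_digraph.\<mu> (with_proj (flip_graph P)) (\<lambda>_. 1) T T'"
    unfolding wf_digraph.\<mu>_def[OF wf_flip_graph[OF P]]
  proof (rule INF_greatest)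
    fix p assume "p \<in> {p. pre_digraph.awalk (with_proj (flip_graph P)) T p T'}"
    then have "N \<le> length p" using path path_if_awalk by blast
    then show "ereal (real N) \<le> ereal (wf_digraph.awalk_cost (\<lambda>_. 1) p)" by (simp add: awalk_cost_unit[OF wf_flip_graph[OF P]])
  qed
  also have "\<dots> \<le> eccentricity (flip_graph P) T"
    unfolding eccentricity_def using T' by (intro SUP_upper) (simp add: flip_graph_def)
  finally show ?thesis .
qed

theorem theorem1p3:
  fixes P :: "(real^2) set" and n :: nat and k :: int and T :: "(real^2) set set"
  assumes "convex_polygon P"
    and "card (vertices P) = n"
    and "real_of_int k \<le> real n / 8 - 5 / 2"
    and "polygon_triangulation P T"
  shows "eccentricity (flip_graph P) T = ereal (real n - 3 + real_of_int k) \<longleftrightarrow>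
    (\<exists>v\<in>vertices P. int (card {e \<in> interior_edges P T. v \<in> e}) = int n - 3 - k)"
proof -
  note P = assms(1) and T = assms(4)
  let ?ecc = "eccentricity (flip_graph P) T"
  let ?deg = "\<lambda>v. card {e \<in> interior_edges P T. v \<in> e}"
  have k: "8 * k + 20 \<le> int n" using assms(3) by linarith
  have n3: "3 \<le> n" using card_vertices_ge_3[OF P] assms(2) by simp
  have labelling: "\<exists>f. labelled_polygon P n f \<and> f 0 = v" if v: "v \<in> vertices P" for v
  proof -
    obtain f where "cyclic_labelling f n (vertices P)" "f 0 = v"
      using cyclic_labelling_exists[OF convex_position_vertices[OF P] v] assms(2) by metis
    then show ?thesis using P assms(2) unfolding labelled_polygon_def by blast
  qed
  have upper: "?ecc \<le> ereal (real (2 * (n - 3) - ?deg v)) \<and> ?deg v \<le> n - 3" if v: "v \<in> vertices P" for v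
  proof -
    obtain f where f: "labelled_polygon P n f" "f 0 = v" using labelling[OF v] by blast
    interpret labelled_polygon P n f by fact
    have "card (fan {..<n} 0 (encode f n T)) \<le> card {..<n}" unfolding fan_def by (intro card_mono) auto
    then have "?deg v \<le> n - 3" using card_fan[OF T] f(2) by simp
    moreover have "?ecc \<le> ereal (real (2 * (n - 3) - ?deg v))"
    proof (rule eccentricity_le[OF P T])
      fix T' assume "polygon_triangulation P T'"
      then obtain m where "(flips P ^^ m) T T'" "m + ?deg v \<le> 2 * (n - 3)"
        using distance_bound[OF T] f(2) by blast
      then show "\<exists>m\<le>2 * (n - 3) - ?deg v. (flips P ^^ m) T T'" by (intro exI[of _ m]) simp
    qed
    ultimately show ?thesis by simp
  qed
  have lower_far: "ereal (real (n - 3 + K)) \<le> ?ecc" if f: "labelled_polygon P n f" "excess_ge {..<n} (encode f n T) K" for f K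
  proof -
    interpret labelled_polygon P n f by fact
    obtain T' where "polygon_triangulation P T'" "\<And>m. (flips P ^^ m) T T' \<Longrightarrow> n - 3 + K \<le> m"
      using far_triangulation_exists[OF T f(2)] by blast
    then show ?thesis by (rule eccentricity_ge[OF P])
  qed
  have lower: "ereal (real (n - 3 + K)) \<le> ?ecc" if v: "v \<in> vertices P" "K + ?deg v \<le> n - 3" "4 * K \<le> ?deg v + 2" for v K
  proof -
    obtain f where f: "labelled_polygon P n f" "f 0 = v" using labelling[OF v(1)] by blast
    interpret labelled_polygon P n f by fact
    show ?thesis using lower_far[OF f(1) excess_at_vertex[OF T]] v f(2) by simp
  qed
  show ?thesis
  proof
    assume "\<exists>v\<in>vertices P. int (?deg v) = int n - 3 - k"
    then obtain v where v: "v \<in> vertices P" "int (?deg v) = int n - 3 - k" by blast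
    have dn: "?deg v \<le> n - 3" using upper[OF v(1)] by blast
    then have k0: "0 \<le> k" using v(2) n3 by linarith
    have lo: "ereal (real (n - 3 + nat k)) \<le> ?ecc" using v k k0 dn by (intro lower[OF v(1)]) linarith+
    have lo_eq: "real (n - 3 + nat k) = real n - 3 + real_of_int k" using k0 n3 by simp
    have "int (2 * (n - 3) - ?deg v) = int n - 3 + k" using v(2) dn n3 by linarith
    then have up_eq: "real (2 * (n - 3) - ?deg v) = real n - 3 + real_of_int k" by linarith
    have "?ecc \<le> ereal (real (2 * (n - 3) - ?deg v))" using upper[OF v(1)] by blast
    then show "?ecc = ereal (real n - 3 + real_of_int k)" using lo unfolding lo_eq up_eq by (rule antisym)
  next
    assume ecc: "?ecc = ereal (real n - 3 + real_of_int k)"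
    show "\<exists>v\<in>vertices P. int (?deg v) = int n - 3 - k"
    proof (rule ccontr)
      assume none: "\<not> (\<exists>v\<in>vertices P. int (?deg v) = int n - 3 - k)"
      have "vertices P \<noteq> {}" using n3 assms(2) by auto
      then obtain v0 where v0: "v0 \<in> vertices P" by blast
      have "ereal (real (n - 3 + 0)) \<le> ?ecc" using upper[OF v0] by (intro lower[OF v0]) auto
      then have k0: "0 \<le> k" unfolding ecc using n3 by simp
      have less: "int (?deg v) + k + 1 \<le> int n - 3" if v: "v \<in> vertices P" for v
      proof -
        have "ereal (real n - 3 + real_of_int k) \<le> ereal (real (2 * (n - 3) - ?deg v))"
          using upper[OF v] unfolding ecc by blast
        then have "real n - 3 + real_of_int k \<le> real (2 * (n - 3) - ?deg v)" by (simp only: ereal_less_eq)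
        then have "int n - 3 + k \<le> int (2 * (n - 3) - ?deg v)" by linarith
        moreover have "?deg v \<le> n - 3" using upper[OF v] by blast
        ultimately have "int (?deg v) \<le> int n - 3 - k" using n3 by linarith
        moreover have "int (?deg v) \<noteq> int n - 3 - k" using none v by blast
        ultimately show ?thesis by linarith
      qed
      \<comment> \<open>the assumption on \<open>k\<close> becomes \<open>8 * K + 12 \<le> n\<close>, the exact requirement of \<open>excess_if_degrees_small\<close>\<close>
      define K where "K = nat k + 1"
      have int_K: "int K = k + 1" unfolding K_def using k0 by simp
      then have K: "1 \<le> K" "8 * K + 12 \<le> n" "int K = k + 1" using k k0 by linarith+
      have "ereal (real (n - 3 + K)) \<le> ?ecc"
      proof (cases "\<exists>v\<in>vertices P. 4 * K \<le> ?deg v + 2")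
        case True
        then obtain v where v: "v \<in> vertices P" "4 * K \<le> ?deg v + 2" by blast
        show ?thesis using less[OF v(1)] K(3) n3 v by (intro lower[OF v(1)]) linarith+
      next
        case False
        then obtain f where "labelled_polygon P n f" "excess_ge {..<n} (encode f n T) K"
          using excess_if_degrees_small[OF P assms(2)[symmetric] T K(1,2)] by (meson not_le)
        then show ?thesis by (rule lower_far)
      qed
      then have "real (n - 3 + K) \<le> real n - 3 + real_of_int k" unfolding ecc by simp
      then show False using K(3) n3 by (simp add: of_nat_diff)
    qed
  qed
qed

end
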